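(* Suppose Player 1 and Player 2 simultaneously run, respectively, the Player-1 and Player-2 algorithms described in the context, with $\eta=\sqrt{\log|\mathcal A|/(KH^2)}$ and $\gamma=\sqrt{|\mathcal S|\log|\mathcal B|/K}$. Let $T=KH$. Then, with probability at least $1-5\delta$, the optimality gap satisfies $$\mathrm{Gap}(K)\le\tilde O\big(\sqrt T\big),$$ where $\tilde O$ hides logarithmic factors in $|\mathcal S|,|\mathcal A|,|\mathcal B|,H,K$ and $1/\delta$.
   Context: Notation. $[n]=\{1,\dots,n\}$; $\Delta_X$ is the probability simplex over a finite set $X$; $\langle f,g\rangle_X=\sum_{x\in X}f(x)g(x)$; $\{x\}^+=\max\{x,0\}$; $\boldsymbol 1,\boldsymbol 0$ are all-ones and zero vectors/functions; $\mathbf 1_{\{\cdot\}}$ is the indicator. $\delta\in(0,1)$. Game (single-controller transition). $\mathcal S,\mathcal A,\mathcal B$ are finite sets (states, actions of Player 1, actions of Player 2), $H$ is the episode length, $K$ the number of episodes. The transitions, unknown to the players, are controlled by Player 1 only: $\mathcal P_h(s'|s,a,b)=\mathcal P_h(s'|s,a)$, $h\in[H]$. The reward functions are $r_h:\mathcal S\times\mathcal A\times\mathcal B\to[0,1]$. Policies are $\mu=\{\mu_h\}_{h=1}^H$, $\mu_h(\cdot|s)\in\Delta_{\mathcal A}$ (Player 1) and $\nu=\{\nu_h\}_{h=1}^H$, $\nu_h(\cdot|s)\in\Delta_{\mathcal B}$ (Player 2). The value function is $V_h^{\mu,\nu}(s)=\mathbb E[\sum_{h'=h}^H r_{h'}(s_{h'},a_{h'},b_{h'})\mid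 s_h=s]$ under $\mu,\nu,\mathcal P$. Protocol. Every episode $k\in[K]$ starts at a fixed $s_1$. At the beginning of episode $k$ each player observes the opponent's policy of episode $k-1$; the players choose $\mu^k,\nu^k$ and move simultaneously, and a trajectory $\{(s_h^k,a_h^k,b_h^k,s_{h+1}^k)\}_{h=1}^H$ is generated with $a_h^k\sim\mu_h^k(\cdot|s_h^k)$, $b_h^k\sim\nu_h^k(\cdot|s_h^k)$, $s_{h+1}^k\sim\mathcal P_h(\cdot|s_h^k,a_h^k)$. At the end of the episode the players observe only the trajectory and the bandit rewards $r_h^k(s_h^k,a_h^k,b_h^k)$ along it, where the time-varying rewards $r_h^k(\cdot,\cdot,\cdot)\in[0,1]$ have expectation $r_h=\mathbb E[r_h^k]$. Optimality gap. $\mathrm{Gap}(K)=\mathrm{Regret}_1(K)+\mathrm{Regret}_2(K)$, with $\mathrm{Regret}_1(K)=\sum_{k=1}^K[V_1^{\mu^*,\nu^k}(s_1)-V_1^{\mu^k,\nu^k}(s_1)]$, $\mu^*\in\arg\max_\mu\sum_{k=1}^K V_1^{\mu,\nu^k}(s_1)$, and $\mathrm{Regret}_2(K)=\sum_{k=1}^K[V_1^{\mu^k,\nu^k}(s_1)-V_1^{\mu^k,\nu^*}(s_1)]$, $\nu^*\in\arg\min_\nu\sum_{k=1}^K V_1^{\mu^k,\nu}(s_1)$. Estimates. For $k\ge1$ let $N_h^k(s,a,b)$, $N_h^k(s,a)$ be the numbers of episodes $\tau\le k$ in which the indicated tuple is visited at step $h$, and $\hat r_h^k(s,a,b)=\frac{\sum_{\tau=1}^k\mathbf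 1_{\{(s,a,b)=(s_h^\tau,a_h^\tau,b_h^\tau)\}}r_h^\tau(s,a,b)}{\max\{N_h^k(s,a,b),1\}}$, $\hat{\mathcal P}_h^k(s'|s,a)=\frac{\sum_{\tau=1}^k\mathbf 1_{\{(s,a,s')=(s_h^\tau,a_h^\tau,s_{h+1}^\tau)\}}}{\max\{N_h^k(s,a),1\}}$. Bonus: $\beta_h^k(s,a,b)=\beta_h^{r,k}(s,a,b)+\beta_h^{\mathcal P,k}(s,a)$ with $\beta_h^{r,k}(s,a,b)=\sqrt{\frac{4\log(|\mathcal S||\mathcal A||\mathcal B|HK/\delta)}{\max\{N_h^k(s,a,b),1\}}}$ and $\beta_h^{\mathcal P,k}(s,a)=\sqrt{\frac{2H^2|\mathcal S|\log(|\mathcal S||\mathcal A|HK/\delta)}{\max\{N_h^k(s,a),1\}}}$. For $k=0$: $\hat{\mathcal P}_h^0(\cdot|s,a)=\boldsymbol 1/|\mathcal S|$, $\hat r_h^0=\beta_h^0=\beta_h^{r,0}=\boldsymbol 0$. The empirical state reaching probability $d_h^{\mu^k,\hat{\mathcal P}^k}(s)$ is the probability of $s_h=s$ starting from $s_1$ under $\mu^k$ and $\hat{\mathcal P}^k$, i.e. $d_1(s)=\mathbf 1_{\{s=s_1\}}$, $d_h(s)=\sum_{s',a'}d_{h-1}(s')\mu_{h-1}^k(a'|s')\hat{\mathcal P}_{h-1}^k(s|s',a')$. Player-1 algorithm. $\mu_h^0(\cdot|s)=\boldsymbol 1/|\mathcal A|$. In episode $k=1,\dots,K$: observe $\nu^{k-1}$;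 set $\overline V_{H+1}^{k-1}=\boldsymbol 0$; for $h=H,\dots,1$ set $\overline Q_h^{k-1}(s,a,b)=\min\{\hat r_h^{k-1}(s,a,b)+\sum_{s'}\hat{\mathcal P}_h^{k-1}(s'|s,a)\overline V_{h+1}^{k-1}(s')+\beta_h^{k-1}(s,a,b),\,H-h+1\}^+$ and $\overline V_h^{k-1}(s)=[\mu_h^{k-1}(\cdot|s)]^\top\overline Q_h^{k-1}(s,\cdot,\cdot)\nu_h^{k-1}(\cdot|s)$; update $\mu_h^k(a|s)\propto\mu_h^{k-1}(a|s)\exp\{\eta\langle\overline Q_h^{k-1}(s,a,\cdot),\nu_h^{k-1}(\cdot|s)\rangle_{\mathcal B}\}$ (normalized over $a$); play $\mu^k$. Player-2 algorithm. $\nu_h^0(\cdot|s)=\boldsymbol 1/|\mathcal B|$. In episode $k=1,\dots,K$: observe $\mu^{k-1}$; set $\tilde r_h^{k-1}(s,a,b)=\max\{\hat r_h^{k-1}(s,a,b)-\beta_h^{r,k-1}(s,a,b),0\}$; update $\nu_h^k(b|s)\propto\nu_h^{k-1}(b|s)\exp\{-\gamma\,d_h^{\mu^{k-1},\hat{\mathcal P}^{k-1}}(s)\,\langle\tilde r_h^{k-1}(s,\cdot,b),\mu_h^{k-1}(\cdot|s)\rangle_{\mathcal A}\}$ (normalized over $b$); play $\nu^k$.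
   Formalization: The bound carries an extra factor polynomial in |S|,|A|,|B|,H with universal exponents, as hiding only logarithms is false (K=1, |S|=|B|=1, |A|=2: Gap=H/2); the rewards are assumed to have mean r_h conditionally on the past, not just marginally. *)

theory Defs
  imports "HOL-Probability.Probability"
begin

type_synonym ('s, 'x) policy = "nat \<Rightarrow> 's \<Rightarrow> 'x \<Rightarrow> real"

definition prob_simplex :: "'x set \<Rightarrow> ('x \<Rightarrow> real) set" where
  "prob_simplex X = {p. (\<forall>x\<in>X. 0 \<le> p x) \<and> (\<Sum>x\<in>X. p x) = 1}"

definition policies :: "nat \<Rightarrow> 's set \<Rightarrow> 'x set \<Rightarrow> ('s, 'x) policy set" where
  "policies H S X = {\<pi>. \<forall>h\<in>{1..H}. \<forall>s\<in>S. \<pi> h s \<in> prob_simplex X}"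

definition normalized :: "'x set \<Rightarrow> ('x \<Rightarrow> real) \<Rightarrow> 'x \<Rightarrow> real" where
  "normalized X w x = w x / (\<Sum>y\<in>X. w y)"


text \<open>
  Episodic zero-sum Markov game with single-controller transitions: \<open>P h s a s'\<close> is the probability
  of moving from \<open>s\<close> to \<open>s'\<close> at step \<open>h\<close> when Player 1 plays \<open>a\<close>. Steps are numbered \<open>1..H\<close>;
  functions are only meaningful on \<open>S\<close>, \<open>A\<close>, \<open>B\<close> and on these steps.
\<close>

locale markov_game =
  fixes S :: "'s set" and A :: "'a set" and B :: "'b set" and H :: nat and s1 :: 's
    and P :: "nat \<Rightarrow> 's \<Rightarrow> 'a \<Rightarrow> 's \<Rightarrow> real"
    and r :: "nat \<Rightarrow> 's \<Rightarrow> 'a \<Rightarrow> 'b \<Rightarrow> real"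
  assumes finite_spaces: "finite S" "finite A" "finite B"
    and nonempty_spaces: "S \<noteq> {}" "A \<noteq> {}" "B \<noteq> {}"
    and horizon_pos: "1 \<le> H"
    and initial_state: "s1 \<in> S"
    and transition: "\<And>h s a. h \<in> {1..H} \<Longrightarrow> s \<in> S \<Longrightarrow> a \<in> A \<Longrightarrow> P h s a \<in> prob_simplex S"
    and reward_range: "\<And>h s a b. h \<in> {1..H} \<Longrightarrow> s \<in> S \<Longrightarrow> a \<in> A \<Longrightarrow> b \<in> B \<Longrightarrow> r h s a b \<in> {0..1}"
begin

text \<open>Trajectories from step \<open>h\<close> to the end of the episode, \<open>\<tau> i = (s\<^sub>i, a\<^sub>i, b\<^sub>i)\<close>, with \<open>s\<^sub>h = s\<close>.\<close>

definition trajs :: "nat \<Rightarrow> 's \<Rightarrow> (nat \<Rightarrow> 's \<times> 'a \<times> 'b) set" where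
  "trajs h s = {\<tau> \<in> {h..H} \<rightarrow>\<^sub>E S \<times> A \<times> B. fst (\<tau> h) = s}"

definition traj_prob ::
  "('s, 'a) policy \<Rightarrow> ('s, 'b) policy \<Rightarrow> nat \<Rightarrow> (nat \<Rightarrow> 's \<times> 'a \<times> 'b) \<Rightarrow> real" where
  "traj_prob \<mu> \<nu> h \<tau> =
     (\<Prod>i\<in>{h..H}. case \<tau> i of (s, a, b) \<Rightarrow> \<mu> i s a * \<nu> i s b) *
     (\<Prod>i\<in>{h..<H}. case \<tau> i of (s, a, b) \<Rightarrow> P i s a (fst (\<tau> (Suc i))))"

text \<open>The conditional expectation of the remaining reward given \<open>s\<^sub>h = s\<close>, for \<open>h \<in> {1..H}\<close>.\<close>

definition V :: "('s, 'a) policy \<Rightarrow> ('s, 'b) policy \<Rightarrow> nat \<Rightarrow> 's \<Rightarrow> real" where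
  "V \<mu> \<nu> h s =
     (\<Sum>\<tau>\<in>trajs h s. traj_prob \<mu> \<nu> h \<tau> * (\<Sum>i\<in>{h..H}. case \<tau> i of (s, a, b) \<Rightarrow> r i s a b))"

end


text \<open>
  The two algorithms run on data indexed by outcomes \<open>\<omega>\<close>: \<open>st k h \<omega>\<close>, \<open>ac k h \<omega>\<close>, \<open>bc k h \<omega>\<close> are the
  state and the two actions at step \<open>h\<close> of episode \<open>k\<close>, and \<open>rw k h\<close> is the (random) reward function
  of that step, which enters the algorithms only through its values at visited triples.
\<close>

locale fictitious_play = markov_game S A B H s1 P r
  for S :: "'s set" and A :: "'a set" and B :: "'b set" and H :: nat and s1 :: 's
    and P :: "nat \<Rightarrow> 's \<Rightarrow> 'a \<Rightarrow> 's \<Rightarrow> real"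
    and r :: "nat \<Rightarrow> 's \<Rightarrow> 'a \<Rightarrow> 'b \<Rightarrow> real" +
  fixes K :: nat and \<delta> :: real
    and st :: "nat \<Rightarrow> nat \<Rightarrow> 'w \<Rightarrow> 's"
    and ac :: "nat \<Rightarrow> nat \<Rightarrow> 'w \<Rightarrow> 'a"
    and bc :: "nat \<Rightarrow> nat \<Rightarrow> 'w \<Rightarrow> 'b"
    and rw :: "nat \<Rightarrow> nat \<Rightarrow> 's \<Rightarrow> 'a \<Rightarrow> 'b \<Rightarrow> 'w \<Rightarrow> real"
  assumes episodes_pos: "1 \<le> K"
    and confidence: "0 < \<delta>" "\<delta> < 1"
begin

definition count_sab :: "'w \<Rightarrow> nat \<Rightarrow> nat \<Rightarrow> 's \<Rightarrow> 'a \<Rightarrow> 'b \<Rightarrow> nat" where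
  "count_sab \<omega> k h s a b = card {\<tau>\<in>{1..k}. st \<tau> h \<omega> = s \<and> ac \<tau> h \<omega> = a \<and> bc \<tau> h \<omega> = b}"

definition count_sa :: "'w \<Rightarrow> nat \<Rightarrow> nat \<Rightarrow> 's \<Rightarrow> 'a \<Rightarrow> nat" where
  "count_sa \<omega> k h s a = card {\<tau>\<in>{1..k}. st \<tau> h \<omega> = s \<and> ac \<tau> h \<omega> = a}"

definition r_hat :: "'w \<Rightarrow> nat \<Rightarrow> nat \<Rightarrow> 's \<Rightarrow> 'a \<Rightarrow> 'b \<Rightarrow> real" where
  "r_hat \<omega> k h s a b =
     (if k = 0 then 0
      else (\<Sum>\<tau>\<in>{1..k}. of_bool (st \<tau> h \<omega> = s \<and> ac \<tau> h \<omega> = a \<and> bc \<tau> h \<omega> = b) * rw \<tau> h s a b \<omega>)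
           / real (max (count_sab \<omega> k h s a b) 1))"

definition P_hat :: "'w \<Rightarrow> nat \<Rightarrow> nat \<Rightarrow> 's \<Rightarrow> 'a \<Rightarrow> 's \<Rightarrow> real" where
  "P_hat \<omega> k h s a s' =
     (if k = 0 then 1 / real (card S)
      else (\<Sum>\<tau>\<in>{1..k}. of_bool (st \<tau> h \<omega> = s \<and> ac \<tau> h \<omega> = a \<and> st \<tau> (Suc h) \<omega> = s'))
           / real (max (count_sa \<omega> k h s a) 1))"

definition bonus_r :: "'w \<Rightarrow> nat \<Rightarrow> nat \<Rightarrow> 's \<Rightarrow> 'a \<Rightarrow> 'b \<Rightarrow> real" where
  "bonus_r \<omega> k h s a b =
     (if k = 0 then 0
      else sqrt (4 * ln (real (card S) * real (card A) * real (card B) * real H * real K / \<delta>)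
                 / real (max (count_sab \<omega> k h s a b) 1)))"

definition bonus_P :: "'w \<Rightarrow> nat \<Rightarrow> nat \<Rightarrow> 's \<Rightarrow> 'a \<Rightarrow> real" where
  "bonus_P \<omega> k h s a =
     (if k = 0 then 0
      else sqrt (2 * (real H)\<^sup>2 * real (card S)
                   * ln (real (card S) * real (card A) * real H * real K / \<delta>)
                 / real (max (count_sa \<omega> k h s a) 1)))"

definition bonus :: "'w \<Rightarrow> nat \<Rightarrow> nat \<Rightarrow> 's \<Rightarrow> 'a \<Rightarrow> 'b \<Rightarrow> real" where
  "bonus \<omega> k h s a b = bonus_r \<omega> k h s a b + bonus_P \<omega> k h s a"

text \<open>\<open>Q_step \<omega> k W h\<close> is the optimistic action value at step \<open>h\<close>, given values \<open>W\<close> at step \<open>h + 1\<close>.\<close>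

definition Q_step :: "'w \<Rightarrow> nat \<Rightarrow> ('s \<Rightarrow> real) \<Rightarrow> nat \<Rightarrow> 's \<Rightarrow> 'a \<Rightarrow> 'b \<Rightarrow> real" where
  "Q_step \<omega> k W h s a b =
     max (min (r_hat \<omega> k h s a b + (\<Sum>s'\<in>S. P_hat \<omega> k h s a s' * W s') + bonus \<omega> k h s a b)
              (real H - real h + 1)) 0"

function V_bar ::
  "'w \<Rightarrow> nat \<Rightarrow> ('s, 'a) policy \<Rightarrow> ('s, 'b) policy \<Rightarrow> nat \<Rightarrow> 's \<Rightarrow> real" where
  "V_bar \<omega> k \<mu> \<nu> h =
     (if h > H then (\<lambda>s. 0)
      else (\<lambda>s. \<Sum>a\<in>A. \<Sum>b\<in>B. \<mu> h s a * Q_step \<omega> k (V_bar \<omega> k \<mu> \<nu> (Suc h)) h s a b * \<nu> h s b))"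
  by pat_completeness auto
termination
  by (relation "Wellfounded.measure (\<lambda>(\<omega>, k, \<mu>, \<nu>, h). Suc H - h)") auto

declare V_bar.simps [simp del]

definition Q_bar ::
  "'w \<Rightarrow> nat \<Rightarrow> ('s, 'a) policy \<Rightarrow> ('s, 'b) policy \<Rightarrow> nat \<Rightarrow> 's \<Rightarrow> 'a \<Rightarrow> 'b \<Rightarrow> real" where
  "Q_bar \<omega> k \<mu> \<nu> h = Q_step \<omega> k (V_bar \<omega> k \<mu> \<nu> (Suc h)) h"

definition r_tilde :: "'w \<Rightarrow> nat \<Rightarrow> nat \<Rightarrow> 's \<Rightarrow> 'a \<Rightarrow> 'b \<Rightarrow> real" where
  "r_tilde \<omega> k h s a b = max (r_hat \<omega> k h s a b - bonus_r \<omega> k h s a b) 0"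

text \<open>State reaching probabilities; steps start at 1, so the value at 0 is irrelevant.\<close>

fun reach :: "('s, 'a) policy \<Rightarrow> (nat \<Rightarrow> 's \<Rightarrow> 'a \<Rightarrow> 's \<Rightarrow> real) \<Rightarrow> nat \<Rightarrow> 's \<Rightarrow> real" where
  "reach \<mu> p 0 s = 0"
| "reach \<mu> p (Suc 0) s = of_bool (s = s1)"
| "reach \<mu> p (Suc (Suc h)) s =
     (\<Sum>s'\<in>S. \<Sum>a'\<in>A. reach \<mu> p (Suc h) s' * \<mu> (Suc h) s' a' * p (Suc h) s' a' s)"

definition \<eta> :: real where
  "\<eta> = sqrt (ln (real (card A)) / (real K * (real H)\<^sup>2))"

definition \<gamma> :: real where
  "\<gamma> = sqrt (real (card S) * ln (real (card B)) / real K)"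

text \<open>The updates map the policies and data of episode \<open>k\<close> to a player's policy in episode \<open>k + 1\<close>.\<close>

definition update1 ::
  "'w \<Rightarrow> nat \<Rightarrow> ('s, 'a) policy \<Rightarrow> ('s, 'b) policy \<Rightarrow> ('s, 'a) policy" where
  "update1 \<omega> k \<mu> \<nu> h s =
     normalized A (\<lambda>a. \<mu> h s a * exp (\<eta> * (\<Sum>b\<in>B. Q_bar \<omega> k \<mu> \<nu> h s a b * \<nu> h s b)))"

definition update2 ::
  "'w \<Rightarrow> nat \<Rightarrow> ('s, 'a) policy \<Rightarrow> ('s, 'b) policy \<Rightarrow> ('s, 'b) policy" where
  "update2 \<omega> k \<mu> \<nu> h s =
     normalized B (\<lambda>b. \<nu> h s b * exp (- \<gamma> * reach \<mu> (P_hat \<omega> k) h s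
                                          * (\<Sum>a\<in>A. r_tilde \<omega> k h s a b * \<mu> h s a)))"

primrec play :: "'w \<Rightarrow> nat \<Rightarrow> ('s, 'a) policy \<times> ('s, 'b) policy" where
  "play \<omega> 0 = ((\<lambda>h s a. 1 / real (card A)), (\<lambda>h s b. 1 / real (card B)))"
| "play \<omega> (Suc k) =
     (case play \<omega> k of (\<mu>, \<nu>) \<Rightarrow> (update1 \<omega> k \<mu> \<nu>, update2 \<omega> k \<mu> \<nu>))"

definition pol1 :: "'w \<Rightarrow> nat \<Rightarrow> ('s, 'a) policy" where
  "pol1 \<omega> k = fst (play \<omega> k)"

definition pol2 :: "'w \<Rightarrow> nat \<Rightarrow> ('s, 'b) policy" where
  "pol2 \<omega> k = snd (play \<omega> k)"

definition best1 :: "'w \<Rightarrow> ('s, 'a) policy" where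
  "best1 \<omega> = arg_max (\<lambda>\<mu>. \<Sum>k\<in>{1..K}. V \<mu> (pol2 \<omega> k) 1 s1) (\<lambda>\<mu>. \<mu> \<in> policies H S A)"

definition best2 :: "'w \<Rightarrow> ('s, 'b) policy" where
  "best2 \<omega> = arg_min (\<lambda>\<nu>. \<Sum>k\<in>{1..K}. V (pol1 \<omega> k) \<nu> 1 s1) (\<lambda>\<nu>. \<nu> \<in> policies H S B)"

definition Regret1 :: "'w \<Rightarrow> real" where
  "Regret1 \<omega> = (\<Sum>k\<in>{1..K}. V (best1 \<omega>) (pol2 \<omega> k) 1 s1 - V (pol1 \<omega> k) (pol2 \<omega> k) 1 s1)"

definition Regret2 :: "'w \<Rightarrow> real" where
  "Regret2 \<omega> = (\<Sum>k\<in>{1..K}. V (pol1 \<omega> k) (pol2 \<omega> k) 1 s1 - V (pol1 \<omega> k) (best2 \<omega>) 1 s1)"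

definition Gap :: "'w \<Rightarrow> real" where
  "Gap \<omega> = Regret1 \<omega> + Regret2 \<omega>"

end


text \<open>
  The interaction protocol on a probability space \<open>M\<close>. The sigma-algebra \<open>F k h\<close> is the information
  available when step \<open>h\<close> of episode \<open>k\<close> begins (in state \<open>st k h\<close>), and \<open>G k h\<close> additionally contains
  the two actions taken at that step. The bandit rewards of episode \<open>k\<close> need only be part of the
  information at its end, \<open>F k (Suc H)\<close>. The reward functions may be correlated and vary from episode
  to episode; all that is required is that \<open>rw k h\<close> has mean \<open>r h\<close> given the past \<open>G k h\<close>, which
  covers in particular reward functions that are independent across episodes and of all moves.
\<close>

locale fictitious_play_run =
  fictitious_play S A B H s1 P r K \<delta> st ac bc rw + prob_space M
  for S :: "'s set" and A :: "'a set" and B :: "'b set" and H :: nat and s1 :: 's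
    and P :: "nat \<Rightarrow> 's \<Rightarrow> 'a \<Rightarrow> 's \<Rightarrow> real"
    and r :: "nat \<Rightarrow> 's \<Rightarrow> 'a \<Rightarrow> 'b \<Rightarrow> real"
    and K :: nat and \<delta> :: real
    and st :: "nat \<Rightarrow> nat \<Rightarrow> 'w \<Rightarrow> 's"
    and ac :: "nat \<Rightarrow> nat \<Rightarrow> 'w \<Rightarrow> 'a"
    and bc :: "nat \<Rightarrow> nat \<Rightarrow> 'w \<Rightarrow> 'b"
    and rw :: "nat \<Rightarrow> nat \<Rightarrow> 's \<Rightarrow> 'a \<Rightarrow> 'b \<Rightarrow> 'w \<Rightarrow> real"
    and M :: "'w measure" +
  fixes F :: "nat \<Rightarrow> nat \<Rightarrow> 'w measure" and G :: "nat \<Rightarrow> nat \<Rightarrow> 'w measure"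
  assumes F_sub: "\<And>k h. k \<in> {1..K} \<Longrightarrow> h \<in> {1..Suc H} \<Longrightarrow> subalgebra M (F k h)"
    and G_sub: "\<And>k h. k \<in> {1..K} \<Longrightarrow> h \<in> {1..H} \<Longrightarrow> subalgebra M (G k h)"
    and F_G: "\<And>k h. k \<in> {1..K} \<Longrightarrow> h \<in> {1..H} \<Longrightarrow> subalgebra (G k h) (F k h)"
    and G_F: "\<And>k h. k \<in> {1..K} \<Longrightarrow> h \<in> {1..H} \<Longrightarrow> subalgebra (F k (Suc h)) (G k h)"
    and F_next: "\<And>k. k \<in> {1..<K} \<Longrightarrow> subalgebra (F (Suc k) 1) (F k (Suc H))"
    and st_meas: "\<And>k h. k \<in> {1..K} \<Longrightarrow> h \<in> {1..Suc H} \<Longrightarrow> st k h \<in> F k h \<rightarrow>\<^sub>M count_space S"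
    and ac_meas: "\<And>k h. k \<in> {1..K} \<Longrightarrow> h \<in> {1..H} \<Longrightarrow> ac k h \<in> G k h \<rightarrow>\<^sub>M count_space A"
    and bc_meas: "\<And>k h. k \<in> {1..K} \<Longrightarrow> h \<in> {1..H} \<Longrightarrow> bc k h \<in> G k h \<rightarrow>\<^sub>M count_space B"
    and rw_meas: "\<And>k h s a b. k \<in> {1..K} \<Longrightarrow> h \<in> {1..H} \<Longrightarrow> s \<in> S \<Longrightarrow> a \<in> A \<Longrightarrow> b \<in> B \<Longrightarrow>
      rw k h s a b \<in> borel_measurable M"
    and rw_range: "\<And>k h s a b \<omega>. k \<in> {1..K} \<Longrightarrow> h \<in> {1..H} \<Longrightarrow> s \<in> S \<Longrightarrow> a \<in> A \<Longrightarrow> b \<in> B \<Longrightarrow>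
      \<omega> \<in> space M \<Longrightarrow> rw k h s a b \<omega> \<in> {0..1}"
    and rw_observed: "\<And>k h. k \<in> {1..K} \<Longrightarrow> h \<in> {1..H} \<Longrightarrow>
      (\<lambda>\<omega>. rw k h (st k h \<omega>) (ac k h \<omega>) (bc k h \<omega>) \<omega>) \<in> borel_measurable (F k (Suc H))"
    and start: "\<And>k \<omega>. k \<in> {1..K} \<Longrightarrow> \<omega> \<in> space M \<Longrightarrow> st k 1 \<omega> = s1"
    and actions: "\<And>k h a b. k \<in> {1..K} \<Longrightarrow> h \<in> {1..H} \<Longrightarrow> a \<in> A \<Longrightarrow> b \<in> B \<Longrightarrow>
      AE \<omega> in M. real_cond_exp M (F k h) (\<lambda>\<omega>. of_bool (ac k h \<omega> = a \<and> bc k h \<omega> = b)) \<omega>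
        = pol1 \<omega> k h (st k h \<omega>) a * pol2 \<omega> k h (st k h \<omega>) b"
    and next_state: "\<And>k h s'. k \<in> {1..K} \<Longrightarrow> h \<in> {1..H} \<Longrightarrow> s' \<in> S \<Longrightarrow>
      AE \<omega> in M. real_cond_exp M (G k h) (\<lambda>\<omega>. of_bool (st k (Suc h) \<omega> = s')) \<omega>
        = P h (st k h \<omega>) (ac k h \<omega>) s'"
    and reward_mean: "\<And>k h s a b. k \<in> {1..K} \<Longrightarrow> h \<in> {1..H} \<Longrightarrow> s \<in> S \<Longrightarrow> a \<in> A \<Longrightarrow> b \<in> B \<Longrightarrow>
      AE \<omega> in M. real_cond_exp M (G k h) (rw k h s a b) \<omega> = r h s a b"

end

(* In both players' regrets the value difference is expressed through the occupancy measure of the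
   true transitions (performance difference lemma). As Player 2 does not influence the transitions,
   the occupancy measure of a fixed comparator of Player 1 is the same in every episode, so Player 1's
   regret reduces to one exponential-weights regret per state and step. Player 2 runs exponential
   weights on losses weighted by the empirical reaching probabilities, whose distance to the true ones is
   controlled by the transition estimation error. What remains in both cases is a sum of expected
   bonuses; a martingale bound replaces the expectation by the realised visits, and along the visits
   1 / sqrt N sums to O(sqrt K). The estimates are accurate by exponential supermartingale
   bounds, stated with a weak form of the martingale property: X is orthogonal to bounded functions of
   the past.

   Measurability of Gap needs the optimal values in closed form: dynamic programming for Player 1, a
   pointwise minimum of cumulative losses for Player 2. The transition bonus yields optimism only for
   K >= 2; for K = 1 the gap is at most 2 H, and it is 0 if both players have a single action. *)

theory Submission
  imports Defs
begin

section \<open>Bellman equation\<close>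

text \<open>The estimates meet objects built from the same data. \<open>V_bar\<close> depends on the
  transition estimate against which it is integrated, so accuracy is demanded for all bounded test
  functions at once; this costs a union bound over the subsets of \<open>S\<close>, for which the
  factor |S| under the root of \<open>bonus_P\<close> pays. The number of visits is random as well,
  so deviations are bounded for every fixed count and then united over the counts. The regret of
  episode k involves estimates formed after episode k, on data that contain this very episode,
  whereas the martingale bound needs coefficients known beforehand; therefore the bonuses are first
  enlarged to the visit counts after k - 1 episodes. The failure probability 5 \<delta> consists of
  2 \<delta> for the rewards, 2 \<delta> for the transitions and \<delta> for the visits. As the
  statement leaves C, p and q free, powers of the sizes and of the logarithm are estimated
  generously; only the two accuracy bounds have to match the prescribed bonuses.\<close>

lemma prob_simplexD:
  assumes "p \<in> prob_simplex X"
  shows "x \<in> X \<Longrightarrow> 0 \<le> p x" "(\<Sum>x\<in>X. p x) = 1"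
  using assms by (auto simp: prob_simplex_def)

lemma policiesD: "\<pi> \<in> policies H S X \<Longrightarrow> h \<in> {1..H} \<Longrightarrow> s \<in> S \<Longrightarrow> \<pi> h s \<in> prob_simplex X"
  by (auto simp: policies_def)

lemma sum_PiE_insert:
  assumes "x \<notin> I"
  shows "(\<Sum>f\<in>Pi\<^sub>E (insert x I) T. g f) = (\<Sum>y\<in>T x. \<Sum>f\<in>Pi\<^sub>E I T. g (f(x := y)))"
proof -
  have "(\<Sum>f\<in>Pi\<^sub>E (insert x I) T. g f) = (\<Sum>(y, f)\<in>T x \<times> Pi\<^sub>E I T. g (f(x := y)))"
    unfolding PiE_insert_eq using inj_combinator[OF assms, of T]
    by (subst sum.reindex) (auto simp: case_prod_unfold)
  then show ?thesis by (simp add: sum.cartesian_product)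
qed

context markov_game
begin

section \<open>Trajectory sums, peeled one step at a time\<close>

abbreviation tails :: "nat \<Rightarrow> (nat \<Rightarrow> 's \<times> 'a \<times> 'b) set" where
  "tails h \<equiv> {h..H} \<rightarrow>\<^sub>E S \<times> A \<times> B"

lemma finite_tails: "finite (tails h)"
  using finite_spaces by (intro finite_PiE) auto

lemma sum_trajs:
  assumes "h \<le> H" "s \<in> S"
  shows "(\<Sum>\<tau>\<in>trajs h s. f \<tau>) = (\<Sum>a\<in>A. \<Sum>b\<in>B. \<Sum>\<sigma>\<in>tails (Suc h). f (\<sigma>(h := (s, a, b))))"
proof -
  have ins: "{h..H} = insert h {Suc h..H}" using assms by auto
  have "(\<Sum>\<tau>\<in>trajs h s. f \<tau>) = (\<Sum>\<tau>\<in>tails h. if fst (\<tau> h) = s then f \<tau> else 0)"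
    unfolding trajs_def by (rule sum.inter_filter[OF finite_tails])
  also have "\<dots> = (\<Sum>y\<in>S \<times> A \<times> B. \<Sum>\<sigma>\<in>tails (Suc h). if fst y = s then f (\<sigma>(h := y)) else 0)"
    unfolding ins by (subst sum_PiE_insert) auto
  also have "\<dots> = (\<Sum>s'\<in>S. if s' = s then \<Sum>a\<in>A. \<Sum>b\<in>B. \<Sum>\<sigma>\<in>tails (Suc h). f (\<sigma>(h := (s', a, b))) else 0)"
    unfolding sum.cartesian_product' by (intro sum.cong refl) auto
  also have "\<dots> = (\<Sum>a\<in>A. \<Sum>b\<in>B. \<Sum>\<sigma>\<in>tails (Suc h). f (\<sigma>(h := (s, a, b))))"
    using assms finite_spaces by simp
  finally show ?thesis .
qed

lemma sum_tails_partition: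
  assumes "h \<le> H"
  shows "(\<Sum>\<sigma>\<in>tails h. f \<sigma>) = (\<Sum>s\<in>S. \<Sum>\<sigma>\<in>trajs h s. f \<sigma>)"
proof -
  have "(\<lambda>\<sigma>. fst (\<sigma> h)) ` tails h \<subseteq> S"
    using assms by (force simp: PiE_iff)
  from sum.group[OF finite_tails finite_spaces(1) this, of f] show ?thesis
    by (simp add: trajs_def)
qed

lemma traj_prob_update:
  assumes "h \<in> {1..H}"
  shows "traj_prob \<mu> \<nu> h (\<sigma>(h := (s, a, b))) =
    \<mu> h s a * \<nu> h s b * (if h < H then P h s a (fst (\<sigma> (Suc h))) else 1) * traj_prob \<mu> \<nu> (Suc h) \<sigma>"
proof -
  have ins: "{h..H} = insert h {Suc h..H}" using assms by auto
  have 1: "(\<Prod>i\<in>{Suc h..H}. case (\<sigma>(h := (s, a, b))) i of (s, a, b) \<Rightarrow> \<mu> i s a * \<nu> i s b) =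
      (\<Prod>i\<in>{Suc h..H}. case \<sigma> i of (s, a, b) \<Rightarrow> \<mu> i s a * \<nu> i s b)"
    by (intro prod.cong) auto
  show ?thesis
  proof (cases "h < H")
    case True
    then have ins': "{h..<H} = insert h {Suc h..<H}" by auto
    have 2: "(\<Prod>i\<in>{Suc h..<H}. case (\<sigma>(h := (s, a, b))) i of
          (s', a', b') \<Rightarrow> P i s' a' (fst ((\<sigma>(h := (s, a, b))) (Suc i)))) =
        (\<Prod>i\<in>{Suc h..<H}. case \<sigma> i of (s, a, b) \<Rightarrow> P i s a (fst (\<sigma> (Suc i))))"
      by (intro prod.cong) auto
    show ?thesis
      unfolding traj_prob_def ins ins' using True 1 2 by (simp add: mult_ac del: fun_upd_apply) simp
  next
    case False
    then have "h = H" using assms by auto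
    then show ?thesis unfolding traj_prob_def ins using 1 by simp
  qed
qed

text \<open>Peels off the first step of the trajectory. The function \<open>f\<close> is arbitrary
  because the identity is used twice, with \<open>f = 1\<close> for the total mass and with the
  collected reward for \<open>V\<close>. The case \<open>h = H\<close> is separate: after the last
  step no state is left to sum over, and the only remaining tail is the function that is
  \<open>undefined\<close> everywhere.\<close>

lemma sum_traj_prob_Bellman:
  assumes "h \<in> {1..H}" "s \<in> S"
  shows "(\<Sum>\<tau>\<in>trajs h s. traj_prob \<mu> \<nu> h \<tau> * f \<tau>) =
    (\<Sum>a\<in>A. \<Sum>b\<in>B. \<mu> h s a * \<nu> h s b *
      (if h < H then \<Sum>s'\<in>S. P h s a s' * (\<Sum>\<sigma>\<in>trajs (Suc h) s'. traj_prob \<mu> \<nu> (Suc h) \<sigma> * f (\<sigma>(h := (s, a, b))))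
       else f ((\<lambda>_. undefined)(h := (s, a, b)))))"
proof (cases "h < H")
  case True
  have "(\<Sum>\<sigma>\<in>tails (Suc h). traj_prob \<mu> \<nu> h (\<sigma>(h := (s, a, b))) * f (\<sigma>(h := (s, a, b)))) =
      \<mu> h s a * \<nu> h s b * (\<Sum>s'\<in>S. P h s a s' *
        (\<Sum>\<sigma>\<in>trajs (Suc h) s'. traj_prob \<mu> \<nu> (Suc h) \<sigma> * f (\<sigma>(h := (s, a, b)))))" for a b
    unfolding sum_distrib_left
    using True by (subst sum_tails_partition, simp, intro sum.cong refl)
      (auto simp: traj_prob_update[OF assms(1)] trajs_def mult_ac)
  then show ?thesis using True assms by (simp add: sum_trajs)
next
  case False
  then have "h = H" using assms by auto
  then show ?thesis using assms
    by (simp add: sum_trajs traj_prob_update) (simp add: traj_prob_def PiE_empty_domain fun_upd_def)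
qed

lemma sum_traj_prob:
  assumes "\<mu> \<in> policies H S A" "\<nu> \<in> policies H S B"
  shows "h \<in> {1..H} \<Longrightarrow> s \<in> S \<Longrightarrow> (\<Sum>\<tau>\<in>trajs h s. traj_prob \<mu> \<nu> h \<tau>) = 1"
proof (induction "H - h" arbitrary: h s)
  case 0
  then show ?case
    using sum_traj_prob_Bellman[OF 0(2,3), of \<mu> \<nu> "\<lambda>_. 1"] policiesD[OF assms(1) 0(2,3)]
      policiesD[OF assms(2) 0(2,3)]
    by (simp add: sum_product[symmetric] prob_simplexD(2))
next
  case (Suc n)
  then have "h < H" by auto
  have "(\<Sum>\<sigma>\<in>trajs (Suc h) s'. traj_prob \<mu> \<nu> (Suc h) \<sigma>) = 1" if "s' \<in> S" for s'
    using Suc that by (intro Suc(1)) auto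
  then show ?case using \<open>h < H\<close>
    using sum_traj_prob_Bellman[OF Suc(3,4), of \<mu> \<nu> "\<lambda>_. 1"] policiesD[OF assms(1) Suc(3,4)]
      policiesD[OF assms(2) Suc(3,4)] transition[OF Suc(3,4)]
    by (simp add: sum_product[symmetric] prob_simplexD(2))
qed

lemma V_end [simp]: "V \<mu> \<nu> (Suc H) s = 0"
  by (simp add: V_def)

lemma V_Bellman:
  assumes "\<mu> \<in> policies H S A" "\<nu> \<in> policies H S B" "h \<in> {1..H}" "s \<in> S"
  shows "V \<mu> \<nu> h s =
    (\<Sum>a\<in>A. \<Sum>b\<in>B. \<mu> h s a * \<nu> h s b * (r h s a b + (\<Sum>s'\<in>S. P h s a s' * V \<mu> \<nu> (Suc h) s')))"
proof -
  let ?R = "\<lambda>h \<tau>. \<Sum>i\<in>{h..H}. case \<tau> i of (s, a, b) \<Rightarrow> r i s a b"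
  have ins: "{h..H} = insert h {Suc h..H}" using assms by auto
  have R: "?R h (\<sigma>(h := (s, a, b))) = r h s a b + ?R (Suc h) \<sigma>" for \<sigma> a b
  proof -
    have "(\<Sum>i\<in>{Suc h..H}. case (\<sigma>(h := (s, a, b))) i of (s, a, b) \<Rightarrow> r i s a b) = ?R (Suc h) \<sigma>"
      by (intro sum.cong) auto
    then show ?thesis unfolding ins by simp
  qed
  \<comment> \<open>The immediate reward comes out of the sum because the continuations have total
    probability 1 (\<open>sum_traj_prob\<close>).\<close>
  have *: "(if h < H then \<Sum>s'\<in>S. P h s a s' *
          (\<Sum>\<sigma>\<in>trajs (Suc h) s'. traj_prob \<mu> \<nu> (Suc h) \<sigma> * ?R h (\<sigma>(h := (s, a, b))))
        else ?R h ((\<lambda>_. undefined)(h := (s, a, b)))) =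
      r h s a b + (\<Sum>s'\<in>S. P h s a s' * V \<mu> \<nu> (Suc h) s')" if "a \<in> A" for a b
  proof (cases "h < H")
    case True
    have "(\<Sum>\<sigma>\<in>trajs (Suc h) s'. traj_prob \<mu> \<nu> (Suc h) \<sigma> * ?R h (\<sigma>(h := (s, a, b)))) =
        r h s a b + V \<mu> \<nu> (Suc h) s'" if "s' \<in> S" for s'
      using sum_traj_prob[OF assms(1,2), of "Suc h" s'] True that
      unfolding R V_def distrib_left sum.distrib by (simp flip: sum_distrib_right)
    then show ?thesis
      using True transition[OF assms(3,4) that]
      by (simp add: distrib_left sum.distrib sum_distrib_right[symmetric] prob_simplexD(2))
  next
    case False
    then have "h = H" using assms by auto
    then show ?thesis using R by simp
  qed
  show ?thesis
    unfolding V_def[of \<mu> \<nu> h] sum_traj_prob_Bellman[OF assms(3,4)]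
    by (intro sum.cong refl) (simp only: *)
qed

end

section \<open>Exponential weights\<close>

lemma sum_le_mult_simplex:
  fixes f :: "'x \<Rightarrow> real"
  assumes "p \<in> prob_simplex X" "\<And>x. x \<in> X \<Longrightarrow> f x \<le> c"
  shows "(\<Sum>x\<in>X. p x * f x) \<le> c"
proof -
  have "(\<Sum>x\<in>X. p x * f x) \<le> (\<Sum>x\<in>X. p x * c)"
    using assms by (intro sum_mono mult_left_mono prob_simplexD(1)) auto
  also have "\<dots> = c" using prob_simplexD(2)[OF assms(1)] by (simp flip: sum_distrib_right)
  finally show ?thesis .
qed

lemma sum_ge_mult_simplex:
  fixes f :: "'x \<Rightarrow> real"
  assumes "p \<in> prob_simplex X" "\<And>x. x \<in> X \<Longrightarrow> c \<le> f x"
  shows "c \<le> (\<Sum>x\<in>X. p x * f x)"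
  using sum_le_mult_simplex[OF assms(1), of "\<lambda>x. - f x" "-c"] assms(2) by (simp add: sum_negf)

lemma normalized_simplex:
  assumes "finite X" "X \<noteq> {}" "\<And>x. x \<in> X \<Longrightarrow> 0 < w x"
  shows "normalized X w \<in> prob_simplex X" "x \<in> X \<Longrightarrow> 0 < normalized X w x"
proof -
  have "0 < sum w X" using assms by (intro sum_pos) auto
  then show "normalized X w \<in> prob_simplex X" "x \<in> X \<Longrightarrow> 0 < normalized X w x"
    using assms(3) by (auto simp: prob_simplex_def normalized_def less_imp_le simp flip: sum_divide_distrib)
qed

text \<open>The quadratic Taylor polynomials at -y and y multiply to 1 + y^4 / 4, which is at least
  1, and the second one is at most exp y. The bound holds for every y >= 0, so the learning rates
  may be large, for instance when K is small compared with ln |A|.\<close>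

lemma exp_minus_le_quadratic:
  fixes y :: real
  assumes "0 \<le> y"
  shows "exp (- y) \<le> 1 - y + y\<^sup>2 / 2"
proof -
  have q: "0 < 1 - y + y\<^sup>2 / 2"
    using zero_le_power2[of "y - 1"] by (simp add: power2_eq_square algebra_simps)
  have "(1 - y + y\<^sup>2 / 2) * (1 + y + y\<^sup>2 / 2) = 1 + (y\<^sup>2)\<^sup>2 / 4"
    by (simp add: power2_eq_square algebra_simps)
  then have "1 \<le> (1 - y + y\<^sup>2 / 2) * (1 + y + y\<^sup>2 / 2)" by simp
  also have "\<dots> \<le> (1 - y + y\<^sup>2 / 2) * exp y"
    using q exp_lower_Taylor_quadratic[OF assms] by (intro mult_left_mono) auto
  finally show ?thesis by (simp add: exp_minus field_simps)
qed

text \<open>Potential argument with the potential \<open>ln (p k x)\<close> of the comparator x. In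
  each round it rises by at least \<theta> times the instantaneous regret, up to a quadratic term;
  the increments telescope, the final value is at most 0 and the initial one is - ln |X|.\<close>

lemma hedge_regret_vertex:
  fixes p l :: "nat \<Rightarrow> 'x \<Rightarrow> real"
  assumes X: "finite X" "X \<noteq> {}" and th: "0 \<le> \<theta>"
    and init: "\<And>x. x \<in> X \<Longrightarrow> p 0 x = 1 / card X"
    and upd: "\<And>k x. k \<le> n \<Longrightarrow> x \<in> X \<Longrightarrow> p (Suc k) x = normalized X (\<lambda>x. p k x * exp (- \<theta> * l k x)) x"
    and l: "\<And>k x. k \<le> n \<Longrightarrow> x \<in> X \<Longrightarrow> 0 \<le> l k x \<and> l k x \<le> G"
    and x: "x \<in> X"
  shows "\<theta> * (\<Sum>k\<le>n. (\<Sum>y\<in>X. p k y * l k y) - l k x) \<le> ln (card X) + \<theta>\<^sup>2 / 2 * G\<^sup>2 * (real n + 1)"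
proof -
  have p: "(\<forall>x\<in>X. 0 < p k x) \<and> p k \<in> prob_simplex X" if "k \<le> Suc n" for k
    using that
  proof (induction k)
    case 0
    then show ?case using X init by (auto simp: prob_simplex_def card_gt_0_iff)
  next
    case (Suc k)
    then have "\<And>y. y \<in> X \<Longrightarrow> 0 < p k y * exp (- \<theta> * l k y)" by auto
    from normalized_simplex[OF X, OF this] upd[of k] Suc(2) show ?case
      by (auto simp: prob_simplex_def)
  qed
  let ?m = "\<lambda>k. \<Sum>y\<in>X. p k y * l k y"
  have step: "\<theta> * (?m k - l k x) \<le> ln (p (Suc k) x) - ln (p k x) + \<theta>\<^sup>2 / 2 * G\<^sup>2" if k: "k \<le> n" for k
  proof -
    \<comment> \<open>The normaliser of the update links the two sides: \<open>ln Z\<close> is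
      bounded above through the mean loss, and it occurs in the exact change of
      \<open>ln (p k x)\<close>.\<close>
    define Z where "Z = (\<Sum>y\<in>X. p k y * exp (- \<theta> * l k y))"
    have pk: "\<And>y. y \<in> X \<Longrightarrow> 0 < p k y" "p k \<in> prob_simplex X" using p[of k] k by auto
    have Z0: "0 < Z" unfolding Z_def using X pk by (intro sum_pos) auto
    have "Z \<le> (\<Sum>y\<in>X. p k y * (1 - \<theta> * l k y + \<theta>\<^sup>2 / 2 * G\<^sup>2))"
      unfolding Z_def
    proof (intro sum_mono mult_left_mono)
      fix y assume y: "y \<in> X"
      have "exp (- \<theta> * l k y) \<le> 1 - \<theta> * l k y + (\<theta> * l k y)\<^sup>2 / 2"
        using exp_minus_le_quadratic[of "\<theta> * l k y"] th l[OF k y] by simp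
      also have "(\<theta> * l k y)\<^sup>2 \<le> (\<theta> * G)\<^sup>2"
        using th l[OF k y] by (intro power_mono mult_left_mono) auto
      finally show "exp (- \<theta> * l k y) \<le> 1 - \<theta> * l k y + \<theta>\<^sup>2 / 2 * G\<^sup>2"
        by (simp add: power_mult_distrib)
    qed (use pk in \<open>auto simp: less_imp_le\<close>)
    also have "\<dots> = 1 + (- \<theta> * ?m k + \<theta>\<^sup>2 / 2 * G\<^sup>2)"
      using prob_simplexD(2)[OF pk(2)]
      by (simp add: algebra_simps sum.distrib sum_subtractf flip: sum_distrib_left sum_distrib_right sum_divide_distrib)
    also have "\<dots> \<le> exp (- \<theta> * ?m k + \<theta>\<^sup>2 / 2 * G\<^sup>2)" by (rule exp_ge_add_one_self)
    finally have "ln Z \<le> ln (exp (- \<theta> * ?m k + \<theta>\<^sup>2 / 2 * G\<^sup>2))"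
      using Z0 by (subst ln_le_cancel_iff) auto
    then have "ln Z \<le> - \<theta> * ?m k + \<theta>\<^sup>2 / 2 * G\<^sup>2" by simp
    moreover have "ln (p (Suc k) x) = ln (p k x) - \<theta> * l k x - ln Z"
    proof -
      have "p (Suc k) x = p k x * exp (- \<theta> * l k x) / Z"
        using upd[OF k x] by (simp only: normalized_def Z_def)
      then show ?thesis using pk(1)[OF x] Z0 by (simp add: ln_div ln_mult)
    qed
    ultimately show ?thesis by (simp add: algebra_simps)
  qed
  have "\<theta> * (\<Sum>k\<le>n. ?m k - l k x) = (\<Sum>k\<le>n. \<theta> * (?m k - l k x))"
    by (simp add: sum_distrib_left)
  also have "\<dots> \<le> (\<Sum>k\<le>n. ln (p (Suc k) x) - ln (p k x) + \<theta>\<^sup>2 / 2 * G\<^sup>2)"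
    using step by (intro sum_mono) auto
  also have "\<dots> = ln (p (Suc n) x) - ln (p 0 x) + \<theta>\<^sup>2 / 2 * G\<^sup>2 * (real n + 1)"
    unfolding sum.distrib using sum_telescope[of "\<lambda>k. - ln (p k x)" n]
    by (simp del: sum_subtractf)
  finally have bound: "\<theta> * (\<Sum>k\<le>n. ?m k - l k x) \<le>
    ln (p (Suc n) x) - ln (p 0 x) + \<theta>\<^sup>2 / 2 * G\<^sup>2 * (real n + 1)" .
  have "ln (p (Suc n) x) \<le> 0"
  proof -
    have "p (Suc n) x \<le> (\<Sum>y\<in>X. p (Suc n) y)"
      using p[of "Suc n"] x X by (intro member_le_sum) (auto simp: less_imp_le)
    then show ?thesis using p[of "Suc n"] x by (auto simp: prob_simplex_def)
  qed
  moreover have "- ln (p 0 x) = ln (card X)"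
    using init[OF x] X by (simp add: ln_div card_gt_0_iff)
  ultimately show ?thesis using bound by linarith
qed

text \<open>Round \<open>0\<close> is split off at the price \<open>G\<close>, since the algorithms start updating before the first
  episode.\<close>

lemma hedge_regret:
  fixes p l :: "nat \<Rightarrow> 'x \<Rightarrow> real"
  assumes X: "finite X" "X \<noteq> {}" and th: "\<theta> = sqrt (c * ln (card X) / n)" and c: "0 < c" and n: "1 \<le> n"
    and init: "\<And>x. x \<in> X \<Longrightarrow> p 0 x = 1 / card X"
    and upd: "\<And>k x. k \<le> n \<Longrightarrow> x \<in> X \<Longrightarrow> p (Suc k) x = normalized X (\<lambda>x. p k x * exp (- \<theta> * l k x)) x"
    and l: "\<And>k x. k \<le> n \<Longrightarrow> x \<in> X \<Longrightarrow> 0 \<le> l k x \<and> l k x \<le> G"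
    and p: "\<And>k. k \<le> n \<Longrightarrow> p k \<in> prob_simplex X" and q: "q \<in> prob_simplex X"
  shows "(\<Sum>k\<in>{1..n}. (\<Sum>x\<in>X. p k x * l k x) - (\<Sum>x\<in>X. q x * l k x))
    \<le> G + (1 / sqrt c + sqrt c * G\<^sup>2) * sqrt (n * ln (card X))"
proof -
  let ?D = "\<lambda>k x. (\<Sum>y\<in>X. p k y * l k y) - l k x"
  have G0: "0 \<le> G" using l[of 0] X by force
  have cX: "1 \<le> card X" using X by (simp add: Suc_le_eq card_gt_0_iff)
  then have L0: "0 \<le> ln (card X)" by simp
  have th0: "0 \<le> \<theta>" unfolding th using L0 c by simp
  have vert: "(\<Sum>k\<le>n. ?D k x) \<le> (1 / sqrt c + sqrt c * G\<^sup>2) * sqrt (n * ln (card X))" if x: "x \<in> X" for x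
  \<comment> \<open>A single action gives \<theta> = 0, which rules out the division by \<theta> at
    the end; there the regret is zero.\<close>
  proof (cases "card X = 1")
    case True
    then have "X = {x}" using x by (metis card_1_singletonE singletonD)
    then have "?D k x = 0" if "k \<le> n" for k
      using prob_simplexD(2)[OF p[OF that]] by simp
    then have "(\<Sum>k\<le>n. ?D k x) = 0" by (intro sum.neutral) auto
    then show ?thesis using True by simp
  next
    case False
    then have L: "0 < ln (card X)" using cX by simp
    then have th1: "0 < \<theta>" unfolding th using c n by simp
    have "\<theta> * (\<Sum>k\<le>n. ?D k x) \<le> ln (card X) + \<theta>\<^sup>2 / 2 * G\<^sup>2 * (real n + 1)"
      by (rule hedge_regret_vertex[OF X th0 init upd l x])
    \<comment> \<open>There are n + 1 rounds, but \<theta> is tuned for n. Passing to 2 n absorbs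
      the 1/2 of the quadratic term.\<close>
    also have "\<theta>\<^sup>2 / 2 * G\<^sup>2 * (real n + 1) \<le> \<theta>\<^sup>2 / 2 * G\<^sup>2 * (2 * real n)"
      using n by (intro mult_left_mono) auto
    also have "ln (card X) + \<theta>\<^sup>2 / 2 * G\<^sup>2 * (2 * real n) = ln (card X) + \<theta>\<^sup>2 * G\<^sup>2 * n" by simp
    also have "\<dots> = \<theta> * ((1 / sqrt c + sqrt c * G\<^sup>2) * sqrt (n * ln (card X)))"
    proof -
      have *: "\<theta> * sqrt (n * ln (card X)) = sqrt c * ln (card X)"
        unfolding th using n c L by (simp add: real_sqrt_mult real_sqrt_divide flip: power2_eq_square)
      have "\<theta>\<^sup>2 * G\<^sup>2 * n = c * ln (card X) * G\<^sup>2" unfolding th using n c L by simp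
      moreover have "\<theta> * ((1 / sqrt c + sqrt c * G\<^sup>2) * sqrt (n * ln (card X))) =
          (1 / sqrt c + sqrt c * G\<^sup>2) * (\<theta> * sqrt (n * ln (card X)))" by simp
      moreover have "(1 / sqrt c + sqrt c * G\<^sup>2) * (sqrt c * ln (card X)) =
          ln (card X) + (sqrt c * sqrt c) * ln (card X) * G\<^sup>2"
        using c by (simp add: algebra_simps)
      ultimately show ?thesis unfolding * using c by simp
    qed
    finally show ?thesis using th1 by simp
  qed
  \<comment> \<open>The regret is affine in the comparator, so against a mixed q it is the q-average
    of the regrets against single actions.\<close>
  have "(\<Sum>k\<le>n. (\<Sum>x\<in>X. p k x * l k x) - (\<Sum>x\<in>X. q x * l k x)) = (\<Sum>k\<le>n. \<Sum>x\<in>X. q x * ?D k x)"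
    by (simp only: right_diff_distrib sum_subtractf sum_distrib_right[symmetric] prob_simplexD(2)[OF q] mult_1_left)
  also have "\<dots> = (\<Sum>x\<in>X. q x * (\<Sum>k\<le>n. ?D k x))"
    by (subst sum.swap) (simp add: sum_distrib_left)
  also have "\<dots> \<le> (1 / sqrt c + sqrt c * G\<^sup>2) * sqrt (n * ln (card X))"
    by (rule sum_le_mult_simplex[OF q vert])
  finally have tot: "(\<Sum>k\<le>n. (\<Sum>x\<in>X. p k x * l k x) - (\<Sum>x\<in>X. q x * l k x)) \<le> \<dots>" .
  have "(\<Sum>x\<in>X. q x * l 0 x) \<le> G" using l by (intro sum_le_mult_simplex[OF q]) auto
  moreover have "0 \<le> (\<Sum>x\<in>X. p 0 x * l 0 x)" using l by (intro sum_ge_mult_simplex[OF p]) auto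
  moreover have "{..n} = insert 0 {1..n}" by auto
  ultimately show ?thesis using tot by simp
qed

section \<open>Values and occupancy measures\<close>

context markov_game
begin

text \<open>Policies are arbitrary functions off the game, and a comparator obtained from
  \<open>arg_max\<close> is determined at best on it. Equality of values must therefore follow from
  agreement at the relevant arguments.\<close>

lemma V_cong:
  assumes "\<And>h s a. h \<in> {1..H} \<Longrightarrow> s \<in> S \<Longrightarrow> a \<in> A \<Longrightarrow> \<mu> h s a = \<mu>' h s a"
    and "\<And>h s b. h \<in> {1..H} \<Longrightarrow> s \<in> S \<Longrightarrow> b \<in> B \<Longrightarrow> \<nu> h s b = \<nu>' h s b"
  shows "V \<mu> \<nu> 1 s = V \<mu>' \<nu>' 1 s"
proof -
  have "traj_prob \<mu> \<nu> 1 \<tau> = traj_prob \<mu>' \<nu>' 1 \<tau>" if "\<tau> \<in> trajs 1 s" for \<tau>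
  proof -
    have "fst (\<tau> i) \<in> S \<and> fst (snd (\<tau> i)) \<in> A \<and> snd (snd (\<tau> i)) \<in> B" if "i \<in> {1..H}" for i
    proof -
      have "\<tau> i \<in> S \<times> A \<times> B" using \<open>\<tau> \<in> trajs 1 s\<close> that by (auto simp: trajs_def PiE_iff)
      then show ?thesis by auto
    qed
    then show ?thesis unfolding traj_prob_def case_prod_unfold
      using assms by (intro arg_cong2[where f = "(*)"] prod.cong) auto
  qed
  then show ?thesis by (simp add: V_def)
qed

lemma V_range:
  assumes "\<mu> \<in> policies H S A" "\<nu> \<in> policies H S B"
  shows "h \<in> {1..Suc H} \<Longrightarrow> s \<in> S \<Longrightarrow> 0 \<le> V \<mu> \<nu> h s \<and> V \<mu> \<nu> h s \<le> real H - real h + 1"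
proof (induction "Suc H - h" arbitrary: h s)
  case 0
  then have "h = Suc H" by auto
  then show ?case by simp
next
  case (Suc n)
  then have h: "h \<in> {1..H}" by auto
  have IH: "0 \<le> V \<mu> \<nu> (Suc h) s' \<and> V \<mu> \<nu> (Suc h) s' \<le> real H - real h" if "s' \<in> S" for s'
    using Suc(1)[of "Suc h" s'] Suc(2) h that by auto
  note mu = policiesD[OF assms(1) h Suc(4)] and nu = policiesD[OF assms(2) h Suc(4)]
  have V: "V \<mu> \<nu> h s = (\<Sum>a\<in>A. \<mu> h s a * (\<Sum>b\<in>B. \<nu> h s b *
      (r h s a b + (\<Sum>s'\<in>S. P h s a s' * V \<mu> \<nu> (Suc h) s'))))"
    using V_Bellman[OF assms h Suc(4)] by (simp add: sum_distrib_left mult.assoc)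
  have x: "0 \<le> r h s a b + (\<Sum>s'\<in>S. P h s a s' * V \<mu> \<nu> (Suc h) s') \<and>
      r h s a b + (\<Sum>s'\<in>S. P h s a s' * V \<mu> \<nu> (Suc h) s') \<le> real H - real h + 1"
    if "a \<in> A" "b \<in> B" for a b
    using reward_range[OF h Suc(4) that]
      sum_ge_mult_simplex[OF transition[OF h Suc(4) that(1)], of 0 "V \<mu> \<nu> (Suc h)"]
      sum_le_mult_simplex[OF transition[OF h Suc(4) that(1)], of "V \<mu> \<nu> (Suc h)" "real H - real h"] IH
    by auto
  show ?case unfolding V using x
    by (intro conjI sum_ge_mult_simplex[OF mu] sum_ge_mult_simplex[OF nu]
        sum_le_mult_simplex[OF mu] sum_le_mult_simplex[OF nu]) auto
qed

text \<open>Optimal value, by backward induction, of the sum over k of the values against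
  \<open>\<nu> k\<close>. The index j counts steps to go, so \<open>Suc j\<close> belongs to step
  \<open>H - j\<close>; this makes the recursion primitive.\<close>

primrec best_value :: "(nat \<Rightarrow> ('s, 'b) policy) \<Rightarrow> nat \<Rightarrow> nat \<Rightarrow> 's \<Rightarrow> real" where
  "best_value \<nu> n 0 s = 0"
| "best_value \<nu> n (Suc j) s =
    Max ((\<lambda>a. (\<Sum>k\<in>{1..n}. \<Sum>b\<in>B. \<nu> k (H - j) s b * r (H - j) s a b)
      + (\<Sum>s'\<in>S. P (H - j) s a s' * best_value \<nu> n j s')) ` A)"

text \<open>Single control is decisive here: the transition term carries no \<nu>, so the action b
  integrates out of it and the sum over k passes through \<open>P\<close>, giving one Bellman
  equation for the whole sum.\<close>

lemma sum_V_Bellman: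
  assumes "\<mu> \<in> policies H S A" "\<And>k. k \<in> {1..n} \<Longrightarrow> \<nu> k \<in> policies H S B" "h \<in> {1..H}" "s \<in> S"
  shows "(\<Sum>k\<in>{1..n}. V \<mu> (\<nu> k) h s) = (\<Sum>a\<in>A. \<mu> h s a * ((\<Sum>k\<in>{1..n}. \<Sum>b\<in>B. \<nu> k h s b * r h s a b)
    + (\<Sum>s'\<in>S. P h s a s' * (\<Sum>k\<in>{1..n}. V \<mu> (\<nu> k) (Suc h) s'))))"
proof -
  have "V \<mu> (\<nu> k) h s = (\<Sum>a\<in>A. \<mu> h s a * ((\<Sum>b\<in>B. \<nu> k h s b * r h s a b)
      + (\<Sum>s'\<in>S. P h s a s' * V \<mu> (\<nu> k) (Suc h) s')))" if "k \<in> {1..n}" for k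
    unfolding V_Bellman[OF assms(1) assms(2)[OF that] assms(3,4)]
    using prob_simplexD(2)[OF policiesD[OF assms(2)[OF that] assms(3,4)]]
    by (simp add: distrib_left sum.distrib mult.assoc flip: sum_distrib_left sum_distrib_right)
  then have "(\<Sum>k\<in>{1..n}. V \<mu> (\<nu> k) h s) = (\<Sum>a\<in>A. \<mu> h s a * (\<Sum>k\<in>{1..n}. (\<Sum>b\<in>B. \<nu> k h s b * r h s a b)
      + (\<Sum>s'\<in>S. P h s a s' * V \<mu> (\<nu> k) (Suc h) s')))"
    by (simp add: sum.swap[of _ A] sum_distrib_left)
  also have "\<dots> = (\<Sum>a\<in>A. \<mu> h s a * ((\<Sum>k\<in>{1..n}. \<Sum>b\<in>B. \<nu> k h s b * r h s a b)
    + (\<Sum>s'\<in>S. P h s a s' * (\<Sum>k\<in>{1..n}. V \<mu> (\<nu> k) (Suc h) s'))))"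
    by (simp add: sum.distrib sum_distrib_left sum.swap[of _ S])
  finally show ?thesis .
qed

lemma sum_V_le_best_value:
  assumes "\<mu> \<in> policies H S A" "\<And>k. k \<in> {1..n} \<Longrightarrow> \<nu> k \<in> policies H S B"
  shows "j \<le> H \<Longrightarrow> s \<in> S \<Longrightarrow> (\<Sum>k\<in>{1..n}. V \<mu> (\<nu> k) (Suc H - j) s) \<le> best_value \<nu> n j s"
proof (induction j arbitrary: s)
  case (Suc j)
  then have h: "H - j \<in> {1..H}" and [simp]: "Suc (H - j) = Suc H - j" by auto
  note mu = policiesD[OF assms(1) h Suc(3)]
  have IH: "\<And>s'. s' \<in> S \<Longrightarrow> (\<Sum>k\<in>{1..n}. V \<mu> (\<nu> k) (Suc (H - j)) s') \<le> best_value \<nu> n j s'"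
    using Suc by simp
  have "(\<Sum>k\<in>{1..n}. V \<mu> (\<nu> k) (H - j) s) = (\<Sum>a\<in>A. \<mu> (H - j) s a *
      ((\<Sum>k\<in>{1..n}. \<Sum>b\<in>B. \<nu> k (H - j) s b * r (H - j) s a b)
        + (\<Sum>s'\<in>S. P (H - j) s a s' * (\<Sum>k\<in>{1..n}. V \<mu> (\<nu> k) (Suc (H - j)) s'))))"
    by (rule sum_V_Bellman[OF assms h Suc(3)])
  also have "\<dots> \<le> best_value \<nu> n (Suc j) s"
    unfolding best_value.simps
  proof (rule sum_le_mult_simplex[OF mu], rule order_trans[OF _ Max.coboundedI[OF _ imageI]])
    fix a assume "a \<in> A"
    then show "(\<Sum>k\<in>{1..n}. \<Sum>b\<in>B. \<nu> k (H - j) s b * r (H - j) s a b) +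
          (\<Sum>s'\<in>S. P (H - j) s a s' * (\<Sum>k\<in>{1..n}. V \<mu> (\<nu> k) (Suc (H - j)) s')) \<le>
        (\<Sum>k\<in>{1..n}. \<Sum>b\<in>B. \<nu> k (H - j) s b * r (H - j) s a b) +
          (\<Sum>s'\<in>S. P (H - j) s a s' * best_value \<nu> n j s')"
      using IH prob_simplexD(1)[OF transition[OF h Suc(3)]]
      by (intro add_left_mono sum_mono mult_left_mono) auto
  qed (use finite_spaces in auto)
  finally show ?case by simp
qed simp

text \<open>A deterministic greedy policy attains the maximum at all steps and states
  simultaneously, for the whole sum over k.\<close>

lemma best_value_attained:
  assumes "\<And>k. k \<in> {1..n} \<Longrightarrow> \<nu> k \<in> policies H S B"
  obtains \<mu> where "\<mu> \<in> policies H S A"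
    "\<And>j s. j \<le> H \<Longrightarrow> s \<in> S \<Longrightarrow> (\<Sum>k\<in>{1..n}. V \<mu> (\<nu> k) (Suc H - j) s) = best_value \<nu> n j s"
proof -
  define f where "f h s a = (\<Sum>k\<in>{1..n}. \<Sum>b\<in>B. \<nu> k h s b * r h s a b)
      + (\<Sum>s'\<in>S. P h s a s' * best_value \<nu> n (H - h) s')" for h s a
  have "\<exists>a\<in>A. f h s a = Max (f h s ` A)" for h s
  proof -
    have "Max (f h s ` A) \<in> f h s ` A" using finite_spaces nonempty_spaces by (intro Max_in) auto
    then show ?thesis by force
  qed
  then obtain g where g: "\<And>h s. g h s \<in> A" "\<And>h s. f h s (g h s) = Max (f h s ` A)" by metis
  define \<mu> :: "('s, 'a) policy" where "\<mu> h s a = of_bool (a = g h s)" for h s a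
  have mu: "\<mu> \<in> policies H S A"
    using g(1) finite_spaces by (auto simp: \<mu>_def policies_def prob_simplex_def)
  have "(\<Sum>k\<in>{1..n}. V \<mu> (\<nu> k) (Suc H - j) s) = best_value \<nu> n j s" if "j \<le> H" "s \<in> S" for j s
    using that
  proof (induction j arbitrary: s)
    case (Suc j)
    then have h: "H - j \<in> {1..H}" and [simp]: "Suc (H - j) = Suc H - j" "H - (H - j) = j" by auto
    have "(\<Sum>k\<in>{1..n}. V \<mu> (\<nu> k) (H - j) s) = (\<Sum>a\<in>A. \<mu> (H - j) s a * f (H - j) s a)"
      using sum_V_Bellman[of \<mu> n \<nu>, OF mu assms h Suc(3)] Suc by (simp add: f_def)
    also have "\<dots> = f (H - j) s (g (H - j) s)"
      using finite_spaces g(1) by (simp add: \<mu>_def of_bool_def if_distrib[of "\<lambda>x. x * _"] cong: if_cong)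
    also have "\<dots> = best_value \<nu> n (Suc j) s"
      using g(2)[of "H - j" s] by (simp add: f_def[abs_def])
    finally show ?case by simp
  qed simp
  with mu that show thesis by blast
qed

end

lemma sum_diff_Suc_telescope:
  fixes U :: "nat \<Rightarrow> real"
  shows "(\<Sum>h\<in>{1..n}. U h - U (Suc h)) = U 1 - U (Suc n)"
  by (induction n) auto

lemma sum_swap_last:
  fixes f :: "'s \<Rightarrow> real"
  shows "(\<Sum>z\<in>Z. \<Sum>s\<in>S. \<Sum>a\<in>A. f s * m s a * g s a z) = (\<Sum>s\<in>S. f s * (\<Sum>a\<in>A. m s a * (\<Sum>z\<in>Z. g s a z)))"
proof -
  have "(\<Sum>z\<in>Z. \<Sum>s\<in>S. \<Sum>a\<in>A. f s * m s a * g s a z) = (\<Sum>s\<in>S. \<Sum>a\<in>A. \<Sum>z\<in>Z. f s * m s a * g s a z)"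
    by (subst sum.swap, intro sum.cong refl, rule sum.swap)
  then show ?thesis by (simp add: sum_distrib_left mult.assoc)
qed

section \<open>Reaching probabilities and occupancy expectations\<close>

context fictitious_play
begin

lemma reach_Suc:
  "1 \<le> h \<Longrightarrow> reach \<mu> p (Suc h) s = (\<Sum>s'\<in>S. \<Sum>a\<in>A. reach \<mu> p h s' * \<mu> h s' a * p h s' a s)"
  by (cases h) auto

lemma sum_reach_Suc:
  assumes "1 \<le> h"
  shows "(\<Sum>s\<in>S. reach \<mu> p (Suc h) s * f s) =
    (\<Sum>s\<in>S. reach \<mu> p h s * (\<Sum>a\<in>A. \<mu> h s a * (\<Sum>s'\<in>S. p h s a s' * f s')))"
proof -
  have "(\<Sum>s\<in>S. reach \<mu> p (Suc h) s * f s) =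
      (\<Sum>s'\<in>S. \<Sum>s\<in>S. \<Sum>a\<in>A. reach \<mu> p h s * \<mu> h s a * (p h s a s' * f s'))"
    using assms by (simp add: reach_Suc sum_distrib_right mult.assoc)
  then show ?thesis by (simp only: sum_swap_last)
qed

text \<open>With \<open>?U h\<close> the \<open>reach\<close>-average of \<open>W h\<close>, the
  recursion of \<open>reach\<close> turns the summand of step h into
  \<open>?U h - ?U (Suc h)\<close>. The family \<open>W\<close> is arbitrary, which later permits
  the estimated values \<open>V_bar\<close>.\<close>

lemma reach_telescope:
  "(\<Sum>h\<in>{1..H}. \<Sum>s\<in>S. reach \<mu> p h s * (W h s - (\<Sum>a\<in>A. \<mu> h s a * (\<Sum>s'\<in>S. p h s a s' * W (Suc h) s')))) =
    W 1 s1 - (\<Sum>s\<in>S. reach \<mu> p (Suc H) s * W (Suc H) s)"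
proof -
  let ?U = "\<lambda>h. \<Sum>s\<in>S. reach \<mu> p h s * W h s"
  have "(\<Sum>h\<in>{1..H}. \<Sum>s\<in>S. reach \<mu> p h s * (W h s - (\<Sum>a\<in>A. \<mu> h s a * (\<Sum>s'\<in>S. p h s a s' * W (Suc h) s')))) =
      (\<Sum>h\<in>{1..H}. ?U h - ?U (Suc h))"
    by (intro sum.cong refl) (simp add: right_diff_distrib sum_subtractf sum_reach_Suc)
  also have "\<dots> = ?U 1 - ?U (Suc H)" by (rule sum_diff_Suc_telescope)
  also have "?U 1 = W 1 s1"
    using initial_state finite_spaces by (simp add: of_bool_def if_distrib[of "\<lambda>x. x * _"] cong: if_cong)
  finally show ?thesis .
qed

text \<open>Mass at most 1 rather than equal to 1: for k >= 1 the empirical kernel vanishes at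
  state-action pairs that have not been visited.\<close>

definition substochastic :: "(nat \<Rightarrow> 's \<Rightarrow> 'a \<Rightarrow> 's \<Rightarrow> real) \<Rightarrow> bool" where
  "substochastic p \<longleftrightarrow> (\<forall>h\<in>{1..H}. \<forall>s\<in>S. \<forall>a\<in>A. (\<forall>s'\<in>S. 0 \<le> p h s a s') \<and> (\<Sum>s'\<in>S. p h s a s') \<le> 1)"

lemma substochastic_P: "substochastic P"
  using transition by (auto simp: substochastic_def prob_simplex_def)

lemma reach_nonneg:
  assumes "\<mu> \<in> policies H S A" "substochastic p"
  shows "h \<in> {1..Suc H} \<Longrightarrow> s \<in> S \<Longrightarrow> 0 \<le> reach \<mu> p h s"
proof (induction h arbitrary: s)
  case (Suc h)
  show ?case
  proof (cases "h = 0")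
    case False
    then have h: "h \<in> {1..H}" using Suc(2) by auto
    have "0 \<le> \<mu> h s' a" if "s' \<in> S" "a \<in> A" for s' a
      using prob_simplexD(1)[OF policiesD[OF assms(1) h]] that by auto
    with h show ?thesis
      using Suc assms(2)
      by (auto simp: reach_Suc substochastic_def intro!: sum_nonneg mult_nonneg_nonneg)
  qed simp
qed simp

lemma sum_reach_le_1:
  assumes "\<mu> \<in> policies H S A" "substochastic p"
  shows "h \<in> {1..Suc H} \<Longrightarrow> (\<Sum>s\<in>S. reach \<mu> p h s) \<le> 1"
proof (induction h)
  case (Suc h)
  show ?case
  proof (cases "h = 0")
    case True
    then show ?thesis using initial_state finite_spaces by (simp add: of_bool_def)
  next
    case False
    then have h: "h \<in> {1..H}" using Suc(2) by auto
    have "(\<Sum>s\<in>S. reach \<mu> p (Suc h) s) = (\<Sum>s\<in>S. reach \<mu> p h s * (\<Sum>a\<in>A. \<mu> h s a * (\<Sum>s'\<in>S. p h s a s')))"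
      using sum_reach_Suc[of h \<mu> p "\<lambda>_. 1"] h by simp
    also have "\<dots> \<le> (\<Sum>s\<in>S. reach \<mu> p h s * 1)"
    proof (intro sum_mono mult_left_mono)
      fix s assume "s \<in> S"
      then show "(\<Sum>a\<in>A. \<mu> h s a * (\<Sum>s'\<in>S. p h s a s')) \<le> 1"
        using assms(2) h by (intro sum_le_mult_simplex[OF policiesD[OF assms(1)]]) (auto simp: substochastic_def)
      show "0 \<le> reach \<mu> p h s" using reach_nonneg[OF assms] h \<open>s \<in> S\<close> by auto
    qed
    also have "\<dots> \<le> 1" using Suc h by simp
    finally show ?thesis .
  qed
qed simp

lemma reach_le_1:
  assumes "\<mu> \<in> policies H S A" "substochastic p" "h \<in> {1..Suc H}" "s \<in> S"
  shows "reach \<mu> p h s \<le> 1"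
  using member_le_sum[of s S "reach \<mu> p h"] sum_reach_le_1[OF assms(1-3)] reach_nonneg[OF assms(1-3)]
    assms(4) finite_spaces by fastforce

text \<open>\<open>occ \<mu> \<nu> f\<close> is the expectation of \<open>\<Sum>h. f h s\<^sub>h a\<^sub>h b\<^sub>h\<close> in an episode played with \<open>\<mu>\<close> and \<open>\<nu>\<close>.\<close>

definition occ :: "('s, 'a) policy \<Rightarrow> ('s, 'b) policy \<Rightarrow> (nat \<Rightarrow> 's \<Rightarrow> 'a \<Rightarrow> 'b \<Rightarrow> real) \<Rightarrow> real" where
  "occ \<mu> \<nu> f = (\<Sum>h\<in>{1..H}. \<Sum>s\<in>S. reach \<mu> P h s * (\<Sum>a\<in>A. \<mu> h s a * (\<Sum>b\<in>B. \<nu> h s b * f h s a b)))"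

lemma occ_mono:
  assumes "\<mu> \<in> policies H S A" "\<nu> \<in> policies H S B"
    and "\<And>h s a b. h \<in> {1..H} \<Longrightarrow> s \<in> S \<Longrightarrow> a \<in> A \<Longrightarrow> b \<in> B \<Longrightarrow> f h s a b \<le> g h s a b"
  shows "occ \<mu> \<nu> f \<le> occ \<mu> \<nu> g"
  unfolding occ_def
  using assms reach_nonneg[OF assms(1) substochastic_P] prob_simplexD(1)[OF policiesD[OF assms(1)]]
    prob_simplexD(1)[OF policiesD[OF assms(2)]]
  by (intro sum_mono mult_left_mono) auto

lemma occ_cmult: "occ \<mu> \<nu> (\<lambda>h s a b. c * f h s a b) = c * occ \<mu> \<nu> f"
  by (simp add: occ_def sum_distrib_left mult_ac)

lemma occ_add: "occ \<mu> \<nu> (\<lambda>h s a b. f h s a b + g h s a b) = occ \<mu> \<nu> f + occ \<mu> \<nu> g"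
  by (simp add: occ_def distrib_left sum.distrib)

lemma occ_state_action:
  assumes "\<nu> \<in> policies H S B"
  shows "occ \<mu> \<nu> (\<lambda>h s a b. f h s a) = (\<Sum>h\<in>{1..H}. \<Sum>s\<in>S. reach \<mu> P h s * (\<Sum>a\<in>A. \<mu> h s a * f h s a))"
  unfolding occ_def using prob_simplexD(2)[OF policiesD[OF assms]]
  by (intro sum.cong refl) (simp flip: sum_distrib_right)

lemma telescope_occ:
  assumes "\<nu> \<in> policies H S B"
  shows "W 1 s1 - (\<Sum>s\<in>S. reach \<mu> P (Suc H) s * W (Suc H) s) =
    (\<Sum>h\<in>{1..H}. \<Sum>s\<in>S. reach \<mu> P h s * W h s) - occ \<mu> \<nu> (\<lambda>h s a b. \<Sum>s'\<in>S. P h s a s' * W (Suc h) s')"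
  unfolding occ_state_action[OF assms] reach_telescope[of \<mu> P W, symmetric]
  by (simp add: right_diff_distrib sum_subtractf)

lemma V_eq_occ:
  assumes "\<mu> \<in> policies H S A" "\<nu> \<in> policies H S B"
  shows "V \<mu> \<nu> 1 s1 = occ \<mu> \<nu> r"
proof -
  have "(\<Sum>h\<in>{1..H}. \<Sum>s\<in>S. reach \<mu> P h s * V \<mu> \<nu> h s) =
      occ \<mu> \<nu> (\<lambda>h s a b. r h s a b + (\<Sum>s'\<in>S. P h s a s' * V \<mu> \<nu> (Suc h) s'))"
    unfolding occ_def using V_Bellman[OF assms]
    by (intro sum.cong refl) (simp add: sum_distrib_left mult.assoc)
  with telescope_occ[OF assms(2), of "V \<mu> \<nu>" \<mu>] show ?thesis by (simp add: occ_add)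
qed

text \<open>\<open>W\<close> is any family that ends in 0. For \<open>W = V_bar\<close> the
  right-hand side is the accumulated Bellman error of the estimated values under the true
  model.\<close>

lemma performance_difference:
  assumes "\<mu> \<in> policies H S A" "\<nu> \<in> policies H S B" "\<And>s. s \<in> S \<Longrightarrow> W (Suc H) s = 0"
  shows "V \<mu> \<nu> 1 s1 - W 1 s1 = occ \<mu> \<nu> (\<lambda>h s a b. r h s a b + (\<Sum>s'\<in>S. P h s a s' * W (Suc h) s'))
    - (\<Sum>h\<in>{1..H}. \<Sum>s\<in>S. reach \<mu> P h s * W h s)"
  using telescope_occ[OF assms(2), of W \<mu>] V_eq_occ[OF assms(1,2)] assms(3) by (simp add: occ_add)

text \<open>The error after one more step is the kernel error weighted by the true reaching
  probabilities, plus the old error pushed through \<open>p\<close>, which does not increase the L1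
  norm. Weighting by the true probabilities makes the bound an \<open>occ\<close>
  expectation.\<close>

lemma reach_perturbation:
  assumes mu: "\<mu> \<in> policies H S A" and p: "substochastic p"
  shows "h \<in> {1..H} \<Longrightarrow> (\<Sum>s\<in>S. \<bar>reach \<mu> P h s - reach \<mu> p h s\<bar>) \<le>
    (\<Sum>i\<in>{1..<h}. \<Sum>s\<in>S. reach \<mu> P i s * (\<Sum>a\<in>A. \<mu> i s a * (\<Sum>s'\<in>S. \<bar>P i s a s' - p i s a s'\<bar>)))"
proof (induction h)
  case (Suc h)
  show ?case
  proof (cases "h = 0")
    case False
    then have h: "h \<in> {1..H}" using Suc(2) by auto
    let ?e = "\<lambda>s. reach \<mu> P h s - reach \<mu> p h s"
    note nn = reach_nonneg[OF mu substochastic_P] prob_simplexD(1)[OF policiesD[OF mu]]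
    have pnn: "0 \<le> p h s a s'" if "s \<in> S" "a \<in> A" "s' \<in> S" for s a s'
      using p h that by (auto simp: substochastic_def)
    have "(\<Sum>s'\<in>S. \<bar>reach \<mu> P (Suc h) s' - reach \<mu> p (Suc h) s'\<bar>) =
        (\<Sum>s'\<in>S. \<bar>\<Sum>s\<in>S. \<Sum>a\<in>A. reach \<mu> P h s * \<mu> h s a * (P h s a s' - p h s a s') + ?e s * \<mu> h s a * p h s a s'\<bar>)"
    proof -
      have "1 \<le> h" using h by simp
      then show ?thesis unfolding reach_Suc[OF \<open>1 \<le> h\<close>] sum_subtractf[symmetric]
        by (intro sum.cong refl arg_cong[where f = abs]) (simp add: algebra_simps)
    qed
    also have "\<dots> \<le> (\<Sum>s'\<in>S. \<Sum>s\<in>S. \<Sum>a\<in>A. reach \<mu> P h s * \<mu> h s a * \<bar>P h s a s' - p h s a s'\<bar> + \<bar>?e s\<bar> * \<mu> h s a * p h s a s')"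
    proof (intro sum_mono order_trans[OF sum_abs] order_trans[OF abs_triangle_ineq] add_mono)
      fix s' s a assume "s' \<in> S" "s \<in> S" "a \<in> A"
      then show "\<bar>reach \<mu> P h s * \<mu> h s a * (P h s a s' - p h s a s')\<bar> \<le> reach \<mu> P h s * \<mu> h s a * \<bar>P h s a s' - p h s a s'\<bar>"
        "\<bar>?e s * \<mu> h s a * p h s a s'\<bar> \<le> \<bar>?e s\<bar> * \<mu> h s a * p h s a s'"
        using nn h pnn by (auto simp: abs_mult)
    qed
    also have "\<dots> = (\<Sum>s\<in>S. reach \<mu> P h s * (\<Sum>a\<in>A. \<mu> h s a * (\<Sum>s'\<in>S. \<bar>P h s a s' - p h s a s'\<bar>))) +
        (\<Sum>s\<in>S. \<bar>?e s\<bar> * (\<Sum>a\<in>A. \<mu> h s a * (\<Sum>s'\<in>S. p h s a s')))"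
      by (simp only: sum.distrib sum_swap_last)
    also have "(\<Sum>s\<in>S. \<bar>?e s\<bar> * (\<Sum>a\<in>A. \<mu> h s a * (\<Sum>s'\<in>S. p h s a s'))) \<le> (\<Sum>s\<in>S. \<bar>?e s\<bar> * 1)"
      using p h by (intro sum_mono mult_left_mono sum_le_mult_simplex[OF policiesD[OF mu h]])
        (auto simp: substochastic_def)
    also have "\<dots> \<le> (\<Sum>i\<in>{1..<h}. \<Sum>s\<in>S. reach \<mu> P i s * (\<Sum>a\<in>A. \<mu> i s a * (\<Sum>s'\<in>S. \<bar>P i s a s' - p i s a s'\<bar>)))"
      using Suc(1) h by simp
    finally show ?thesis using h by (simp add: atLeastLessThanSuc)
  qed simp
qed simp

end

section \<open>Regret under accurate estimates\<close>

text \<open>Exponential weights ignore a common factor, so shifting all losses by a constant changes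
  nothing; this converts gains into losses.\<close>

lemma normalized_cmult: "c \<noteq> 0 \<Longrightarrow> normalized X (\<lambda>x. c * w x) = normalized X w"
  by (simp add: normalized_def fun_eq_iff flip: sum_distrib_left)

text \<open>\<open>arg_max\<close> is a choice operator, so its defining property becomes available
  only once some maximiser \<open>x\<close> is exhibited.\<close>

lemma arg_max_is_max:
  fixes f :: "'x \<Rightarrow> real"
  assumes "Q x" "\<And>y. Q y \<Longrightarrow> f y \<le> f x"
  shows "Q (arg_max f Q)" "f (arg_max f Q) = f x"
proof -
  have "is_arg_max f Q x" using assms by (auto simp: is_arg_max_linorder)
  then have "is_arg_max f Q (arg_max f Q)" unfolding arg_max_def by (rule someI)
  then show "Q (arg_max f Q)" "f (arg_max f Q) = f x"
    using assms by (auto simp: is_arg_max_linorder intro: antisym)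
qed

lemma arg_min_is_min:
  fixes f :: "'x \<Rightarrow> real"
  assumes "Q x" "\<And>y. Q y \<Longrightarrow> f x \<le> f y"
  shows "Q (arg_min f Q)" "f (arg_min f Q) = f x"
proof -
  have "is_arg_min f Q x" using assms by (auto simp: is_arg_min_linorder)
  then have "is_arg_min f Q (arg_min f Q)" unfolding arg_min_def by (rule someI)
  then show "Q (arg_min f Q)" "f (arg_min f Q) = f x"
    using assms by (auto simp: is_arg_min_linorder intro: antisym)
qed

section \<open>Policies of the run and the optimal comparators\<close>

context fictitious_play
begin

lemma pol_0:
  "pol1 \<omega> 0 h s a = 1 / real (card A)" "pol2 \<omega> 0 h s b = 1 / real (card B)"
  by (simp_all add: pol1_def pol2_def)

lemma pol_Suc:
  "pol1 \<omega> (Suc k) = update1 \<omega> k (pol1 \<omega> k) (pol2 \<omega> k)"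
  "pol2 \<omega> (Suc k) = update2 \<omega> k (pol1 \<omega> k) (pol2 \<omega> k)"
  by (simp_all add: pol1_def pol2_def case_prod_unfold)

text \<open>Positivity is part of the induction because the next update divides by the sum of the
  reweighted probabilities. All h and s are covered, also outside the game, since each update
  normalises pointwise.\<close>

lemma pol_simplex:
  "(\<forall>a\<in>A. 0 < pol1 \<omega> k h s a) \<and> pol1 \<omega> k h s \<in> prob_simplex A"
  "(\<forall>b\<in>B. 0 < pol2 \<omega> k h s b) \<and> pol2 \<omega> k h s \<in> prob_simplex B"
proof (induction k arbitrary: h s)
  case 0
  case 1 show ?case using finite_spaces nonempty_spaces by (auto simp: pol_0 prob_simplex_def card_gt_0_iff)
  case 2 show ?case using finite_spaces nonempty_spaces by (auto simp: pol_0 prob_simplex_def card_gt_0_iff)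
next
  case (Suc k)
  case 1 show ?case unfolding pol_Suc update1_def
    using normalized_simplex[OF finite_spaces(2) nonempty_spaces(2)] Suc by simp
  case 2 show ?case unfolding pol_Suc update2_def
    using normalized_simplex[OF finite_spaces(3) nonempty_spaces(3)] Suc by simp
qed

lemma pol_policies: "pol1 \<omega> k \<in> policies H S A" "pol2 \<omega> k \<in> policies H S B"
  using pol_simplex by (auto simp: policies_def)

lemma best1_optimal:
  "best1 \<omega> \<in> policies H S A"
  "(\<Sum>k\<in>{1..K}. V (best1 \<omega>) (pol2 \<omega> k) 1 s1) = best_value (pol2 \<omega>) K H s1"
proof -
  obtain \<mu> where mu: "\<mu> \<in> policies H S A"
    "\<And>j s. j \<le> H \<Longrightarrow> s \<in> S \<Longrightarrow> (\<Sum>k\<in>{1..K}. V \<mu> (pol2 \<omega> k) (Suc H - j) s) = best_value (pol2 \<omega>) K j s"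
    using best_value_attained[of K "pol2 \<omega>"] pol_policies by blast
  let ?f = "\<lambda>\<mu>. \<Sum>k\<in>{1..K}. V \<mu> (pol2 \<omega> k) 1 s1"
  have val: "?f \<mu> = best_value (pol2 \<omega>) K H s1" using mu(2)[of H s1] initial_state by simp
  have le: "?f \<mu>' \<le> ?f \<mu>" if "\<mu>' \<in> policies H S A" for \<mu>'
    using sum_V_le_best_value[of \<mu>' K "pol2 \<omega>" H s1] that pol_policies initial_state val by simp
  note am = arg_max_is_max[of "\<lambda>\<mu>. \<mu> \<in> policies H S A" \<mu> ?f, OF mu(1) le]
  show "best1 \<omega> \<in> policies H S A" using am(1) by (simp add: best1_def)
  show "?f (best1 \<omega>) = best_value (pol2 \<omega>) K H s1" using am(2) val by (simp add: best1_def)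
qed

definition cum_loss :: "'w \<Rightarrow> nat \<Rightarrow> 's \<Rightarrow> 'b \<Rightarrow> real" where
  "cum_loss \<omega> h s b = (\<Sum>k\<in>{1..K}. reach (pol1 \<omega> k) P h s * (\<Sum>a\<in>A. pol1 \<omega> k h s a * r h s a b))"

text \<open>The reaching probabilities do not change with \<nu>, so the summed value is linear in
  \<nu> with coefficients \<open>cum_loss\<close>, and its minimisation splits over steps and
  states.\<close>

lemma sum_V_eq_cum_loss:
  assumes "\<nu> \<in> policies H S B"
  shows "(\<Sum>k\<in>{1..K}. V (pol1 \<omega> k) \<nu> 1 s1) = (\<Sum>h\<in>{1..H}. \<Sum>s\<in>S. \<Sum>b\<in>B. \<nu> h s b * cum_loss \<omega> h s b)"
proof -
  have "V (pol1 \<omega> k) \<nu> 1 s1 = (\<Sum>h\<in>{1..H}. \<Sum>s\<in>S. \<Sum>b\<in>B. \<nu> h s b *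
      (reach (pol1 \<omega> k) P h s * (\<Sum>a\<in>A. pol1 \<omega> k h s a * r h s a b)))" for k
    unfolding V_eq_occ[OF pol_policies(1) assms] occ_def sum_distrib_left
    by (intro sum.cong refl, subst sum.swap) (simp add: mult_ac)
  then have "(\<Sum>k\<in>{1..K}. V (pol1 \<omega> k) \<nu> 1 s1) = (\<Sum>k\<in>{1..K}. \<Sum>h\<in>{1..H}. \<Sum>s\<in>S. \<Sum>b\<in>B. \<nu> h s b *
      (reach (pol1 \<omega> k) P h s * (\<Sum>a\<in>A. pol1 \<omega> k h s a * r h s a b)))" by simp
  also have "\<dots> = (\<Sum>h\<in>{1..H}. \<Sum>s\<in>S. \<Sum>b\<in>B. \<Sum>k\<in>{1..K}. \<nu> h s b *
      (reach (pol1 \<omega> k) P h s * (\<Sum>a\<in>A. pol1 \<omega> k h s a * r h s a b)))"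
    by (subst sum.swap, rule sum.cong[OF refl], subst sum.swap, rule sum.cong[OF refl], rule sum.swap)
  finally show ?thesis by (simp add: cum_loss_def sum_distrib_left)
qed

lemma best2_optimal:
  "best2 \<omega> \<in> policies H S B"
  "(\<Sum>k\<in>{1..K}. V (pol1 \<omega> k) (best2 \<omega>) 1 s1) = (\<Sum>h\<in>{1..H}. \<Sum>s\<in>S. Min (cum_loss \<omega> h s ` B))"
proof -
  have "\<exists>b\<in>B. cum_loss \<omega> h s b = Min (cum_loss \<omega> h s ` B)" for h s
  proof -
    have "Min (cum_loss \<omega> h s ` B) \<in> cum_loss \<omega> h s ` B" using finite_spaces nonempty_spaces by (intro Min_in) auto
    then show ?thesis by force
  qed
  then obtain g where g: "\<And>h s. g h s \<in> B" "\<And>h s. cum_loss \<omega> h s (g h s) = Min (cum_loss \<omega> h s ` B)" by metis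
  define \<nu> :: "('s, 'b) policy" where "\<nu> h s b = of_bool (b = g h s)" for h s b
  have nu: "\<nu> \<in> policies H S B"
    using g(1) finite_spaces by (auto simp: \<nu>_def policies_def prob_simplex_def)
  let ?f = "\<lambda>\<nu>. \<Sum>k\<in>{1..K}. V (pol1 \<omega> k) \<nu> 1 s1"
  have val: "?f \<nu> = (\<Sum>h\<in>{1..H}. \<Sum>s\<in>S. Min (cum_loss \<omega> h s ` B))"
    unfolding sum_V_eq_cum_loss[OF nu] using g finite_spaces
    by (simp add: \<nu>_def of_bool_def if_distrib[of "\<lambda>x. x * _"] cong: if_cong)
  have le: "?f \<nu> \<le> ?f \<nu>'" if "\<nu>' \<in> policies H S B" for \<nu>'
    unfolding val sum_V_eq_cum_loss[OF that] using finite_spaces that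
    by (intro sum_mono sum_ge_mult_simplex[OF policiesD] Min_le) auto
  note am = arg_min_is_min[of "\<lambda>\<nu>. \<nu> \<in> policies H S B" \<nu> ?f, OF nu le]
  show "best2 \<omega> \<in> policies H S B" using am(1) by (simp add: best2_def)
  show "?f (best2 \<omega>) = (\<Sum>h\<in>{1..H}. \<Sum>s\<in>S. Min (cum_loss \<omega> h s ` B))" using am(2) val by (simp add: best2_def)
qed

section \<open>Empirical transitions and optimistic values\<close>

lemma substochastic_P_hat: "substochastic (P_hat \<omega> k)"
proof -
  have "(\<Sum>s'\<in>S. P_hat \<omega> k h s a s') \<le> 1" for h s a
  proof (cases "k = 0")
    case True
    then show ?thesis using finite_spaces nonempty_spaces by (simp add: P_hat_def)
  next
    case False
    have "(\<Sum>s'\<in>S. \<Sum>\<tau>\<in>{1..k}. of_bool (st \<tau> h \<omega> = s \<and> ac \<tau> h \<omega> = a \<and> st \<tau> (Suc h) \<omega> = s')) =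
        (\<Sum>\<tau>\<in>{1..k}. \<Sum>s'\<in>S. of_bool (st \<tau> h \<omega> = s \<and> ac \<tau> h \<omega> = a \<and> st \<tau> (Suc h) \<omega> = s') :: real)"
      by (rule sum.swap)
    also have "\<dots> \<le> (\<Sum>\<tau>\<in>{1..k}. of_bool (st \<tau> h \<omega> = s \<and> ac \<tau> h \<omega> = a))"
      using finite_spaces by (intro sum_mono) (auto simp: of_bool_def)
    also have "\<dots> = real (count_sa \<omega> k h s a)"
      by (simp add: count_sa_def Int_def)
    also have "\<dots> \<le> real (max (count_sa \<omega> k h s a) 1)" by simp
    finally show ?thesis using False by (simp add: P_hat_def flip: sum_divide_distrib)
  qed
  then show ?thesis by (auto simp: substochastic_def P_hat_def intro!: divide_nonneg_nonneg sum_nonneg)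
qed

lemma V_bar_end: "V_bar \<omega> k \<mu> \<nu> (Suc H) s = 0"
  by (subst V_bar.simps) simp

lemma V_bar_eq:
  "h \<in> {1..H} \<Longrightarrow> V_bar \<omega> k \<mu> \<nu> h s = (\<Sum>a\<in>A. \<mu> h s a * (\<Sum>b\<in>B. \<nu> h s b * Q_bar \<omega> k \<mu> \<nu> h s a b))"
  by (subst V_bar.simps) (simp add: Q_bar_def sum_distrib_left mult_ac)

lemma Q_bar_range:
  assumes "h \<in> {1..H}"
  shows "0 \<le> Q_bar \<omega> k \<mu> \<nu> h s a b" "Q_bar \<omega> k \<mu> \<nu> h s a b \<le> real H - real h + 1"
  using assms by (auto simp: Q_bar_def Q_step_def)

lemma V_bar_range:
  assumes "\<mu> \<in> policies H S A" "\<nu> \<in> policies H S B" "h \<in> {1..Suc H}" "s \<in> S"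
  shows "0 \<le> V_bar \<omega> k \<mu> \<nu> h s" "V_bar \<omega> k \<mu> \<nu> h s \<le> real H - real h + 1"
proof -
  have "0 \<le> V_bar \<omega> k \<mu> \<nu> h s \<and> V_bar \<omega> k \<mu> \<nu> h s \<le> real H - real h + 1"
  proof (cases "h = Suc H")
    case True
    then show ?thesis by (simp add: V_bar_end)
  next
    case False
    then have h: "h \<in> {1..H}" using assms by auto
    show ?thesis unfolding V_bar_eq[OF h]
      using Q_bar_range[OF h]
      by (intro conjI sum_ge_mult_simplex[OF policiesD[OF assms(1) h assms(4)]] sum_ge_mult_simplex[OF policiesD[OF assms(2) h assms(4)]]
        sum_le_mult_simplex[OF policiesD[OF assms(1) h assms(4)]] sum_le_mult_simplex[OF policiesD[OF assms(2) h assms(4)]]) auto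
  qed
  then show "0 \<le> V_bar \<omega> k \<mu> \<nu> h s" "V_bar \<omega> k \<mu> \<nu> h s \<le> real H - real h + 1" by auto
qed

section \<open>Accuracy of the estimates and the regret of Player 1\<close>

definition reward_accurate :: "'w \<Rightarrow> bool" where
  "reward_accurate \<omega> \<longleftrightarrow> (\<forall>k\<in>{1..K}. \<forall>h\<in>{1..H}. \<forall>s\<in>S. \<forall>a\<in>A. \<forall>b\<in>B.
     \<bar>r_hat \<omega> k h s a b - r h s a b\<bar> \<le> bonus_r \<omega> k h s a b)"

text \<open>Uniform in \<open>W\<close>, because it is applied to \<open>V_bar\<close>, which
  depends on the data. As H >= 1, indicator functions are admissible too; they give the L1
  error.\<close>

definition transition_accurate :: "'w \<Rightarrow> bool" where
  "transition_accurate \<omega> \<longleftrightarrow> (\<forall>k\<in>{1..K}. \<forall>h\<in>{1..H}. \<forall>s\<in>S. \<forall>a\<in>A. \<forall>W. (\<forall>s'\<in>S. 0 \<le> W s' \<and> W s' \<le> real H) \<longrightarrow>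
     \<bar>\<Sum>s'\<in>S. (P_hat \<omega> k h s a s' - P h s a s') * W s'\<bar> \<le> bonus_P \<omega> k h s a)"

definition bonus_sum :: "'w \<Rightarrow> real" where
  "bonus_sum \<omega> = (\<Sum>k\<in>{1..K}. occ (pol1 \<omega> k) (pol2 \<omega> k) (bonus \<omega> k))"

text \<open>The errors of the reward and transition estimates stay within their bonuses, so adding
  the bonus yields optimism at the price of twice the bonus. Clipping is harmless because the true
  backup \<open>m\<close> itself lies between 0 and H - h + 1.\<close>

lemma Q_bar_bounds:
  assumes good: "reward_accurate \<omega>" "transition_accurate \<omega>" and k: "k \<in> {1..K}"
    and pol: "\<mu> \<in> policies H S A" "\<nu> \<in> policies H S B"
    and x: "h \<in> {1..H}" "s \<in> S" "a \<in> A" "b \<in> B"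
  defines "m \<equiv> r h s a b + (\<Sum>s'\<in>S. P h s a s' * V_bar \<omega> k \<mu> \<nu> (Suc h) s')"
  shows "m \<le> Q_bar \<omega> k \<mu> \<nu> h s a b" "Q_bar \<omega> k \<mu> \<nu> h s a b \<le> m + 2 * bonus \<omega> k h s a b"
proof -
  let ?W = "V_bar \<omega> k \<mu> \<nu> (Suc h)"
  have W: "0 \<le> ?W s' \<and> ?W s' \<le> real H - real h" if "s' \<in> S" for s'
    using V_bar_range[OF pol _ that, of "Suc h"] x by auto
  then have W': "\<forall>s'\<in>S. 0 \<le> ?W s' \<and> ?W s' \<le> real H" by fastforce
  have P: "\<bar>\<Sum>s'\<in>S. (P_hat \<omega> k h s a s' - P h s a s') * ?W s'\<bar> \<le> bonus_P \<omega> k h s a"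
    using good(2) k x W' unfolding transition_accurate_def by blast
  have P': "(\<Sum>s'\<in>S. (P_hat \<omega> k h s a s' - P h s a s') * ?W s') =
      (\<Sum>s'\<in>S. P_hat \<omega> k h s a s' * ?W s') - (\<Sum>s'\<in>S. P h s a s' * ?W s')"
    by (simp add: left_diff_distrib sum_subtractf)
  have R: "\<bar>r_hat \<omega> k h s a b - r h s a b\<bar> \<le> bonus_r \<omega> k h s a b"
    using good(1) k x unfolding reward_accurate_def by blast
  have m: "0 \<le> m" "m \<le> real H - real h + 1"
    using reward_range[OF x] W
      sum_ge_mult_simplex[OF transition[OF x(1-3)], of 0 ?W]
      sum_le_mult_simplex[OF transition[OF x(1-3)], of ?W "real H - real h"]
    unfolding m_def by auto
  let ?x = "r_hat \<omega> k h s a b + (\<Sum>s'\<in>S. P_hat \<omega> k h s a s' * ?W s') + bonus \<omega> k h s a b"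
  have "m \<le> ?x" "?x \<le> m + 2 * bonus \<omega> k h s a b" "0 \<le> bonus \<omega> k h s a b"
    using P R unfolding P' bonus_def m_def by (simp_all add: abs_le_iff)
  then show "m \<le> Q_bar \<omega> k \<mu> \<nu> h s a b" "Q_bar \<omega> k \<mu> \<nu> h s a b \<le> m + 2 * bonus \<omega> k h s a b"
    using m unfolding Q_bar_def Q_step_def by (auto simp: max_def min_def)
qed

text \<open>The gains \<open>g\<close> lie in [0, H] and become losses \<open>H - g\<close>. Then G
  = H and c = 1 / H^2, for which the factor in \<open>hedge_regret\<close> is 2 H. The loss of round
  k uses the estimates after episode k, exactly as the update to episode k + 1 does.\<close>

lemma player1_hedge:
  assumes "q \<in> prob_simplex A" and h: "h \<in> {1..H}"
  shows "(\<Sum>k\<in>{1..K}. (\<Sum>a\<in>A. q a * (\<Sum>b\<in>B. pol2 \<omega> k h s b * Q_bar \<omega> k (pol1 \<omega> k) (pol2 \<omega> k) h s a b))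
      - V_bar \<omega> k (pol1 \<omega> k) (pol2 \<omega> k) h s) \<le> real H + 2 * real H * sqrt (real K * ln (real (card A)))"
proof -
  define g where "g k a = (\<Sum>b\<in>B. pol2 \<omega> k h s b * Q_bar \<omega> k (pol1 \<omega> k) (pol2 \<omega> k) h s a b)" for k a
  have H0: "0 < real H" using horizon_pos by simp
  have g: "0 \<le> g k a \<and> g k a \<le> real H" for k a
  proof -
    have "Q_bar \<omega> k (pol1 \<omega> k) (pol2 \<omega> k) h s a b \<le> real H" for b
      using Q_bar_range(2)[OF h, of \<omega> k "pol1 \<omega> k" "pol2 \<omega> k" s a b] h by auto
    then show ?thesis unfolding g_def
      using pol_simplex Q_bar_range(1)[OF h]
      by (intro conjI sum_ge_mult_simplex sum_le_mult_simplex) blast+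
  qed
  have upd: "pol1 \<omega> (Suc k) h s a = normalized A (\<lambda>a. pol1 \<omega> k h s a * exp (- \<eta> * (real H - g k a))) a" for k a
  proof -
    have "(\<lambda>a. pol1 \<omega> k h s a * exp (- \<eta> * (real H - g k a))) =
        (\<lambda>a. exp (- \<eta> * real H) * (pol1 \<omega> k h s a * exp (\<eta> * g k a)))"
      by (simp add: fun_eq_iff algebra_simps flip: exp_add)
    then have "normalized A (\<lambda>a. pol1 \<omega> k h s a * exp (- \<eta> * (real H - g k a))) =
        normalized A (\<lambda>a. pol1 \<omega> k h s a * exp (\<eta> * g k a))"
      by (simp add: normalized_cmult)
    then show ?thesis by (simp add: pol_Suc update1_def g_def mult.commute)
  qed
  have eta: "\<eta> = sqrt (1 / (real H)\<^sup>2 * ln (card A) / K)"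
    by (simp add: \<eta>_def mult.commute)
  have "(\<Sum>k\<in>{1..K}. (\<Sum>a\<in>A. pol1 \<omega> k h s a * (real H - g k a)) - (\<Sum>a\<in>A. q a * (real H - g k a)))
      \<le> real H + (1 / sqrt (1 / (real H)\<^sup>2) + sqrt (1 / (real H)\<^sup>2) * (real H)\<^sup>2) * sqrt (K * ln (card A))"
    using finite_spaces nonempty_spaces H0 episodes_pos pol_simplex g
    by (intro hedge_regret[where p = "\<lambda>k. pol1 \<omega> k h s" and l = "\<lambda>k a. real H - g k a", OF _ _ eta _ _ _ upd])
      (auto simp: pol_0 assms)
  also have "1 / sqrt (1 / (real H)\<^sup>2) + sqrt (1 / (real H)\<^sup>2) * (real H)\<^sup>2 = 2 * real H"
    using H0 by (simp add: real_sqrt_divide power2_eq_square)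
  also have "(\<Sum>k\<in>{1..K}. (\<Sum>a\<in>A. pol1 \<omega> k h s a * (real H - g k a)) - (\<Sum>a\<in>A. q a * (real H - g k a))) =
      (\<Sum>k\<in>{1..K}. (\<Sum>a\<in>A. q a * g k a) - (\<Sum>a\<in>A. pol1 \<omega> k h s a * g k a))"
  proof (intro sum.cong refl)
    fix k
    have "(\<Sum>a\<in>A. pol1 \<omega> k h s a) = 1" "(\<Sum>a\<in>A. q a) = 1"
      using pol_simplex(1) assms(1) by (auto simp: prob_simplex_def)
    then show "(\<Sum>a\<in>A. pol1 \<omega> k h s a * (real H - g k a)) - (\<Sum>a\<in>A. q a * (real H - g k a)) =
        (\<Sum>a\<in>A. q a * g k a) - (\<Sum>a\<in>A. pol1 \<omega> k h s a * g k a)"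
      by (simp add: right_diff_distrib sum_subtractf flip: sum_distrib_right)
  qed
  finally show ?thesis unfolding V_bar_eq[OF h] g_def .
qed

text \<open>The estimated value \<open>V_bar\<close> at the start is inserted between the
  comparator's value and the value played: optimism leaves the exponential-weights regret
  \<open>D\<close> for the first difference, and the Bellman error leaves twice the bonuses for the
  second.\<close>

lemma Regret1_le:
  assumes good: "reward_accurate \<omega>" "transition_accurate \<omega>"
  shows "Regret1 \<omega> \<le> real H * (real H + 2 * real H * sqrt (real K * ln (real (card A)))) + 2 * bonus_sum \<omega>"
proof -
  define R where "R = real H + 2 * real H * sqrt (real K * ln (real (card A)))"
  define D where "D k h s = (\<Sum>a\<in>A. best1 \<omega> h s a * (\<Sum>b\<in>B. pol2 \<omega> k h s b * Q_bar \<omega> k (pol1 \<omega> k) (pol2 \<omega> k) h s a b))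
      - V_bar \<omega> k (pol1 \<omega> k) (pol2 \<omega> k) h s" for k h s
  have R0: "0 \<le> R"
    using finite_spaces nonempty_spaces by (simp add: R_def Suc_le_eq card_gt_0_iff)
  have step: "V (best1 \<omega>) (pol2 \<omega> k) 1 s1 - V (pol1 \<omega> k) (pol2 \<omega> k) 1 s1 \<le>
      (\<Sum>h\<in>{1..H}. \<Sum>s\<in>S. reach (best1 \<omega>) P h s * D k h s) + 2 * occ (pol1 \<omega> k) (pol2 \<omega> k) (bonus \<omega> k)"
    if k: "k \<in> {1..K}" for k
  proof -
    let ?\<mu> = "pol1 \<omega> k" and ?\<nu> = "pol2 \<omega> k"
    let ?W = "V_bar \<omega> k ?\<mu> ?\<nu>" and ?Q = "Q_bar \<omega> k ?\<mu> ?\<nu>"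
    let ?m = "\<lambda>h s a b. r h s a b + (\<Sum>s'\<in>S. P h s a s' * ?W (Suc h) s')"
    note bd = Q_bar_bounds[OF good k pol_policies]
    have W: "(\<Sum>h\<in>{1..H}. \<Sum>s\<in>S. reach ?\<mu> P h s * ?W h s) = occ ?\<mu> ?\<nu> ?Q"
      unfolding occ_def by (intro sum.cong refl) (simp add: V_bar_eq)
    have "V (best1 \<omega>) ?\<nu> 1 s1 - ?W 1 s1 = occ (best1 \<omega>) ?\<nu> ?m - (\<Sum>h\<in>{1..H}. \<Sum>s\<in>S. reach (best1 \<omega>) P h s * ?W h s)"
      by (rule performance_difference[OF best1_optimal(1) pol_policies(2)]) (rule V_bar_end)
    moreover have "occ (best1 \<omega>) ?\<nu> ?m \<le> occ (best1 \<omega>) ?\<nu> ?Q"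
      using bd(1) by (intro occ_mono best1_optimal pol_policies) auto
    moreover have "occ (best1 \<omega>) ?\<nu> ?Q - (\<Sum>h\<in>{1..H}. \<Sum>s\<in>S. reach (best1 \<omega>) P h s * ?W h s) =
        (\<Sum>h\<in>{1..H}. \<Sum>s\<in>S. reach (best1 \<omega>) P h s * D k h s)"
      by (simp add: occ_def D_def right_diff_distrib sum_subtractf)
    ultimately have 1: "V (best1 \<omega>) ?\<nu> 1 s1 - ?W 1 s1 \<le> (\<Sum>h\<in>{1..H}. \<Sum>s\<in>S. reach (best1 \<omega>) P h s * D k h s)" by simp
    \<comment> \<open>For the policies actually played, \<open>V_bar\<close> is the mean of
      \<open>Q_bar\<close> under them, so no regret term appears and only the bonuses
      remain.\<close>
    have "V ?\<mu> ?\<nu> 1 s1 - ?W 1 s1 = occ ?\<mu> ?\<nu> ?m - occ ?\<mu> ?\<nu> ?Q"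
      unfolding W[symmetric] by (rule performance_difference[OF pol_policies]) (rule V_bar_end)
    moreover have "occ ?\<mu> ?\<nu> ?Q \<le> occ ?\<mu> ?\<nu> (\<lambda>h s a b. ?m h s a b + 2 * bonus \<omega> k h s a b)"
      using bd(2) by (intro occ_mono pol_policies) auto
    ultimately show ?thesis using 1 unfolding occ_add occ_cmult by linarith
  qed
  have "Regret1 \<omega> \<le> (\<Sum>k\<in>{1..K}. (\<Sum>h\<in>{1..H}. \<Sum>s\<in>S. reach (best1 \<omega>) P h s * D k h s)
      + 2 * occ (pol1 \<omega> k) (pol2 \<omega> k) (bonus \<omega> k))"
    unfolding Regret1_def using step by (rule sum_mono)
  moreover have "\<dots> = (\<Sum>k\<in>{1..K}. \<Sum>h\<in>{1..H}. \<Sum>s\<in>S. reach (best1 \<omega>) P h s * D k h s) + 2 * bonus_sum \<omega>"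
    unfolding sum.distrib bonus_sum_def sum_distrib_left ..
  moreover have "(\<Sum>k\<in>{1..K}. \<Sum>h\<in>{1..H}. \<Sum>s\<in>S. reach (best1 \<omega>) P h s * D k h s) =
      (\<Sum>h\<in>{1..H}. \<Sum>s\<in>S. reach (best1 \<omega>) P h s * (\<Sum>k\<in>{1..K}. D k h s))"
    unfolding sum_distrib_left by (subst sum.swap, rule sum.cong[OF refl], rule sum.swap)
  moreover have "\<dots> \<le> (\<Sum>h\<in>{1..H}. \<Sum>s\<in>S. reach (best1 \<omega>) P h s * R)"
    unfolding D_def R_def
    by (intro sum_mono mult_left_mono player1_hedge policiesD[OF best1_optimal(1)] reach_nonneg[OF best1_optimal(1) substochastic_P]) auto
  moreover have "\<dots> \<le> (\<Sum>h\<in>{1..H}. R)"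
  proof (rule sum_mono)
    fix h assume "h \<in> {1..H}"
    then have "(\<Sum>s\<in>S. reach (best1 \<omega>) P h s) * R \<le> 1 * R"
      by (intro mult_right_mono R0 sum_reach_le_1[OF best1_optimal(1) substochastic_P]) auto
    then show "(\<Sum>s\<in>S. reach (best1 \<omega>) P h s * R) \<le> R" by (simp add: sum_distrib_right)
  qed
  ultimately show ?thesis by (simp add: R_def)
qed

section \<open>The regret of Player 2\<close>

lemma player2_hedge:
  assumes "q \<in> prob_simplex B" and h: "h \<in> {1..H}" "s \<in> S"
    and r_tilde: "\<And>k a b. k \<in> {1..K} \<Longrightarrow> a \<in> A \<Longrightarrow> b \<in> B \<Longrightarrow> r_tilde \<omega> k h s a b \<le> 1"
  defines "l \<equiv> \<lambda>k b. reach (pol1 \<omega> k) (P_hat \<omega> k) h s * (\<Sum>a\<in>A. pol1 \<omega> k h s a * r_tilde \<omega> k h s a b)"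
  shows "(\<Sum>k\<in>{1..K}. (\<Sum>b\<in>B. pol2 \<omega> k h s b * l k b) - (\<Sum>b\<in>B. q b * l k b))
    \<le> 1 + 2 * real (card S) * sqrt (real K * ln (real (card B)))"
proof -
  have S1: "1 \<le> real (card S)" using finite_spaces nonempty_spaces by (simp add: Suc_le_eq card_gt_0_iff)
  have l: "0 \<le> l k b \<and> l k b \<le> 1" if "k \<le> K" "b \<in> B" for k b
  proof -
    have rt: "0 \<le> r_tilde \<omega> k h s a b \<and> r_tilde \<omega> k h s a b \<le> 1" if "a \<in> A" for a
    \<comment> \<open>The assumption on \<open>r_tilde\<close> starts at k = 1; in round 0 the
      estimate and its bonus are 0 by definition.\<close>
    proof (cases "k = 0")
      case True
      then show ?thesis by (simp add: r_tilde_def r_hat_def bonus_r_def)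
    next
      case False
      then show ?thesis using r_tilde[of k a b] that \<open>k \<le> K\<close> \<open>b \<in> B\<close> by (auto simp: r_tilde_def)
    qed
    have "0 \<le> (\<Sum>a\<in>A. pol1 \<omega> k h s a * r_tilde \<omega> k h s a b)" "(\<Sum>a\<in>A. pol1 \<omega> k h s a * r_tilde \<omega> k h s a b) \<le> 1"
      using rt pol_simplex(1) by (auto intro!: sum_ge_mult_simplex sum_le_mult_simplex)
    moreover have "0 \<le> reach (pol1 \<omega> k) (P_hat \<omega> k) h s" "reach (pol1 \<omega> k) (P_hat \<omega> k) h s \<le> 1"
      using h by (auto intro!: reach_nonneg reach_le_1 pol_policies substochastic_P_hat)
    ultimately show ?thesis unfolding l_def by (simp add: mult_le_one)
  qed
  have upd: "pol2 \<omega> (Suc k) h s b = normalized B (\<lambda>b. pol2 \<omega> k h s b * exp (- \<gamma> * l k b)) b" for k b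
    by (simp add: pol_Suc update2_def l_def mult_ac)
  have "(\<Sum>k\<in>{1..K}. (\<Sum>b\<in>B. pol2 \<omega> k h s b * l k b) - (\<Sum>b\<in>B. q b * l k b))
      \<le> 1 + (1 / sqrt (card S) + sqrt (card S) * 1\<^sup>2) * sqrt (K * ln (card B))"
    using finite_spaces nonempty_spaces S1 episodes_pos pol_simplex l
    by (intro hedge_regret[where p = "\<lambda>k. pol2 \<omega> k h s" and l = l, OF _ _ \<gamma>_def _ _ _ upd])
      (auto simp: pol_0 assms(1))
  \<comment> \<open>With G = 1 and c = |S| the factor is 1 / sqrt |S| + sqrt |S|, generously bounded
    by 2 |S|.\<close>
  also have "\<dots> \<le> 1 + 2 * real (card S) * sqrt (real K * ln (real (card B)))"
  proof -
    have "1 \<le> sqrt (card S)" using S1 by simp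
    then have "1 / sqrt (card S) \<le> 1" by simp
    moreover have "sqrt (card S) \<le> card S"
      using S1 by (intro real_le_lsqrt) (auto simp: power2_eq_square mult_le_cancel_left1)
    ultimately have "1 / sqrt (card S) + sqrt (card S) * 1\<^sup>2 \<le> 2 * real (card S)"
      using S1 unfolding power_one mult_1_right by linarith
    then show ?thesis
      using finite_spaces nonempty_spaces
      by (intro add_left_mono mult_right_mono) (auto simp: Suc_le_eq card_gt_0_iff)
  qed
  finally show ?thesis .
qed

text \<open>The L1 norm is a difference of two integrals of the error, over the sets where it is
  nonnegative and where it is negative; the indicators of both sets are admissible test
  functions.\<close>

lemma l1_error_le_bonus:
  assumes "transition_accurate \<omega>" "k \<in> {1..K}" "h \<in> {1..H}" "s \<in> S" "a \<in> A"
  shows "(\<Sum>s'\<in>S. \<bar>P h s a s' - P_hat \<omega> k h s a s'\<bar>) \<le> 2 * bonus_P \<omega> k h s a"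
proof -
  let ?D = "\<lambda>s'. P_hat \<omega> k h s a s' - P h s a s'"
  have le: "\<bar>\<Sum>s'\<in>S. ?D s' * W s'\<bar> \<le> bonus_P \<omega> k h s a" if "\<And>s'. W s' = 0 \<or> W s' = (1::real)" for W
  proof -
    have "\<forall>s'\<in>S. 0 \<le> W s' \<and> W s' \<le> real H" using that horizon_pos
      by (metis le_numeral_extra(3,4) of_nat_0_le_iff of_nat_1 of_nat_le_iff zero_le_one)
    then show ?thesis using assms unfolding transition_accurate_def by blast
  qed
  have "(\<Sum>s'\<in>S. \<bar>P h s a s' - P_hat \<omega> k h s a s'\<bar>) =
      (\<Sum>s'\<in>S. ?D s' * of_bool (?D s' \<ge> 0)) - (\<Sum>s'\<in>S. ?D s' * of_bool (?D s' < 0))"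
    unfolding sum_subtractf[symmetric] by (intro sum.cong) auto
  also have "\<dots> \<le> 2 * bonus_P \<omega> k h s a"
    using le[of "\<lambda>s'. of_bool (?D s' \<ge> 0)"] le[of "\<lambda>s'. of_bool (?D s' < 0)"] by (simp add: abs_le_iff)
  finally show ?thesis .
qed

text \<open>A one-step error enters the perturbation bounds of the later steps only. Extending these
  inner sums to all steps gives the factor H, and \<open>l1_error_le_bonus\<close> the factor
  2.\<close>

lemma reach_hat_error:
  assumes "transition_accurate \<omega>" "k \<in> {1..K}"
  shows "(\<Sum>h\<in>{1..H}. \<Sum>s\<in>S. \<bar>reach (pol1 \<omega> k) P h s - reach (pol1 \<omega> k) (P_hat \<omega> k) h s\<bar>)
    \<le> 2 * real H * occ (pol1 \<omega> k) (pol2 \<omega> k) (\<lambda>h s a b. bonus_P \<omega> k h s a)"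
proof -
  let ?\<mu> = "pol1 \<omega> k"
  define X where "X i = (\<Sum>s\<in>S. reach ?\<mu> P i s * (\<Sum>a\<in>A. ?\<mu> i s a * (\<Sum>s'\<in>S. \<bar>P i s a s' - P_hat \<omega> k i s a s'\<bar>)))" for i
  have X0: "0 \<le> X i" if "i \<in> {1..H}" for i
    unfolding X_def using that pol_simplex(1)
    by (intro sum_nonneg mult_nonneg_nonneg reach_nonneg[OF pol_policies(1) substochastic_P])
      (auto simp: less_imp_le)
  have "(\<Sum>h\<in>{1..H}. \<Sum>s\<in>S. \<bar>reach ?\<mu> P h s - reach ?\<mu> (P_hat \<omega> k) h s\<bar>) \<le> (\<Sum>h\<in>{1..H}. \<Sum>i\<in>{1..<h}. X i)"
    unfolding X_def by (intro sum_mono reach_perturbation pol_policies substochastic_P_hat)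
  also have "\<dots> \<le> (\<Sum>h\<in>{1..H}. \<Sum>i\<in>{1..H}. X i)"
    using X0 by (intro sum_mono sum_mono2) auto
  finally have "(\<Sum>h\<in>{1..H}. \<Sum>s\<in>S. \<bar>reach ?\<mu> P h s - reach ?\<mu> (P_hat \<omega> k) h s\<bar>) \<le> real H * (\<Sum>i\<in>{1..H}. X i)" by simp
  moreover have "(\<Sum>i\<in>{1..H}. X i) \<le> 2 * occ ?\<mu> (pol2 \<omega> k) (\<lambda>h s a b. bonus_P \<omega> k h s a)"
    unfolding X_def occ_cmult[symmetric]
    using l1_error_le_bonus[OF assms] by (subst occ_state_action[OF pol_policies(2)[of \<omega> k], symmetric]) (intro occ_mono pol_policies)
  then have "real H * (\<Sum>i\<in>{1..H}. X i) \<le> real H * (2 * occ ?\<mu> (pol2 \<omega> k) (\<lambda>h s a b. bonus_P \<omega> k h s a))"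
    by (rule mult_left_mono) simp
  ultimately show ?thesis by (simp add: mult_ac)
qed

text \<open>The pessimistic rewards \<open>r_tilde\<close> stay below r, so replacing r by them
  costs nothing for the comparator and at most twice the bonus for the policy played. Exponential
  weights control the regret weighted by empirical reaching probabilities; exchanging these for the
  true ones costs their L1 distance.\<close>

lemma Regret2_le:
  assumes good: "reward_accurate \<omega>" "transition_accurate \<omega>"
  shows "Regret2 \<omega> \<le> real H * real (card S) * (1 + 2 * real (card S) * sqrt (real K * ln (real (card B))))
    + (2 + 2 * real H) * bonus_sum \<omega>"
proof -
  define R where "R = 1 + 2 * real (card S) * sqrt (real K * ln (real (card B)))"
  define l where "l k h s b = reach (pol1 \<omega> k) (P_hat \<omega> k) h s * (\<Sum>a\<in>A. pol1 \<omega> k h s a * r_tilde \<omega> k h s a b)" for k h s b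
  define D where "D k h s = (\<Sum>b\<in>B. pol2 \<omega> k h s b * l k h s b) - (\<Sum>b\<in>B. best2 \<omega> h s b * l k h s b)" for k h s
  have rt: "0 \<le> r_tilde \<omega> k h s a b" "r_tilde \<omega> k h s a b \<le> r h s a b" "r h s a b \<le> r_tilde \<omega> k h s a b + 2 * bonus_r \<omega> k h s a b"
    "0 \<le> bonus_r \<omega> k h s a b" "r_tilde \<omega> k h s a b \<le> 1"
    if "k \<in> {1..K}" "h \<in> {1..H}" "s \<in> S" "a \<in> A" "b \<in> B" for k h s a b
  proof -
    have "\<bar>r_hat \<omega> k h s a b - r h s a b\<bar> \<le> bonus_r \<omega> k h s a b"
      using good(1) that unfolding reward_accurate_def by blast
    then show "0 \<le> r_tilde \<omega> k h s a b" "r_tilde \<omega> k h s a b \<le> r h s a b" "r h s a b \<le> r_tilde \<omega> k h s a b + 2 * bonus_r \<omega> k h s a b"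
      "0 \<le> bonus_r \<omega> k h s a b" "r_tilde \<omega> k h s a b \<le> 1"
      using reward_range[OF that(2-5)] by (auto simp: r_tilde_def abs_le_iff)
  qed
  have step: "V (pol1 \<omega> k) (pol2 \<omega> k) 1 s1 - V (pol1 \<omega> k) (best2 \<omega>) 1 s1 \<le>
      (\<Sum>h\<in>{1..H}. \<Sum>s\<in>S. D k h s) + (2 + 2 * real H) * occ (pol1 \<omega> k) (pol2 \<omega> k) (bonus \<omega> k)"
    if k: "k \<in> {1..K}" for k
  proof -
    let ?\<mu> = "pol1 \<omega> k" and ?\<nu> = "pol2 \<omega> k" and ?\<nu>' = "best2 \<omega>" and ?rt = "r_tilde \<omega> k"
    define E where "E h s = (\<Sum>a\<in>A. ?\<mu> h s a * (\<Sum>b\<in>B. ?\<nu> h s b * ?rt h s a b)) - (\<Sum>a\<in>A. ?\<mu> h s a * (\<Sum>b\<in>B. ?\<nu>' h s b * ?rt h s a b))" for h s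
    have E1: "\<bar>E h s\<bar> \<le> 1" if "h \<in> {1..H}" "s \<in> S" for h s
    proof -
      have "0 \<le> (\<Sum>a\<in>A. ?\<mu> h s a * (\<Sum>b\<in>B. \<nu> h s b * ?rt h s a b)) \<and>
          (\<Sum>a\<in>A. ?\<mu> h s a * (\<Sum>b\<in>B. \<nu> h s b * ?rt h s a b)) \<le> 1" if "\<nu> \<in> policies H S B" for \<nu>
        using rt(1,5)[OF k \<open>h \<in> {1..H}\<close> \<open>s \<in> S\<close>] policiesD[OF that \<open>h \<in> {1..H}\<close> \<open>s \<in> S\<close>]
          policiesD[OF pol_policies(1) \<open>h \<in> {1..H}\<close> \<open>s \<in> S\<close>]
        by (auto intro!: sum_ge_mult_simplex sum_le_mult_simplex)
      from this[OF pol_policies(2), of \<omega> k] this[OF best2_optimal(1), of \<omega>] show ?thesis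
        unfolding E_def abs_le_iff by linarith
    qed
    have DE: "D k h s = reach ?\<mu> (P_hat \<omega> k) h s * E h s" for h s
    proof -
      have "(\<Sum>b\<in>B. \<nu> h s b * l k h s b) = reach ?\<mu> (P_hat \<omega> k) h s * (\<Sum>a\<in>A. ?\<mu> h s a * (\<Sum>b\<in>B. \<nu> h s b * ?rt h s a b))"
        for \<nu> :: "('s, 'b) policy"
        unfolding l_def sum_distrib_left by (subst sum.swap) (simp add: mult_ac)
      then show ?thesis unfolding D_def E_def by (simp add: right_diff_distrib)
    qed
    have "occ ?\<mu> ?\<nu> ?rt - occ ?\<mu> ?\<nu>' ?rt = (\<Sum>h\<in>{1..H}. \<Sum>s\<in>S. reach ?\<mu> P h s * E h s)"
      by (simp add: occ_def E_def right_diff_distrib sum_subtractf)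
    also have "\<dots> \<le> (\<Sum>h\<in>{1..H}. \<Sum>s\<in>S. D k h s + \<bar>reach ?\<mu> P h s - reach ?\<mu> (P_hat \<omega> k) h s\<bar>)"
    proof (intro sum_mono)
      fix h s assume "h \<in> {1..H}" "s \<in> S"
      \<comment> \<open>\<open>E\<close> is a difference of two averages of values in [0, 1], so the
        change of weights is charged with a factor of at most 1.\<close>
      have "(reach ?\<mu> P h s - reach ?\<mu> (P_hat \<omega> k) h s) * E h s \<le> \<bar>reach ?\<mu> P h s - reach ?\<mu> (P_hat \<omega> k) h s\<bar> * \<bar>E h s\<bar>"
        by (metis abs_ge_self abs_mult)
      also have "\<dots> \<le> \<bar>reach ?\<mu> P h s - reach ?\<mu> (P_hat \<omega> k) h s\<bar> * 1"
        using E1[OF \<open>h \<in> {1..H}\<close> \<open>s \<in> S\<close>] by (intro mult_left_mono) auto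
      finally show "reach ?\<mu> P h s * E h s \<le> D k h s + \<bar>reach ?\<mu> P h s - reach ?\<mu> (P_hat \<omega> k) h s\<bar>"
        unfolding DE by (simp add: algebra_simps)
    qed
    also have "\<dots> \<le> (\<Sum>h\<in>{1..H}. \<Sum>s\<in>S. D k h s) + 2 * real H * occ ?\<mu> ?\<nu> (\<lambda>h s a b. bonus_P \<omega> k h s a)"
      unfolding sum.distrib using reach_hat_error[OF good(2) k] by simp
    finally have 1: "occ ?\<mu> ?\<nu> ?rt - occ ?\<mu> ?\<nu>' ?rt \<le> \<dots>" .
    have bP: "0 \<le> bonus_P \<omega> k h s a" if "h \<in> {1..H}" "s \<in> S" "a \<in> A" for h s a
    proof -
      have "0 \<le> (\<Sum>s'\<in>S. \<bar>P h s a s' - P_hat \<omega> k h s a s'\<bar>)" by (rule sum_nonneg) simp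
      then show ?thesis using l1_error_le_bonus[OF good(2) k that] by linarith
    qed
    have 2: "occ ?\<mu> ?\<nu>' ?rt \<le> occ ?\<mu> ?\<nu>' r"
      using rt(2)[OF k] by (intro occ_mono pol_policies best2_optimal)
    have 3: "occ ?\<mu> ?\<nu> r \<le> occ ?\<mu> ?\<nu> (\<lambda>h s a b. ?rt h s a b + 2 * bonus \<omega> k h s a b)"
      using rt(3)[OF k] bP by (intro occ_mono pol_policies) (fastforce simp: bonus_def)
    have 4: "occ ?\<mu> ?\<nu> (\<lambda>h s a b. bonus_P \<omega> k h s a) \<le> occ ?\<mu> ?\<nu> (bonus \<omega> k)"
      using rt(4)[OF k] by (intro occ_mono pol_policies) (simp add: bonus_def)
    have "2 * real H * occ ?\<mu> ?\<nu> (\<lambda>h s a b. bonus_P \<omega> k h s a) \<le> 2 * real H * occ ?\<mu> ?\<nu> (bonus \<omega> k)"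
      using 4 by (intro mult_left_mono) auto
    then show ?thesis
      using 1 2 3 unfolding V_eq_occ[OF pol_policies(1) pol_policies(2)] V_eq_occ[OF pol_policies(1) best2_optimal(1)]
        occ_add occ_cmult by (simp add: distrib_right)
  qed
  have "Regret2 \<omega> \<le> (\<Sum>k\<in>{1..K}. (\<Sum>h\<in>{1..H}. \<Sum>s\<in>S. D k h s)
      + (2 + 2 * real H) * occ (pol1 \<omega> k) (pol2 \<omega> k) (bonus \<omega> k))"
    unfolding Regret2_def using step by (rule sum_mono)
  moreover have "\<dots> = (\<Sum>k\<in>{1..K}. \<Sum>h\<in>{1..H}. \<Sum>s\<in>S. D k h s) + (2 + 2 * real H) * bonus_sum \<omega>"
    unfolding sum.distrib bonus_sum_def sum_distrib_left ..
  moreover have "(\<Sum>k\<in>{1..K}. \<Sum>h\<in>{1..H}. \<Sum>s\<in>S. D k h s) = (\<Sum>h\<in>{1..H}. \<Sum>s\<in>S. \<Sum>k\<in>{1..K}. D k h s)"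
    by (subst sum.swap, rule sum.cong[OF refl], rule sum.swap)
  moreover have "\<dots> \<le> (\<Sum>h\<in>{1..H}. \<Sum>s\<in>S. R)"
    unfolding D_def l_def R_def
    by (intro sum_mono player2_hedge policiesD[OF best2_optimal(1)] rt(5))
  ultimately show ?thesis by (simp add: R_def)
qed

lemma Gap_le_bonus_sum:
  assumes "reward_accurate \<omega>" "transition_accurate \<omega>"
  shows "Gap \<omega> \<le> real H * (real H + 2 * real H * sqrt (real K * ln (real (card A))))
    + real H * real (card S) * (1 + 2 * real (card S) * sqrt (real K * ln (real (card B))))
    + (4 + 2 * real H) * bonus_sum \<omega>"
  using Regret1_le[OF assms] Regret2_le[OF assms] unfolding Gap_def by (simp add: algebra_simps)

end

section \<open>Exponential supermartingales\<close>

text \<open>The case p = 1/2 of the inequality behind Hoeffding's lemma, at argument 2 l;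
  \<open>cosh l\<close> is the moment generating function of a fair sign. Symmetry settles negative
  l.\<close>

lemma cosh_le_exp_half_square: "cosh l \<le> exp (l\<^sup>2 / 2)" for l :: real
proof -
  have pos: "cosh l \<le> exp (l\<^sup>2 / 2)" if "0 < l" for l :: real
  proof -
    have "- (2 * l) * (1 / 2) + ln (1 + (1 / 2) * (exp (2 * l) - 1)) \<le> (2 * l)\<^sup>2 / 8"
      using that by (intro Hoeffdings_lemma_aux) auto
    then have "ln (1 + (1 / 2) * (exp (2 * l) - 1)) \<le> l + l\<^sup>2 / 2"
      by (simp add: power2_eq_square)
    then have "exp (ln (1 + (1 / 2) * (exp (2 * l) - 1))) \<le> exp (l + l\<^sup>2 / 2)" by simp
    moreover have "0 < 1 + (1 / 2) * (exp (2 * l) - 1)"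
      using exp_gt_zero[of "2 * l"] by (simp add: field_simps add_pos_pos)
    ultimately have "1 + (1 / 2) * (exp (2 * l) - 1) \<le> exp (l + l\<^sup>2 / 2)" by simp
    then have "exp (- l) * (1 + (1 / 2) * (exp (2 * l) - 1)) \<le> exp (- l) * exp (l + l\<^sup>2 / 2)"
      by (rule mult_left_mono) simp
    then show ?thesis by (simp add: cosh_def algebra_simps flip: exp_add)
  qed
  consider "l = 0" | "0 < l" | "0 < - l" by linarith
  then show ?thesis using pos[of l] pos[of "- l"] by cases auto
qed

text \<open>By convexity the exponential lies below its chord between -l and l, and
  \<open>cosh l\<close> is at most the Gaussian factor. The right-hand side is affine in x, so
  orthogonality alone removes the x term in expectation.\<close>

lemma exp_le_of_abs_le_1:
  fixes x l :: real
  assumes "\<bar>x\<bar> \<le> 1"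
  shows "exp (l * x - l\<^sup>2 / 2) \<le> 1 + exp (- l\<^sup>2 / 2) * sinh l * x"
proof -
  have conv: "convex_on UNIV (exp :: real \<Rightarrow> real)"
    using convex_on_exp[of 1] by simp
  have "exp ((1 - (1 - x) / 2) *\<^sub>R l + ((1 - x) / 2) *\<^sub>R (- l)) \<le> (1 - (1 - x) / 2) * exp l + (1 - x) / 2 * exp (- l)"
    using assms by (intro convex_onD[OF conv]) auto
  also have "(1 - (1 - x) / 2) *\<^sub>R l + ((1 - x) / 2) *\<^sub>R (- l) = l * x"
    by (simp add: field_simps)
  also have "(1 - (1 - x) / 2) * exp l + (1 - x) / 2 * exp (- l) = cosh l + x * sinh l"
    by (simp add: cosh_def sinh_def field_simps)
  finally have "exp (l * x) \<le> exp (l\<^sup>2 / 2) + x * sinh l"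
    using cosh_le_exp_half_square[of l] by linarith
  then have "exp (- l\<^sup>2 / 2) * exp (l * x) \<le> exp (- l\<^sup>2 / 2) * (exp (l\<^sup>2 / 2) + x * sinh l)"
    by (rule mult_left_mono) simp
  then show ?thesis by (simp add: distrib_left mult_ac flip: exp_add)
qed

context prob_space
begin

text \<open>\<open>v\<close> is the 0/1 clock of the visits: a round with v = 0 contributes the
  factor 1, and a round with v = 1 at most an affine function of X. Its linear part is orthogonal to
  the product so far, which is a bounded function of the past.\<close>

lemma expectation_exp_sum_le_1:
  fixes X v :: "nat \<Rightarrow> 'a \<Rightarrow> real"
  assumes past: "\<And>k j. k \<in> {1..n} \<Longrightarrow> j \<in> {1..<k} \<Longrightarrow> X j \<in> borel_measurable (\<F> k)"
      "\<And>k j. k \<in> {1..n} \<Longrightarrow> j \<in> {1..<k} \<Longrightarrow> v j \<in> borel_measurable (\<F> k)"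
    and meas: "\<And>k. k \<in> {1..n} \<Longrightarrow> X k \<in> borel_measurable M" "\<And>k. k \<in> {1..n} \<Longrightarrow> v k \<in> borel_measurable M"
    and bound: "\<And>k \<omega>. k \<in> {1..n} \<Longrightarrow> \<omega> \<in> space M \<Longrightarrow> \<bar>X k \<omega>\<bar> \<le> v k \<omega> \<and> v k \<omega> \<in> {0, 1}"
    and orth: "\<And>k Z c. k \<in> {1..n} \<Longrightarrow> Z \<in> borel_measurable (\<F> k) \<Longrightarrow> (\<And>\<omega>. \<omega> \<in> space M \<Longrightarrow> \<bar>Z \<omega>\<bar> \<le> c) \<Longrightarrow>
      expectation (\<lambda>\<omega>. Z \<omega> * X k \<omega>) = 0"
  shows "j \<le> n \<Longrightarrow> expectation (\<lambda>\<omega>. exp (\<Sum>i\<in>{1..j}. l * X i \<omega> - l\<^sup>2 / 2 * v i \<omega>)) \<le> 1"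
proof (induction j)
  case 0
  then show ?case by (simp add: prob_space)
next
  case (Suc j)
  let ?W = "\<lambda>j \<omega>. exp (\<Sum>i\<in>{1..j}. l * X i \<omega> - l\<^sup>2 / 2 * v i \<omega>)"
  have k: "Suc j \<in> {1..n}" using Suc by auto
  have W_bound: "\<bar>?W i \<omega>\<bar> \<le> exp (real i * \<bar>l\<bar>)" if "\<omega> \<in> space M" "i \<le> n" for i \<omega>
  proof -
    have "(\<Sum>i\<in>{1..i}. l * X i \<omega> - l\<^sup>2 / 2 * v i \<omega>) \<le> (\<Sum>i\<in>{1..i}. \<bar>l\<bar>)"
    proof (rule sum_mono)
      fix i' assume "i' \<in> {1..i}"
      then have b: "\<bar>X i' \<omega>\<bar> \<le> v i' \<omega>" "v i' \<omega> \<in> {0, 1}" using bound[of i' \<omega>] that by auto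
      then have "\<bar>l * X i' \<omega>\<bar> \<le> \<bar>l\<bar> * 1" unfolding abs_mult by (intro mult_left_mono) auto
      then have "l * X i' \<omega> \<le> \<bar>l\<bar>" by linarith
      moreover have "0 \<le> l\<^sup>2 / 2 * v i' \<omega>" using b by auto
      ultimately show "l * X i' \<omega> - l\<^sup>2 / 2 * v i' \<omega> \<le> \<bar>l\<bar>" by linarith
    qed
    then show ?thesis by simp
  qed
  have W_meas: "?W i \<in> borel_measurable M" if "i \<le> n" for i
    using meas that by (intro measurable_compose[OF _ borel_measurable_exp]
        borel_measurable_sum borel_measurable_diff borel_measurable_times
        borel_measurable_const) auto
  have W_int: "integrable M (?W i)" if "i \<le> n" for i
    using W_bound[OF _ that] W_meas[OF that] by (intro integrable_const_bound[where B = "exp (real i * \<bar>l\<bar>)"]) auto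
  have X_int: "integrable M (\<lambda>\<omega>. ?W j \<omega> * X (Suc j) \<omega>)"
  proof (rule Bochner_Integration.integrable_bound[OF W_int[of j]])
    show "AE \<omega> in M. norm (?W j \<omega> * X (Suc j) \<omega>) \<le> norm (?W j \<omega>)"
      using bound[OF k] by (intro AE_I2) (fastforce simp: abs_mult intro: mult_left_le)
  qed (use W_meas[of j] meas(1)[OF k] Suc in auto)
  define c where "c = exp (- l\<^sup>2 / 2) * sinh l"
  have "expectation (?W (Suc j)) \<le> expectation (\<lambda>\<omega>. ?W j \<omega> + c * (?W j \<omega> * X (Suc j) \<omega>))"
  proof (rule integral_mono)
    fix \<omega> assume w: "\<omega> \<in> space M"
    have "exp (l * X (Suc j) \<omega> - l\<^sup>2 / 2 * v (Suc j) \<omega>) \<le> 1 + c * X (Suc j) \<omega>"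
    proof (cases "v (Suc j) \<omega> = 0")
      case True
      then show ?thesis using bound[OF k w] by simp
    next
      case False
      then have "v (Suc j) \<omega> = 1" "\<bar>X (Suc j) \<omega>\<bar> \<le> 1" using bound[OF k w] by auto
      then show ?thesis using exp_le_of_abs_le_1[of "X (Suc j) \<omega>" l] by (simp add: c_def)
    qed
    then have "?W j \<omega> * exp (l * X (Suc j) \<omega> - l\<^sup>2 / 2 * v (Suc j) \<omega>) \<le> ?W j \<omega> * (1 + c * X (Suc j) \<omega>)"
      by (rule mult_left_mono) simp
    then show "?W (Suc j) \<omega> \<le> ?W j \<omega> + c * (?W j \<omega> * X (Suc j) \<omega>)"
      by (simp add: exp_add[symmetric] algebra_simps)
  next
    show "integrable M (?W (Suc j))" using W_int[of "Suc j"] Suc by blast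
    show "integrable M (\<lambda>\<omega>. ?W j \<omega> + c * (?W j \<omega> * X (Suc j) \<omega>))"
      using W_int[of j] X_int Suc by (intro Bochner_Integration.integrable_add integrable_mult_right) auto
  qed
  also have "\<dots> = expectation (?W j) + c * expectation (\<lambda>\<omega>. ?W j \<omega> * X (Suc j) \<omega>)"
    using W_int[of j] X_int Suc by simp
  also have "expectation (\<lambda>\<omega>. ?W j \<omega> * X (Suc j) \<omega>) = 0"
    using past k W_bound[of _ j] Suc
    by (intro orth[OF k, of "?W j" "exp (real j * \<bar>l\<bar>)"])
      (auto intro!: measurable_compose[OF _ borel_measurable_exp] borel_measurable_sum borel_measurable_diff borel_measurable_times)
  finally show ?case using Suc by simp
qed

text \<open>Markov's inequality for the exponential supermartingale with l = t / m. The event fixes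
  the value m of the clock, so that l is a constant; random visit counts are dealt with later by a
  union over m.\<close>

lemma martingale_tail:
  fixes X v :: "nat \<Rightarrow> 'a \<Rightarrow> real"
  assumes past: "\<And>k j. k \<in> {1..n} \<Longrightarrow> j \<in> {1..<k} \<Longrightarrow> X j \<in> borel_measurable (\<F> k)"
      "\<And>k j. k \<in> {1..n} \<Longrightarrow> j \<in> {1..<k} \<Longrightarrow> v j \<in> borel_measurable (\<F> k)"
    and meas: "\<And>k. k \<in> {1..n} \<Longrightarrow> X k \<in> borel_measurable M" "\<And>k. k \<in> {1..n} \<Longrightarrow> v k \<in> borel_measurable M"
    and bound: "\<And>k \<omega>. k \<in> {1..n} \<Longrightarrow> \<omega> \<in> space M \<Longrightarrow> \<bar>X k \<omega>\<bar> \<le> v k \<omega> \<and> v k \<omega> \<in> {0, 1}"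
    and orth: "\<And>k Z c. k \<in> {1..n} \<Longrightarrow> Z \<in> borel_measurable (\<F> k) \<Longrightarrow> (\<And>\<omega>. \<omega> \<in> space M \<Longrightarrow> \<bar>Z \<omega>\<bar> \<le> c) \<Longrightarrow>
      expectation (\<lambda>\<omega>. Z \<omega> * X k \<omega>) = 0"
    and t: "0 \<le> t" "0 < m"
  shows "{\<omega> \<in> space M. t < (\<Sum>k\<in>{1..n}. X k \<omega>) \<and> (\<Sum>k\<in>{1..n}. v k \<omega>) = m} \<in> sets M"
    and "prob {\<omega> \<in> space M. t < (\<Sum>k\<in>{1..n}. X k \<omega>) \<and> (\<Sum>k\<in>{1..n}. v k \<omega>) = m} \<le> exp (- t\<^sup>2 / (2 * m))"
proof -
  define l where "l = t / m"
  let ?E = "{\<omega> \<in> space M. t < (\<Sum>k\<in>{1..n}. X k \<omega>) \<and> (\<Sum>k\<in>{1..n}. v k \<omega>) = m}"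
  let ?W = "\<lambda>\<omega>. exp (\<Sum>i\<in>{1..n}. l * X i \<omega> - l\<^sup>2 / 2 * v i \<omega>)"
  have [measurable]: "(\<lambda>\<omega>. \<Sum>k\<in>{1..n}. X k \<omega>) \<in> borel_measurable M" "(\<lambda>\<omega>. \<Sum>k\<in>{1..n}. v k \<omega>) \<in> borel_measurable M"
    using meas by (auto intro!: borel_measurable_sum)
  show E: "?E \<in> sets M" by measurable
  have W: "?W \<omega> = exp (l * (\<Sum>k\<in>{1..n}. X k \<omega>) - l\<^sup>2 / 2 * (\<Sum>k\<in>{1..n}. v k \<omega>))" for \<omega>
    by (simp add: sum_subtractf sum_distrib_left)
  have W_int: "integrable M ?W"
  proof (rule integrable_const_bound[where B = "exp (\<bar>l\<bar> * real n)"])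
    show "AE \<omega> in M. norm (?W \<omega>) \<le> exp (\<bar>l\<bar> * real n)"
    proof (rule AE_I2)
      fix \<omega> assume w: "\<omega> \<in> space M"
      have "\<bar>\<Sum>k\<in>{1..n}. X k \<omega>\<bar> \<le> (\<Sum>k\<in>{1..n}. 1)"
        using bound[OF _ w] by (intro order_trans[OF sum_abs] sum_mono) fastforce
      then have "\<bar>l * (\<Sum>k\<in>{1..n}. X k \<omega>)\<bar> \<le> \<bar>l\<bar> * real n"
        unfolding abs_mult by (intro mult_left_mono) auto
      moreover have "0 \<le> l\<^sup>2 / 2 * (\<Sum>k\<in>{1..n}. v k \<omega>)"
        using bound[OF _ w] by (intro mult_nonneg_nonneg sum_nonneg) fastforce+
      ultimately show "norm (?W \<omega>) \<le> exp (\<bar>l\<bar> * real n)" unfolding W by simp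
    qed
  qed (unfold W, measurable)
  have EW: "exp (t\<^sup>2 / (2 * m)) \<le> ?W \<omega>" if "\<omega> \<in> ?E" for \<omega>
  proof -
    have "t\<^sup>2 / (2 * m) = l * t - l\<^sup>2 / 2 * m"
      using t by (simp add: l_def power2_eq_square field_simps)
    also have "\<dots> \<le> l * (\<Sum>k\<in>{1..n}. X k \<omega>) - l\<^sup>2 / 2 * (\<Sum>k\<in>{1..n}. v k \<omega>)"
      using that t by (simp add: l_def divide_right_mono mult_left_mono)
    finally show ?thesis unfolding W by simp
  qed
  have "exp (t\<^sup>2 / (2 * m)) * prob ?E = expectation (\<lambda>\<omega>. exp (t\<^sup>2 / (2 * m)) * indicator ?E \<omega>)"
    using E by simp
  also have "\<dots> \<le> expectation ?W"
    using EW E W_int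
    by (intro integral_mono integrable_mult_right integrable_real_indicator)
      (auto split: split_indicator simp: less_top[symmetric])
  also have "\<dots> \<le> 1"
    by (rule expectation_exp_sum_le_1[OF past meas bound orth order_refl])
  finally have "prob ?E \<le> 1 / exp (t\<^sup>2 / (2 * m))"
    by (simp add: pos_le_divide_eq mult.commute)
  then show "prob ?E \<le> exp (- t\<^sup>2 / (2 * m))" by (simp add: exp_minus field_simps)
qed

end

section \<open>Measurability\<close>

lemma subalgebra_trans: "subalgebra M N \<Longrightarrow> subalgebra N L \<Longrightarrow> subalgebra M L"
  by (auto simp: subalgebra_def)

lemma subalgebra_refl: "subalgebra M M"
  by (auto simp: subalgebra_def)

section \<open>Measurability of the empirical quantities\<close>

context fictitious_play
begin

abbreviation visit :: "nat \<Rightarrow> nat \<Rightarrow> 's \<Rightarrow> 'a \<Rightarrow> 'b \<Rightarrow> 'w \<Rightarrow> real" where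
  "visit k h s a b \<omega> \<equiv> of_bool (st k h \<omega> = s \<and> ac k h \<omega> = a \<and> bc k h \<omega> = b)"

abbreviation visit_sa :: "nat \<Rightarrow> nat \<Rightarrow> 's \<Rightarrow> 'a \<Rightarrow> 'w \<Rightarrow> real" where
  "visit_sa k h s a \<omega> \<equiv> of_bool (st k h \<omega> = s \<and> ac k h \<omega> = a)"

text \<open>The conditional probability of \<open>visit\<close> given the information at the start
  of episode k, as \<open>visit_prob\<close> shows in weak form.\<close>

abbreviation rate :: "nat \<Rightarrow> nat \<Rightarrow> 's \<Rightarrow> 'a \<Rightarrow> 'b \<Rightarrow> 'w \<Rightarrow> real" where
  "rate k h s a b \<omega> \<equiv> reach (pol1 \<omega> k) P h s * (pol1 \<omega> k h s a * pol2 \<omega> k h s b)"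

text \<open>Rewards only appear multiplied by the indicator of the visit, since their values at unvisited triples
  are never revealed.\<close>

definition observed :: "'w measure \<Rightarrow> nat \<Rightarrow> bool" where
  "observed N n \<longleftrightarrow> (\<forall>\<tau>\<in>{1..n}. \<forall>h\<in>{1..H}. \<forall>s\<in>S. \<forall>a\<in>A.
     visit_sa \<tau> h s a \<in> borel_measurable N \<and>
     (\<forall>s'\<in>S. (\<lambda>\<omega>. of_bool (st \<tau> h \<omega> = s \<and> ac \<tau> h \<omega> = a \<and> st \<tau> (Suc h) \<omega> = s') :: real) \<in> borel_measurable N) \<and>
     (\<forall>b\<in>B. visit \<tau> h s a b \<in> borel_measurable N \<and>
       (\<lambda>\<omega>. visit \<tau> h s a b \<omega> * rw \<tau> h s a b \<omega>) \<in> borel_measurable N))"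

lemma observed_mono: "observed N n \<Longrightarrow> m \<le> n \<Longrightarrow> observed N m"
  unfolding observed_def by (meson atLeastAtMost_iff le_trans)

lemma real_count_sab:
  "real (count_sab \<omega> k h s a b) = (\<Sum>\<tau>\<in>{1..k}. visit \<tau> h s a b \<omega>)"
  by (simp add: count_sab_def Int_def)

lemma real_count_sa:
  "real (count_sa \<omega> k h s a) = (\<Sum>\<tau>\<in>{1..k}. visit_sa \<tau> h s a \<omega>)"
  by (simp add: count_sa_def Int_def)

context
  fixes N :: "'w measure" and k :: nat
  assumes obs: "observed N k"
begin

lemma count_meas:
  assumes "h \<in> {1..H}" "s \<in> S" "a \<in> A"
  shows "(\<lambda>\<omega>. real (count_sa \<omega> k h s a)) \<in> borel_measurable N"
    and "b \<in> B \<Longrightarrow> (\<lambda>\<omega>. real (count_sab \<omega> k h s a b)) \<in> borel_measurable N"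
  unfolding real_count_sa real_count_sab
  by (intro borel_measurable_sum; use obs assms in \<open>auto simp: observed_def\<close>)+

lemma bonus_meas:
  assumes "h \<in> {1..H}" "s \<in> S" "a \<in> A"
  shows "(\<lambda>\<omega>. bonus_P \<omega> k h s a) \<in> borel_measurable N"
    and "b \<in> B \<Longrightarrow> (\<lambda>\<omega>. bonus_r \<omega> k h s a b) \<in> borel_measurable N"
    and "b \<in> B \<Longrightarrow> (\<lambda>\<omega>. bonus \<omega> k h s a b) \<in> borel_measurable N"
proof -
  note [measurable] = count_meas[OF assms]
  show P: "(\<lambda>\<omega>. bonus_P \<omega> k h s a) \<in> borel_measurable N"
    unfolding bonus_P_def of_nat_max by (cases "k = 0") (simp, simp, measurable)
  show r: "(\<lambda>\<omega>. bonus_r \<omega> k h s a b) \<in> borel_measurable N" if [measurable]: "b \<in> B"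
    unfolding bonus_r_def of_nat_max by (cases "k = 0") (simp, simp, measurable)
  show "(\<lambda>\<omega>. bonus \<omega> k h s a b) \<in> borel_measurable N" if [measurable]: "b \<in> B"
    unfolding bonus_def by (intro borel_measurable_add r[OF that] P)
qed

lemma r_hat_meas:
  assumes "h \<in> {1..H}" "s \<in> S" "a \<in> A" "b \<in> B"
  shows "(\<lambda>\<omega>. r_hat \<omega> k h s a b) \<in> borel_measurable N"
proof -
  have [measurable]: "(\<lambda>\<omega>. \<Sum>\<tau>\<in>{1..k}. visit \<tau> h s a b \<omega> * rw \<tau> h s a b \<omega>) \<in> borel_measurable N"
    by (intro borel_measurable_sum) (use obs assms in \<open>auto simp: observed_def\<close>)
  note [measurable] = count_meas(2)[OF assms]
  show ?thesis unfolding r_hat_def of_nat_max by (cases "k = 0") (simp, simp only: if_False, measurable)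
qed

lemma P_hat_meas:
  assumes "h \<in> {1..H}" "s \<in> S" "a \<in> A" "s' \<in> S"
  shows "(\<lambda>\<omega>. P_hat \<omega> k h s a s') \<in> borel_measurable N"
proof -
  have [measurable]: "(\<lambda>\<omega>. \<Sum>\<tau>\<in>{1..k}. of_bool (st \<tau> h \<omega> = s \<and> ac \<tau> h \<omega> = a \<and> st \<tau> (Suc h) \<omega> = s') :: real) \<in> borel_measurable N"
    by (intro borel_measurable_sum) (use obs assms in \<open>auto simp: observed_def\<close>)
  note [measurable] = count_meas(1)[OF assms(1-3)]
  show ?thesis unfolding P_hat_def of_nat_max by (cases "k = 0") (simp, simp only: if_False, measurable)
qed

lemma r_tilde_meas:
  assumes "h \<in> {1..H}" "s \<in> S" "a \<in> A" "b \<in> B"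
  shows "(\<lambda>\<omega>. r_tilde \<omega> k h s a b) \<in> borel_measurable N"
  unfolding r_tilde_def using r_hat_meas[OF assms] bonus_meas(2)[OF assms]
  by (intro borel_measurable_max borel_measurable_diff) auto

end

section \<open>Measurability of policies, values and the gap\<close>

definition policy_meas :: "'w measure \<Rightarrow> 'x set \<Rightarrow> ('w \<Rightarrow> ('s, 'x) policy) \<Rightarrow> bool" where
  "policy_meas N X \<pi> \<longleftrightarrow> (\<forall>h\<in>{1..H}. \<forall>s\<in>S. \<forall>x\<in>X. (\<lambda>\<omega>. \<pi> \<omega> h s x) \<in> borel_measurable N)"

lemma policy_measD:
  "policy_meas N X \<pi> \<Longrightarrow> h \<in> {1..H} \<Longrightarrow> s \<in> S \<Longrightarrow> x \<in> X \<Longrightarrow> (\<lambda>\<omega>. \<pi> \<omega> h s x) \<in> borel_measurable N"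
  by (auto simp: policy_meas_def)

lemma reach_meas:
  assumes "policy_meas N A \<mu>"
    and "\<And>h s a s'. h \<in> {1..H} \<Longrightarrow> s \<in> S \<Longrightarrow> a \<in> A \<Longrightarrow> s' \<in> S \<Longrightarrow> (\<lambda>\<omega>. p \<omega> h s a s') \<in> borel_measurable N"
  shows "h \<in> {1..Suc H} \<Longrightarrow> s \<in> S \<Longrightarrow> (\<lambda>\<omega>. reach (\<mu> \<omega>) (p \<omega>) h s) \<in> borel_measurable N"
proof (induction h arbitrary: s)
  case (Suc h)
  show ?case
  proof (cases "h = 0")
    case False
    then have "1 \<le> h" "h \<in> {1..H}" using Suc(2) by auto
    then show ?thesis unfolding reach_Suc[OF \<open>1 \<le> h\<close>]
      using Suc assms(2)[of h] policy_measD[OF assms(1)]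
      by (intro borel_measurable_sum borel_measurable_times) auto
  qed simp
qed simp

lemma Q_step_meas:
  assumes "observed N k" "h \<in> {1..H}" "s \<in> S" "a \<in> A" "b \<in> B"
    and "\<And>s'. s' \<in> S \<Longrightarrow> (\<lambda>\<omega>. W \<omega> s') \<in> borel_measurable N"
  shows "(\<lambda>\<omega>. Q_step \<omega> k (W \<omega>) h s a b) \<in> borel_measurable N"
  unfolding Q_step_def
  using r_hat_meas[OF assms(1-5)] bonus_meas(3)[OF assms(1-5)] P_hat_meas[OF assms(1-4)] assms(6)
  by (intro borel_measurable_max borel_measurable_min borel_measurable_add borel_measurable_sum borel_measurable_times) auto

lemma V_bar_meas:
  assumes "observed N k" "policy_meas N A \<mu>" "policy_meas N B \<nu>"
  shows "h \<in> {1..Suc H} \<Longrightarrow> s \<in> S \<Longrightarrow> (\<lambda>\<omega>. V_bar \<omega> k (\<mu> \<omega>) (\<nu> \<omega>) h s) \<in> borel_measurable N"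
proof (induction "Suc H - h" arbitrary: h s)
  case 0
  then have "(\<lambda>\<omega>. V_bar \<omega> k (\<mu> \<omega>) (\<nu> \<omega>) h s) = (\<lambda>\<omega>. 0)"
    by (subst V_bar.simps) auto
  then show ?case by simp
next
  case (Suc j)
  then have h: "h \<in> {1..H}" by auto
  have W: "(\<lambda>\<omega>. V_bar \<omega> k (\<mu> \<omega>) (\<nu> \<omega>) (Suc h) s') \<in> borel_measurable N" if "s' \<in> S" for s'
    using Suc(1)[of "Suc h" s'] Suc(2) h that by auto
  have "(\<lambda>\<omega>. V_bar \<omega> k (\<mu> \<omega>) (\<nu> \<omega>) h s) = (\<lambda>\<omega>. \<Sum>a\<in>A. \<Sum>b\<in>B. \<mu> \<omega> h s a * Q_step \<omega> k (V_bar \<omega> k (\<mu> \<omega>) (\<nu> \<omega>) (Suc h)) h s a b * \<nu> \<omega> h s b)"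
    using h by (subst V_bar.simps) auto
  then show ?case
    using Q_step_meas[OF assms(1) h Suc(4) _ _ W] policy_measD[OF assms(2) h Suc(4)] policy_measD[OF assms(3) h Suc(4)]
    by (auto intro!: borel_measurable_sum borel_measurable_times)
qed

text \<open>The policy of episode k is a function of the data of the first k - 1 episodes, hence the
  bound \<open>Suc n\<close>.\<close>

lemma pol_meas:
  "observed N n \<Longrightarrow> k \<le> Suc n \<Longrightarrow> policy_meas N A (\<lambda>\<omega>. pol1 \<omega> k) \<and> policy_meas N B (\<lambda>\<omega>. pol2 \<omega> k)"
proof (induction k)
  case 0
  then show ?case by (simp add: policy_meas_def pol_0)
next
  case (Suc k)
  have obs: "observed N k" using observed_mono[OF Suc(2)] Suc(3) by auto
  have IH: "policy_meas N A (\<lambda>\<omega>. pol1 \<omega> k)" "policy_meas N B (\<lambda>\<omega>. pol2 \<omega> k)" using Suc by auto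
  note m1 = policy_measD[OF IH(1)] and m2 = policy_measD[OF IH(2)]
  have "(\<lambda>\<omega>. pol1 \<omega> (Suc k) h s a) \<in> borel_measurable N" if x: "h \<in> {1..H}" "s \<in> S" "a \<in> A" for h s a
  proof -
    have "(\<lambda>\<omega>. Q_bar \<omega> k (pol1 \<omega> k) (pol2 \<omega> k) h s a b) \<in> borel_measurable N" if "a \<in> A" "b \<in> B" for a b
      unfolding Q_bar_def using V_bar_meas[OF obs IH, of "Suc h"] x that
      by (intro Q_step_meas[OF obs]) auto
    then have "(\<lambda>\<omega>. pol1 \<omega> k h s a * exp (\<eta> * (\<Sum>b\<in>B. Q_bar \<omega> k (pol1 \<omega> k) (pol2 \<omega> k) h s a b * pol2 \<omega> k h s b))) \<in> borel_measurable N"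
      if "a \<in> A" for a
      using m1[OF x(1,2)] m2[OF x(1,2)] that
      by (intro borel_measurable_times measurable_compose[OF _ borel_measurable_exp] borel_measurable_sum) auto
    then show ?thesis unfolding pol_Suc update1_def normalized_def using x
      by (intro borel_measurable_divide borel_measurable_sum) auto
  qed
  moreover have "(\<lambda>\<omega>. pol2 \<omega> (Suc k) h s b) \<in> borel_measurable N" if x: "h \<in> {1..H}" "s \<in> S" "b \<in> B" for h s b
  proof -
    have "(\<lambda>\<omega>. reach (pol1 \<omega> k) (P_hat \<omega> k) h s) \<in> borel_measurable N"
      using x by (intro reach_meas[OF IH(1)] P_hat_meas[OF obs]) auto
    then have "(\<lambda>\<omega>. pol2 \<omega> k h s b * exp (- \<gamma> * reach (pol1 \<omega> k) (P_hat \<omega> k) h s *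
        (\<Sum>a\<in>A. r_tilde \<omega> k h s a b * pol1 \<omega> k h s a))) \<in> borel_measurable N"
      if "b \<in> B" for b
      using m1[OF x(1,2)] m2[OF x(1,2)] r_tilde_meas[OF obs x(1,2)] that
      by (intro borel_measurable_times measurable_compose[OF _ borel_measurable_exp] borel_measurable_sum) auto
    then show ?thesis unfolding pol_Suc update2_def normalized_def using x
      by (intro borel_measurable_divide borel_measurable_sum) auto
  qed
  ultimately show ?case by (auto simp: policy_meas_def)
qed

lemma best_value_meas:
  assumes "\<And>k. k \<in> {1..n} \<Longrightarrow> policy_meas N B (\<lambda>\<omega>. \<nu> \<omega> k)"
  shows "j \<le> H \<Longrightarrow> s \<in> S \<Longrightarrow> (\<lambda>\<omega>. best_value (\<nu> \<omega>) n j s) \<in> borel_measurable N"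
proof (induction j arbitrary: s)
  case (Suc j)
  then have h: "H - j \<in> {1..H}" by auto
  show ?case unfolding best_value.simps
    using Suc policy_measD[OF assms h Suc(3)] finite_spaces nonempty_spaces
    by (intro borel_measurable_Max borel_measurable_add borel_measurable_sum borel_measurable_times) auto
qed simp

text \<open>The values of the policies played cancel between the two regrets. Only the two optimal
  values remain, not the chosen optimisers, whose dependence on \<omega> is uncontrolled.\<close>

lemma Gap_meas:
  assumes "observed N K"
  shows "Gap \<in> borel_measurable N"
proof -
  have m: "policy_meas N A (\<lambda>\<omega>. pol1 \<omega> k)" "policy_meas N B (\<lambda>\<omega>. pol2 \<omega> k)" if "k \<in> {1..K}" for k
    using pol_meas[OF assms, of k] that by auto
  have "(\<lambda>\<omega>. cum_loss \<omega> h s b) \<in> borel_measurable N" if "h \<in> {1..H}" "s \<in> S" "b \<in> B" for h s b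
    unfolding cum_loss_def using that policy_measD[OF m(1)] reach_meas[OF m(1), of _ "\<lambda>_. P"]
    by (intro borel_measurable_sum borel_measurable_times) auto
  then have "(\<lambda>\<omega>. \<Sum>h\<in>{1..H}. \<Sum>s\<in>S. Min (cum_loss \<omega> h s ` B)) \<in> borel_measurable N"
    using finite_spaces nonempty_spaces by (intro borel_measurable_sum borel_measurable_Min) auto
  moreover have "(\<lambda>\<omega>. best_value (pol2 \<omega>) K H s1) \<in> borel_measurable N"
    using m initial_state by (intro best_value_meas) auto
  moreover have "Gap \<omega> = best_value (pol2 \<omega>) K H s1 - (\<Sum>h\<in>{1..H}. \<Sum>s\<in>S. Min (cum_loss \<omega> h s ` B))" for \<omega>
    unfolding Gap_def Regret1_def Regret2_def sum_subtractf best1_optimal best2_optimal by simp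
  ultimately show ?thesis unfolding Gap_def[abs_def] by (simp add: Gap_def[symmetric])
qed

end

section \<open>Conditional expectations along the run\<close>

lemma of_bool_eq_meas:
  assumes "f \<in> N \<rightarrow>\<^sub>M count_space X"
  shows "(\<lambda>\<omega>. of_bool (f \<omega> = x) :: real) \<in> borel_measurable N"
  by (rule measurable_compose[OF assms]) simp

lemma abs_mult_le_left: "\<bar>x\<bar> \<le> c \<Longrightarrow> \<bar>y\<bar> \<le> 1 \<Longrightarrow> \<bar>x * y\<bar> \<le> c" for x y c :: real
  using mult_mono[of "\<bar>x\<bar>" c "\<bar>y\<bar>" 1] by (simp add: abs_mult)

context prob_space
begin

lemma integrable_bounded:
  fixes f :: "'a \<Rightarrow> real"
  assumes "f \<in> borel_measurable M" "\<And>\<omega>. \<omega> \<in> space M \<Longrightarrow> \<bar>f \<omega>\<bar> \<le> c"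
  shows "integrable M f"
  using assms by (intro integrable_const_bound[where B = c]) auto

lemma integrable_mult_bounded:
  fixes f g :: "'a \<Rightarrow> real"
  assumes "f \<in> borel_measurable M" "\<And>\<omega>. \<omega> \<in> space M \<Longrightarrow> \<bar>f \<omega>\<bar> \<le> c"
    and "g \<in> borel_measurable M" "\<And>\<omega>. \<omega> \<in> space M \<Longrightarrow> \<bar>g \<omega>\<bar> \<le> 1"
  shows "integrable M (\<lambda>\<omega>. f \<omega> * g \<omega>)"
  using assms by (intro integrable_bounded[where c = c] borel_measurable_times abs_mult_le_left) auto

text \<open>The weight \<open>v\<close> will be the indicator of a visit. The conditional
  expectation has to agree with \<open>e\<close> only where v is nonzero, so formulas at the random
  current state and action can be replaced by those at fixed ones.\<close>

lemma expectation_mult_cond_exp: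
  fixes Z v g e :: "'a \<Rightarrow> real"
  assumes sub: "subalgebra M \<G>"
    and Z: "Z \<in> borel_measurable \<G>" "\<And>\<omega>. \<omega> \<in> space M \<Longrightarrow> \<bar>Z \<omega>\<bar> \<le> c"
    and v: "v \<in> borel_measurable \<G>" "\<And>\<omega>. \<bar>v \<omega>\<bar> \<le> 1"
    and g: "g \<in> borel_measurable M" "\<And>\<omega>. \<omega> \<in> space M \<Longrightarrow> \<bar>g \<omega>\<bar> \<le> 1"
    and e: "e \<in> borel_measurable M" "AE \<omega> in M. v \<omega> * real_cond_exp M \<G> g \<omega> = v \<omega> * e \<omega>"
  shows "expectation (\<lambda>\<omega>. Z \<omega> * v \<omega> * g \<omega>) = expectation (\<lambda>\<omega>. Z \<omega> * v \<omega> * e \<omega>)"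
proof -
  interpret finite_measure_subalgebra M \<G>
    using sub by unfold_locales
  have f: "(\<lambda>\<omega>. Z \<omega> * v \<omega>) \<in> borel_measurable \<G>" by (rule borel_measurable_times[OF Z(1) v(1)])
  have fM: "(\<lambda>\<omega>. Z \<omega> * v \<omega>) \<in> borel_measurable M" by (rule measurable_from_subalg[OF sub f])
  have "integrable M (\<lambda>\<omega>. Z \<omega> * v \<omega> * g \<omega>)"
    by (rule integrable_mult_bounded[OF fM abs_mult_le_left[OF Z(2) v(2)] g])
  then have "expectation (\<lambda>\<omega>. Z \<omega> * v \<omega> * g \<omega>) = expectation (\<lambda>\<omega>. Z \<omega> * v \<omega> * real_cond_exp M \<G> g \<omega>)"
    using real_cond_exp_intg(2)[OF _ f g(1)] by simp
  also have "\<dots> = expectation (\<lambda>\<omega>. Z \<omega> * v \<omega> * e \<omega>)"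
  proof (rule integral_cong_AE)
    show "AE \<omega> in M. Z \<omega> * v \<omega> * real_cond_exp M \<G> g \<omega> = Z \<omega> * v \<omega> * e \<omega>"
      using e(2) by eventually_elim (simp add: mult.assoc)
  qed (use e fM in auto)
  finally show ?thesis .
qed

end

section \<open>The filtration of the run and the information in it\<close>

context fictitious_play_run
begin

lemma F_mono:
  assumes "k \<in> {1..K}" "1 \<le> h"
  shows "h \<le> h' \<Longrightarrow> h' \<le> Suc H \<Longrightarrow> subalgebra (F k h') (F k h)"
proof (induction h' rule: dec_induct)
  case (step m)
  then have "m \<in> {1..H}" using assms by auto
  moreover have "subalgebra (F k m) (F k h)" using step by simp
  ultimately show ?case
    using subalgebra_trans[OF subalgebra_trans[OF G_F[OF assms(1), of m] F_G[OF assms(1), of m]]] by blast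
qed (rule subalgebra_refl)

lemma F_past:
  assumes "1 \<le> j"
  shows "j < k \<Longrightarrow> k \<le> K \<Longrightarrow> subalgebra (F k 1) (F j (Suc H))"
proof (induction k)
  case (Suc k)
  have nxt: "subalgebra (F (Suc k) 1) (F k (Suc H))" using Suc assms by (intro F_next) auto
  show ?case
  proof (cases "j = k")
    case False
    then have "subalgebra (F k 1) (F j (Suc H))" "subalgebra (F k (Suc H)) (F k 1)"
      using Suc assms F_mono[of k 1 "Suc H"] by auto
    then show ?thesis using subalgebra_trans[OF subalgebra_trans[OF nxt]] by blast
  qed (use nxt in simp)
qed simp

lemma G_past:
  assumes "1 \<le> j" "j < k" "k \<le> K" "h \<in> {1..H}"
  shows "subalgebra (G k h) (F j (Suc H))"
proof -
  have "subalgebra (G k h) (F k h)" "subalgebra (F k h) (F k 1)"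
    using F_mono[of k 1 h] F_G[of k h] assms by auto
  then show ?thesis using subalgebra_trans[OF subalgebra_trans[OF _ _] F_past[OF assms(1-3)]] by blast
qed

lemma step_meas:
  assumes "k \<in> {1..K}" "h \<in> {1..H}" "subalgebra N (G k h)"
  shows "(\<lambda>\<omega>. of_bool (st k h \<omega> = s) :: real) \<in> borel_measurable N"
    "visit_sa k h s a \<in> borel_measurable N"
    "visit k h s a b \<in> borel_measurable N"
proof -
  have "st k h \<in> F k h \<rightarrow>\<^sub>M count_space S" using assms by (intro st_meas) auto
  then have s: "st k h \<in> N \<rightarrow>\<^sub>M count_space S"
    by (rule measurable_from_subalg[OF subalgebra_trans[OF assms(3) F_G[OF assms(1,2)]]])
  note ab = measurable_from_subalg[OF assms(3) ac_meas[OF assms(1,2)]] measurable_from_subalg[OF assms(3) bc_meas[OF assms(1,2)]]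
  show "(\<lambda>\<omega>. of_bool (st k h \<omega> = s) :: real) \<in> borel_measurable N"
    "visit_sa k h s a \<in> borel_measurable N"
    "visit k h s a b \<in> borel_measurable N"
    unfolding of_bool_conj
    by (intro borel_measurable_times of_bool_eq_meas[OF s] of_bool_eq_meas[OF ab(1)] of_bool_eq_meas[OF ab(2)])+
qed

lemma next_meas:
  assumes "k \<in> {1..K}" "h \<in> {1..H}" "subalgebra N (F k (Suc h))"
  shows "(\<lambda>\<omega>. of_bool (st k (Suc h) \<omega> = s) :: real) \<in> borel_measurable N"
proof -
  have "st k (Suc h) \<in> F k (Suc h) \<rightarrow>\<^sub>M count_space S" using assms by (intro st_meas) auto
  from of_bool_eq_meas[OF measurable_from_subalg[OF assms(3) this]] show ?thesis .
qed

lemma F_end_G: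
  assumes "k \<in> {1..K}" "h \<in> {1..H}"
  shows "subalgebra (F k (Suc H)) (G k h)"
  by (rule subalgebra_trans[OF F_mono[of k "Suc h" "Suc H"] G_F[OF assms]]) (use assms in auto)

text \<open>On a visit to (s, a, b) the reward there is the realised bandit reward, and otherwise
  both products are 0; only realised rewards are assumed to be observed.\<close>

lemma reward_meas:
  assumes "k \<in> {1..K}" "h \<in> {1..H}" "subalgebra N (F k (Suc H))"
  shows "(\<lambda>\<omega>. visit k h s a b \<omega> * rw k h s a b \<omega>) \<in> borel_measurable N"
proof -
  have "(\<lambda>\<omega>. visit k h s a b \<omega> *
      rw k h (st k h \<omega>) (ac k h \<omega>) (bc k h \<omega>) \<omega>) \<in> borel_measurable N"
    by (intro borel_measurable_times step_meas(3)[OF assms(1,2)] subalgebra_trans[OF assms(3)] F_end_G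
      measurable_from_subalg[OF assms(3) rw_observed[OF assms(1,2)]] assms(1,2))
  moreover have "(\<lambda>\<omega>. visit k h s a b \<omega> * rw k h (st k h \<omega>) (ac k h \<omega>) (bc k h \<omega>) \<omega>) =
      (\<lambda>\<omega>. visit k h s a b \<omega> * rw k h s a b \<omega>)"
    by (auto simp: fun_eq_iff)
  ultimately show ?thesis by simp
qed

lemma observedI:
  assumes "n \<le> K" "\<And>k. k \<in> {1..n} \<Longrightarrow> subalgebra N (F k (Suc H))"
  shows "observed N n"
proof -
  have "k \<in> {1..K}" if "k \<in> {1..n}" for k using that assms by auto
  moreover have "(\<lambda>\<omega>. of_bool (st k h \<omega> = s \<and> ac k h \<omega> = a \<and> st k (Suc h) \<omega> = s') :: real) \<in> borel_measurable N"
    if "k \<in> {1..n}" "h \<in> {1..H}" for k h s a s'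
  proof -
    have "(\<lambda>\<omega>. visit_sa k h s a \<omega> * of_bool (st k (Suc h) \<omega> = s') :: real) \<in> borel_measurable N"
    proof (intro borel_measurable_times step_meas(2) next_meas)
      have k: "k \<in> {1..K}" using that(1) assms(1) by auto
      then show "subalgebra N (G k h)" using subalgebra_trans[OF assms(2) F_end_G] that by blast
      show "subalgebra N (F k (Suc h))"
        using subalgebra_trans[OF assms(2) F_mono[of k "Suc h" "Suc H"]] that k by auto
    qed (use that assms in auto)
    then show ?thesis by (simp add: of_bool_conj mult.assoc)
  qed
  moreover have "subalgebra N (G k h)" if "k \<in> {1..n}" "h \<in> {1..H}" for k h
    using subalgebra_trans[OF assms(2) F_end_G] that assms(1) by auto
  ultimately show ?thesis unfolding observed_def
    using assms(2) by (intro ballI conjI step_meas reward_meas) blast+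
qed

lemma observed_F: "k \<in> {1..K} \<Longrightarrow> observed (F k 1) (k - 1)"
  by (intro observedI F_past) auto

lemma observed_M: "observed M K"
  by (intro observedI F_sub) auto

lemma st_in_S: "k \<in> {1..K} \<Longrightarrow> h \<in> {1..Suc H} \<Longrightarrow> \<omega> \<in> space M \<Longrightarrow> st k h \<omega> \<in> S"
  using measurable_space[OF st_meas[of k h], of \<omega>] F_sub[of k h] by (auto simp: subalgebra_def)

lemma act_in: "k \<in> {1..K} \<Longrightarrow> h \<in> {1..H} \<Longrightarrow> \<omega> \<in> space M \<Longrightarrow> ac k h \<omega> \<in> A \<and> bc k h \<omega> \<in> B"
  using measurable_space[OF ac_meas[of k h], of \<omega>] measurable_space[OF bc_meas[of k h], of \<omega>] G_sub[of k h]
  by (auto simp: subalgebra_def)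

lemma pol_range:
  "a \<in> A \<Longrightarrow> pol1 \<omega> k h s a \<in> {0..1}" "b \<in> B \<Longrightarrow> pol2 \<omega> k h s b \<in> {0..1}"
proof -
  have *: "p x \<in> {0..1}" if "x \<in> X" "finite X" "p \<in> prob_simplex X" for p :: "'x \<Rightarrow> real" and x X
    using that member_le_sum[of x X p] by (simp add: prob_simplex_def)
  show "a \<in> A \<Longrightarrow> pol1 \<omega> k h s a \<in> {0..1}" "b \<in> B \<Longrightarrow> pol2 \<omega> k h s b \<in> {0..1}"
    using *[OF _ finite_spaces(2) conjunct2[OF pol_simplex(1)]] *[OF _ finite_spaces(3) conjunct2[OF pol_simplex(2)]]
    by blast+
qed

section \<open>Orthogonality relations for rewards, transitions and actions\<close>

lemma reward_orth:
  assumes k: "k \<in> {1..K}" and x: "h \<in> {1..H}" "s \<in> S" "a \<in> A" "b \<in> B"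
    and Z: "Z \<in> borel_measurable (G k h)" "\<And>\<omega>. \<omega> \<in> space M \<Longrightarrow> \<bar>Z \<omega>\<bar> \<le> c"
  shows "expectation (\<lambda>\<omega>. Z \<omega> * (visit k h s a b \<omega> * (rw k h s a b \<omega> - r h s a b))) = 0"
proof -
  let ?f = "\<lambda>\<omega>. Z \<omega> * visit k h s a b \<omega>"
  have vG: "visit k h s a b \<in> borel_measurable (G k h)" by (rule step_meas(3)[OF k x(1) subalgebra_refl])
  have fM: "?f \<in> borel_measurable M"
    by (rule measurable_from_subalg[OF G_sub[OF k x(1)] borel_measurable_times[OF Z(1) vG]])
  have fb: "\<bar>?f \<omega>\<bar> \<le> c" if "\<omega> \<in> space M" for \<omega> by (rule abs_mult_le_left[OF Z(2)[OF that]]) simp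
  have rb: "\<bar>rw k h s a b \<omega>\<bar> \<le> 1" if "\<omega> \<in> space M" for \<omega>
    using rw_range[OF k x that] by auto
  have eq: "expectation (\<lambda>\<omega>. ?f \<omega> * rw k h s a b \<omega>) = expectation (\<lambda>\<omega>. ?f \<omega> * r h s a b)"
  proof (rule expectation_mult_cond_exp[OF G_sub[OF k x(1)] Z vG _ rw_meas[OF k x] rb])
    show "AE \<omega> in M. visit k h s a b \<omega> * real_cond_exp M (G k h) (rw k h s a b) \<omega> = visit k h s a b \<omega> * r h s a b"
      using reward_mean[OF k x] by eventually_elim simp
  qed auto
  have int: "integrable M (\<lambda>\<omega>. ?f \<omega> * rw k h s a b \<omega>)" "integrable M (\<lambda>\<omega>. ?f \<omega> * r h s a b)"
    by (rule integrable_mult_bounded[OF fM fb rw_meas[OF k x] rb] integrable_mult_left[OF integrable_bounded[OF fM fb]]; assumption)+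
  have "expectation (\<lambda>\<omega>. Z \<omega> * (visit k h s a b \<omega> * (rw k h s a b \<omega> - r h s a b))) =
      expectation (\<lambda>\<omega>. ?f \<omega> * rw k h s a b \<omega> - ?f \<omega> * r h s a b)"
    by (intro Bochner_Integration.integral_cong refl) (simp only: right_diff_distrib mult.assoc)
  also have "\<dots> = 0"
    unfolding Bochner_Integration.integral_diff[OF int] eq by simp
  finally show ?thesis .
qed

lemma transition_orth:
  assumes k: "k \<in> {1..K}" and x: "h \<in> {1..H}" "s \<in> S" "a \<in> A" and s': "s' \<in> S"
    and Z: "Z \<in> borel_measurable (G k h)" "\<And>\<omega>. \<omega> \<in> space M \<Longrightarrow> \<bar>Z \<omega>\<bar> \<le> c"
  shows "expectation (\<lambda>\<omega>. Z \<omega> * visit_sa k h s a \<omega> * of_bool (st k (Suc h) \<omega> = s')) =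
    expectation (\<lambda>\<omega>. Z \<omega> * visit_sa k h s a \<omega> * P h s a s')"
proof (rule expectation_mult_cond_exp[OF G_sub[OF k x(1)] Z step_meas(2)[OF k x(1) subalgebra_refl]])
  have "subalgebra M (F k (Suc h))" using k x by (intro F_sub) auto
  then show "(\<lambda>\<omega>. of_bool (st k (Suc h) \<omega> = s') :: real) \<in> borel_measurable M" by (rule next_meas[OF k x(1)])
  show "AE \<omega> in M. visit_sa k h s a \<omega> * real_cond_exp M (G k h) (\<lambda>\<omega>. of_bool (st k (Suc h) \<omega> = s')) \<omega> =
      visit_sa k h s a \<omega> * P h s a s'"
    using next_state[OF k x(1) s'] by eventually_elim auto
qed auto

text \<open>Unlike rewards and transitions, actions are conditioned on \<open>F k h\<close>, the
  information before they are drawn. The indicator of the current state turns the policies at the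
  random state into those at \<open>s\<close>.\<close>

lemma action_orth:
  assumes k: "k \<in> {1..K}" and x: "h \<in> {1..H}" "s \<in> S" "a \<in> A" "b \<in> B"
    and Z: "Z \<in> borel_measurable (F k h)" "\<And>\<omega>. \<omega> \<in> space M \<Longrightarrow> \<bar>Z \<omega>\<bar> \<le> c"
  shows "expectation (\<lambda>\<omega>. Z \<omega> * of_bool (st k h \<omega> = s) * of_bool (ac k h \<omega> = a \<and> bc k h \<omega> = b)) =
    expectation (\<lambda>\<omega>. Z \<omega> * of_bool (st k h \<omega> = s) * (pol1 \<omega> k h s a * pol2 \<omega> k h s b))"
proof -
  have sub: "subalgebra M (F k h)" "st k h \<in> F k h \<rightarrow>\<^sub>M count_space S"
    using k x by (auto intro!: F_sub st_meas)
  have pm: "policy_meas M A (\<lambda>\<omega>. pol1 \<omega> k)" "policy_meas M B (\<lambda>\<omega>. pol2 \<omega> k)"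
    using pol_meas[OF observed_M, of k] k by auto
  note ab = measurable_from_subalg[OF G_sub[OF k x(1)] ac_meas[OF k x(1)]] measurable_from_subalg[OF G_sub[OF k x(1)] bc_meas[OF k x(1)]]
  show ?thesis
  proof (rule expectation_mult_cond_exp[OF sub(1) Z of_bool_eq_meas[OF sub(2)]])
    show "(\<lambda>\<omega>. of_bool (ac k h \<omega> = a \<and> bc k h \<omega> = b) :: real) \<in> borel_measurable M"
      unfolding of_bool_conj by (intro borel_measurable_times of_bool_eq_meas[OF ab(1)] of_bool_eq_meas[OF ab(2)])
    show "(\<lambda>\<omega>. pol1 \<omega> k h s a * pol2 \<omega> k h s b) \<in> borel_measurable M"
      by (intro borel_measurable_times policy_measD[OF pm(1)] policy_measD[OF pm(2)] x)
    show "AE \<omega> in M. of_bool (st k h \<omega> = s) * real_cond_exp M (F k h) (\<lambda>\<omega>. of_bool (ac k h \<omega> = a \<and> bc k h \<omega> = b)) \<omega> =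
        of_bool (st k h \<omega> = s) * (pol1 \<omega> k h s a * pol2 \<omega> k h s b)"
      using actions[OF k x(1,3,4)] by eventually_elim auto
  qed auto
qed

section \<open>The law of the visits within an episode\<close>

lemma pol_meas_F:
  assumes "k \<in> {1..K}"
  shows "policy_meas (F k 1) A (\<lambda>\<omega>. pol1 \<omega> k)" "policy_meas (F k 1) B (\<lambda>\<omega>. pol2 \<omega> k)"
  using pol_meas[OF observed_F[OF assms], of k] assms by auto

lemma reach_P_meas_F:
  assumes "k \<in> {1..K}" "h \<in> {1..Suc H}" "s \<in> S"
  shows "(\<lambda>\<omega>. reach (pol1 \<omega> k) P h s) \<in> borel_measurable (F k 1)"
  by (rule reach_meas[OF pol_meas_F(1)[OF assms(1)], of "\<lambda>_. P"]) (use assms in auto)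

lemma rate_meas:
  assumes "k \<in> {1..K}" "h \<in> {1..H}" "s \<in> S" "a \<in> A" "b \<in> B"
  shows "rate k h s a b \<in> borel_measurable (F k 1)"
  using assms by (intro borel_measurable_times reach_P_meas_F policy_measD[OF pol_meas_F(1)] policy_measD[OF pol_meas_F(2)]) auto

lemma rate_range:
  assumes "h \<in> {1..H}" "s \<in> S" "a \<in> A" "b \<in> B"
  shows "\<bar>rate k h s a b \<omega>\<bar> \<le> 1"
  using reach_nonneg[OF pol_policies(1) substochastic_P, of h s] reach_le_1[OF pol_policies(1) substochastic_P, of h s]
    pol_range(1)[OF assms(3), of \<omega> k h s] pol_range(2)[OF assms(4), of \<omega> k h s] assms
  by (simp add: abs_mult mult_le_one)

text \<open>The law of the state is a hypothesis because the lemma also serves inside the induction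
  that proves this law (\<open>state_prob\<close>). The policies are known before the episode, so
  they are absorbed into the bounded factor \<open>Z\<close>.\<close>

lemma action_prob:
  assumes k: "k \<in> {1..K}" and x: "h \<in> {1..H}" "s \<in> S" "a \<in> A" "b \<in> B"
    and state: "\<And>Z c. Z \<in> borel_measurable (F k 1) \<Longrightarrow> (\<And>\<omega>. \<omega> \<in> space M \<Longrightarrow> \<bar>Z \<omega>\<bar> \<le> c) \<Longrightarrow>
      expectation (\<lambda>\<omega>. Z \<omega> * of_bool (st k h \<omega> = s)) = expectation (\<lambda>\<omega>. Z \<omega> * reach (pol1 \<omega> k) P h s)"
    and Z: "Z \<in> borel_measurable (F k 1)" "\<And>\<omega>. \<omega> \<in> space M \<Longrightarrow> \<bar>Z \<omega>\<bar> \<le> c"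
  shows "expectation (\<lambda>\<omega>. Z \<omega> * visit k h s a b \<omega>) = expectation (\<lambda>\<omega>. Z \<omega> * rate k h s a b \<omega>)"
proof -
  have ZF: "Z \<in> borel_measurable (F k h)"
    using x by (intro measurable_from_subalg[OF F_mono[OF k] Z(1)]) auto
  let ?p = "\<lambda>\<omega>. pol1 \<omega> k h s a * pol2 \<omega> k h s b"
  have "expectation (\<lambda>\<omega>. Z \<omega> * visit k h s a b \<omega>) =
      expectation (\<lambda>\<omega>. Z \<omega> * of_bool (st k h \<omega> = s) * of_bool (ac k h \<omega> = a \<and> bc k h \<omega> = b))"
    by (simp add: of_bool_conj mult.assoc)
  also have "\<dots> = expectation (\<lambda>\<omega>. Z \<omega> * of_bool (st k h \<omega> = s) * ?p \<omega>)"
    by (rule action_orth[OF k x ZF Z(2)])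
  also have "\<dots> = expectation (\<lambda>\<omega>. (Z \<omega> * ?p \<omega>) * of_bool (st k h \<omega> = s))"
    by (simp add: mult_ac)
  also have "\<dots> = expectation (\<lambda>\<omega>. (Z \<omega> * ?p \<omega>) * reach (pol1 \<omega> k) P h s)"
  proof (rule state)
    show "(\<lambda>\<omega>. Z \<omega> * ?p \<omega>) \<in> borel_measurable (F k 1)"
      by (intro borel_measurable_times Z(1) policy_measD[OF pol_meas_F(1)] policy_measD[OF pol_meas_F(2)] k x)
    have "\<bar>?p \<omega>\<bar> \<le> 1" for \<omega>
      using pol_range(1)[OF x(3), of \<omega> k h s] pol_range(2)[OF x(4), of \<omega> k h s] by (simp add: abs_mult mult_le_one)
    then show "\<bar>Z \<omega> * ?p \<omega>\<bar> \<le> c" if "\<omega> \<in> space M" for \<omega>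
      by (rule abs_mult_le_left[OF Z(2)[OF that]])
  qed
  finally show ?thesis by (simp add: mult_ac)
qed

text \<open>Says in weak form that \<open>reach\<close> is the conditional law of the state given
  the start of the episode. \<open>Z\<close> and its bound are generalised in the induction, since
  the hypothesis is applied to \<open>Z\<close> times policy probabilities.\<close>

lemma state_prob:
  assumes k: "k \<in> {1..K}"
  shows "h \<in> {1..Suc H} \<Longrightarrow> s \<in> S \<Longrightarrow> Z \<in> borel_measurable (F k 1) \<Longrightarrow> (\<And>\<omega>. \<omega> \<in> space M \<Longrightarrow> \<bar>Z \<omega>\<bar> \<le> c) \<Longrightarrow>
      expectation (\<lambda>\<omega>. Z \<omega> * of_bool (st k h \<omega> = s)) = expectation (\<lambda>\<omega>. Z \<omega> * reach (pol1 \<omega> k) P h s)"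
proof (induction h arbitrary: s Z c)
  case (Suc h)
  show ?case
  proof (cases "h = 0")
    case True
    then show ?thesis using start[OF k] by (intro Bochner_Integration.integral_cong) auto
  next
    case False
    then have h: "h \<in> {1..H}" "1 \<le> h" using Suc(2) by auto
    let ?n = "\<lambda>\<omega>. of_bool (st k (Suc h) \<omega> = s) :: real"
    have sub: "subalgebra M (F k 1)" by (rule F_sub[OF k]) auto
    have ZG: "Z \<in> borel_measurable (G k h)"
      by (rule measurable_from_subalg[OF subalgebra_trans[OF F_G[OF k h(1)] F_mono[OF k, of 1 h]] Suc(4)]) (use h in auto)
    note Zv = measurable_from_subalg[OF G_sub[OF k h(1)] ZG] Suc(5)
    note v = step_meas(2,3)[OF k h(1) G_sub[OF k h(1)]]
    have nM: "?n \<in> borel_measurable M"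
      using h by (intro next_meas[OF k h(1) F_sub[OF k]]) auto
    have int_n: "integrable M (\<lambda>\<omega>. Z \<omega> * (visit_sa k h s' a \<omega> * ?n \<omega>))" for s' a
      by (rule integrable_mult_bounded[OF Zv borel_measurable_times[OF v(1) nM]]) auto
    have int_v: "integrable M (\<lambda>\<omega>. Z \<omega> * visit k h s' a b \<omega>)" for s' a b
      by (rule integrable_mult_bounded[OF Zv v(2)]) auto
    have int_r: "integrable M (\<lambda>\<omega>. Z \<omega> * rate k h s' a b \<omega>)" if "s' \<in> S" "a \<in> A" "b \<in> B" for s' a b
      by (rule integrable_mult_bounded[OF Zv measurable_from_subalg[OF sub rate_meas[OF k h(1) that]] rate_range[OF h(1) that]])
    \<comment> \<open>Decomposition by the state and Player 1's action at step h: exactly one of the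
      indicators \<open>visit_sa\<close> is 1.\<close>
    have "expectation (\<lambda>\<omega>. Z \<omega> * ?n \<omega>) = expectation (\<lambda>\<omega>. \<Sum>s'\<in>S. \<Sum>a\<in>A. Z \<omega> * (visit_sa k h s' a \<omega> * ?n \<omega>))"
    proof (rule Bochner_Integration.integral_cong[OF refl])
      fix \<omega> assume w: "\<omega> \<in> space M"
      have "(\<Sum>s'\<in>S. \<Sum>a\<in>A. visit_sa k h s' a \<omega>) = (1::real)"
        using st_in_S[OF k _ w, of h] act_in[OF k h(1) w] h finite_spaces
        unfolding of_bool_conj sum_distrib_left[symmetric] by (simp add: of_bool_def)
      then show "Z \<omega> * ?n \<omega> = (\<Sum>s'\<in>S. \<Sum>a\<in>A. Z \<omega> * (visit_sa k h s' a \<omega> * ?n \<omega>))"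
        by (simp flip: sum_distrib_left sum_distrib_right)
    qed
    also have "\<dots> = (\<Sum>s'\<in>S. \<Sum>a\<in>A. expectation (\<lambda>\<omega>. Z \<omega> * (visit_sa k h s' a \<omega> * ?n \<omega>)))"
      using int_n by (simp add: integrable_sum)
    also have "\<dots> = (\<Sum>s'\<in>S. \<Sum>a\<in>A. \<Sum>b\<in>B. P h s' a s * expectation (\<lambda>\<omega>. Z \<omega> * visit k h s' a b \<omega>))"
    proof (intro sum.cong refl)
      fix s' a assume s': "s' \<in> S" and a: "a \<in> A"
      have "expectation (\<lambda>\<omega>. Z \<omega> * (visit_sa k h s' a \<omega> * ?n \<omega>)) = expectation (\<lambda>\<omega>. Z \<omega> * visit_sa k h s' a \<omega> * P h s' a s)"
        unfolding mult.assoc[symmetric] by (rule transition_orth[OF k h(1) s' a Suc(3) ZG Suc(5)])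
      \<comment> \<open>The transition does not involve b, but \<open>action_prob\<close> concerns
        joint actions; b is split off here and summed out again at the end.\<close>
      also have "\<dots> = expectation (\<lambda>\<omega>. \<Sum>b\<in>B. P h s' a s * (Z \<omega> * visit k h s' a b \<omega>))"
      proof (rule Bochner_Integration.integral_cong[OF refl])
        fix \<omega> assume w: "\<omega> \<in> space M"
        have "(\<Sum>b\<in>B. visit k h s' a b \<omega>) = visit_sa k h s' a \<omega>"
          using act_in[OF k h(1) w] finite_spaces by (auto simp: of_bool_def)
        then show "Z \<omega> * visit_sa k h s' a \<omega> * P h s' a s = (\<Sum>b\<in>B. P h s' a s * (Z \<omega> * visit k h s' a b \<omega>))"
          unfolding sum_distrib_left[symmetric] by simp
      qed
      also have "\<dots> = (\<Sum>b\<in>B. P h s' a s * expectation (\<lambda>\<omega>. Z \<omega> * visit k h s' a b \<omega>))"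
        using int_v by (simp add: integrable_sum)
      finally show "expectation (\<lambda>\<omega>. Z \<omega> * (visit_sa k h s' a \<omega> * ?n \<omega>)) = \<dots>" .
    qed
    also have "\<dots> = (\<Sum>s'\<in>S. \<Sum>a\<in>A. \<Sum>b\<in>B. P h s' a s * expectation (\<lambda>\<omega>. Z \<omega> * rate k h s' a b \<omega>))"
      using Suc(1) h by (intro sum.cong refl arg_cong2[where f = "(*)"] action_prob[OF k h(1) _ _ _ _ Suc(4,5)]) auto
    also have "\<dots> = expectation (\<lambda>\<omega>. \<Sum>s'\<in>S. \<Sum>a\<in>A. \<Sum>b\<in>B. P h s' a s * (Z \<omega> * rate k h s' a b \<omega>))"
      using int_r by (simp add: integrable_sum)
    also have "\<dots> = expectation (\<lambda>\<omega>. Z \<omega> * reach (pol1 \<omega> k) P (Suc h) s)"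
    proof (rule Bochner_Integration.integral_cong[OF refl])
      fix \<omega>
      have "(\<Sum>b\<in>B. P h s' a s * (Z \<omega> * rate k h s' a b \<omega>)) = Z \<omega> * (reach (pol1 \<omega> k) P h s' * pol1 \<omega> k h s' a * P h s' a s)" for s' a
      proof -
        have "(\<Sum>b\<in>B. P h s' a s * (Z \<omega> * rate k h s' a b \<omega>)) =
            Z \<omega> * (reach (pol1 \<omega> k) P h s' * pol1 \<omega> k h s' a * P h s' a s) * (\<Sum>b\<in>B. pol2 \<omega> k h s' b)"
          unfolding sum_distrib_left by (simp add: mult_ac)
        then show ?thesis using prob_simplexD(2)[OF conjunct2[OF pol_simplex(2)]] by simp
      qed
      then show "(\<Sum>s'\<in>S. \<Sum>a\<in>A. \<Sum>b\<in>B. P h s' a s * (Z \<omega> * rate k h s' a b \<omega>)) = Z \<omega> * reach (pol1 \<omega> k) P (Suc h) s"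
        unfolding reach_Suc[OF h(2)] sum_distrib_left by simp
    qed
    finally show ?thesis .
  qed
qed simp

lemma visit_prob:
  assumes "k \<in> {1..K}" "h \<in> {1..H}" "s \<in> S" "a \<in> A" "b \<in> B"
    and "Z \<in> borel_measurable (F k 1)" "\<And>\<omega>. \<omega> \<in> space M \<Longrightarrow> \<bar>Z \<omega>\<bar> \<le> c"
  shows "expectation (\<lambda>\<omega>. Z \<omega> * visit k h s a b \<omega>) =
    expectation (\<lambda>\<omega>. Z \<omega> * rate k h s a b \<omega>)"
  using assms(2) by (intro action_prob[OF assms(1-5) _ assms(6,7)] state_prob[OF assms(1) _ assms(3)]) auto

end

section \<open>Accuracy of the estimates\<close>

lemma sqrt_mult_divide_self: "0 < n \<Longrightarrow> sqrt (c * n) / n = sqrt (c / n)"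
  by (simp add: real_sqrt_mult real_sqrt_divide real_div_sqrt field_simps)

text \<open>Since D has total 0, its negative part is as large as its positive part, and one-sided
  bounds on subset sums control both signs. The result is m c without a factor 2, which
  \<open>bonus_P\<close> would not cover.\<close>

lemma abs_sum_weighted_le:
  fixes D W :: "'x \<Rightarrow> real"
  assumes fin: "finite X" and D0: "sum D X = 0" and D: "\<And>U. U \<subseteq> X \<Longrightarrow> sum D U \<le> c"
    and W: "\<And>x. x \<in> X \<Longrightarrow> 0 \<le> W x \<and> W x \<le> m" and m: "0 \<le> m"
  shows "\<bar>\<Sum>x\<in>X. D x * W x\<bar> \<le> m * c"
proof -
  have up: "(\<Sum>x\<in>X. E x * W x) \<le> m * sum E {x \<in> X. 0 \<le> E x}" for E :: "'x \<Rightarrow> real"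
  proof -
    have "(\<Sum>x\<in>X. E x * W x) \<le> (\<Sum>x\<in>X. if 0 \<le> E x then m * E x else 0)"
      using W by (intro sum_mono) (auto simp: mult.commute[of m] not_le intro!: mult_left_mono mult_nonpos_nonneg)
    also have "\<dots> = m * sum E {x \<in> X. 0 \<le> E x}"
      using fin by (simp add: sum.If_cases sum_distrib_left Int_def)
    finally show ?thesis .
  qed
  have "sum D {x \<in> X. 0 \<le> D x} \<le> c" by (rule D) auto
  then have 1: "(\<Sum>x\<in>X. D x * W x) \<le> m * c"
    using up[of D] mult_left_mono[OF _ m] by fastforce
  have "sum D {x \<in> X. 0 \<le> - D x} + sum D {x \<in> X. 0 < D x} = sum D X"
    using fin by (subst sum.union_disjoint[symmetric]) (auto intro!: sum.cong)
  moreover have "sum D {x \<in> X. 0 < D x} \<le> c" by (rule D) auto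
  ultimately have "sum (\<lambda>x. - D x) {x \<in> X. 0 \<le> - D x} \<le> c" using D0 by (simp add: sum_negf)
  then have "(\<Sum>x\<in>X. - D x * W x) \<le> m * c"
    using up[of "\<lambda>x. - D x"] mult_left_mono[OF _ m] by fastforce
  with 1 show ?thesis by (simp add: sum_negf abs_le_iff)
qed

context fictitious_play
begin

lemma card_pos: "1 \<le> real (card S)" "1 \<le> real (card A)" "1 \<le> real (card B)" "1 \<le> real H" "1 \<le> real K"
  using finite_spaces nonempty_spaces horizon_pos episodes_pos by (auto simp: Suc_le_eq card_gt_0_iff)

definition log_r :: real where
  "log_r = ln (real (card S) * real (card A) * real (card B) * real H * real K / \<delta>)"

definition log_P :: real where
  "log_P = ln (real (card S) * real (card A) * real H * real K / \<delta>)"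

lemma size_bounds:
  "real K \<le> real (card S) * real (card A) * real H * real K"
  "real (card S) * real K \<le> real (card S) * real (card A) * real H * real K"
  "real (card S) * real (card A) * real H * real K \<le> real (card S) * real (card A) * real (card B) * real H * real K"
proof -
  have "card S \<ge> 1" "card A \<ge> 1" "card B \<ge> 1" "H \<ge> 1" using card_pos by (simp_all add: Suc_le_eq)
  then have "K \<le> card S * card A * H * K" "card S * K \<le> card S * card A * H * K"
    "card S * card A * H * K \<le> card S * card A * card B * H * K"
    by (simp_all add: Suc_le_eq)
  then show "real K \<le> real (card S) * real (card A) * real H * real K"
    "real (card S) * real K \<le> real (card S) * real (card A) * real H * real K"
    "real (card S) * real (card A) * real H * real K \<le> real (card S) * real (card A) * real (card B) * real H * real K"
    unfolding of_nat_mult[symmetric] by (simp_all only: of_nat_le_iff)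
qed

lemma log_P_le_log_r: "log_P \<le> log_r"
  unfolding log_P_def log_r_def using size_bounds confidence card_pos
  by (intro ln_mono divide_right_mono) (auto intro!: divide_pos_pos mult_pos_pos)

text \<open>From ln 2 >= 2/3. A lower bound on the logarithms makes the bonus at an unvisited entry
  as large as the trivial error.\<close>

lemma log_ge: "2 \<le> y \<Longrightarrow> 2 / 3 \<le> ln (y / \<delta>)"
proof -
  assume "2 \<le> y"
  then have "y * \<delta> \<le> y * 1" using confidence by (intro mult_left_mono) auto
  then have "2 \<le> y / \<delta>" using confidence \<open>2 \<le> y\<close> by (simp add: pos_le_divide_eq)
  then have "ln 2 \<le> ln (y / \<delta>)" by (intro ln_mono) auto
  then show ?thesis using ln2_ge_two_thirds by linarith
qed

lemma log_P_ge: "2 \<le> K \<Longrightarrow> 2 / 3 \<le> log_P"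
  unfolding log_P_def using size_bounds(1) by (intro log_ge) linarith

lemma exp_minus_log_r: "exp (- log_r) = \<delta> / (real (card S) * real (card A) * real (card B) * real H * real K)"
  unfolding log_r_def using confidence card_pos by (simp add: exp_minus field_simps)

lemma exp_minus_log_P: "exp (- log_P) = \<delta> / (real (card S) * real (card A) * real H * real K)"
  unfolding log_P_def using confidence card_pos by (simp add: exp_minus field_simps)

lemma bonus_r_eq: "1 \<le> k \<Longrightarrow> bonus_r \<omega> k h s a b = sqrt (4 * log_r / real (max (count_sab \<omega> k h s a b) 1))"
  by (simp add: bonus_r_def log_r_def)

lemma bonus_P_eq: "1 \<le> k \<Longrightarrow> bonus_P \<omega> k h s a = sqrt (2 * (real H)\<^sup>2 * real (card S) * log_P / real (max (count_sa \<omega> k h s a) 1))"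
  by (simp add: bonus_P_def log_P_def)

lemma count_le: "count_sab \<omega> k h s a b \<le> k" "count_sa \<omega> k h s a \<le> k"
proof -
  have *: "card {\<tau>\<in>{1..k}. Q \<tau>} \<le> k" for Q
  proof -
    have "card {\<tau>\<in>{1..k}. Q \<tau>} \<le> card {1..k}" by (rule card_mono) auto
    then show ?thesis by simp
  qed
  show "count_sab \<omega> k h s a b \<le> k" "count_sa \<omega> k h s a \<le> k"
    unfolding count_sab_def count_sa_def by (rule *)+
qed

end

section \<open>Accuracy of the reward estimates\<close>

context fictitious_play_run
begin

text \<open>The threshold is n times the bonus at n visits, and the sign c selects the side of the
  deviation. The count n is a parameter rather than the random count; the tuple argument lets a
  union run over a product set.\<close>

definition reward_tail :: "nat \<times> nat \<times> nat \<times> 's \<times> 'a \<times> 'b \<times> real \<Rightarrow> 'w set" where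
  "reward_tail = (\<lambda>(k, n, h, s, a, b, c). {\<omega> \<in> space M.
     sqrt (4 * log_r * real n) < (\<Sum>\<tau>\<in>{1..k}. c * (visit \<tau> h s a b \<omega> * (rw \<tau> h s a b \<omega> - r h s a b))) \<and>
     (\<Sum>\<tau>\<in>{1..k}. visit \<tau> h s a b \<omega>) = real n})"

lemma reward_diff_meas:
  assumes "k \<in> {1..K}" "h \<in> {1..H}" "subalgebra N (F k (Suc H))"
  shows "(\<lambda>\<omega>. c * (visit k h s a b \<omega> * (rw k h s a b \<omega> - r h s a b))) \<in> borel_measurable N"
proof -
  have "(\<lambda>\<omega>. c * (visit k h s a b \<omega> * rw k h s a b \<omega> - visit k h s a b \<omega> * r h s a b)) \<in> borel_measurable N"
    by (intro borel_measurable_times borel_measurable_diff borel_measurable_const reward_meas[OF assms]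
      step_meas(3)[OF assms(1,2) subalgebra_trans[OF assms(3) F_end_G[OF assms(1,2)]]])
  then show ?thesis by (simp only: right_diff_distrib)
qed

lemma F_end_sub: "k \<in> {1..K} \<Longrightarrow> subalgebra M (F k (Suc H))"
  by (rule F_sub) auto

text \<open>Martingale tail over the episodes along \<open>G \<tau> h\<close>, which contains the
  actions of step h and thus decides whether the entry is visited. The constant 4 in the bonus makes
  the exponent twice the logarithm.\<close>

lemma reward_tail_prob:
  assumes k: "k \<in> {1..K}" and n: "1 \<le> n" and x: "h \<in> {1..H}" "s \<in> S" "a \<in> A" "b \<in> B"
    and c: "c \<in> {-1, 1}" and L: "0 \<le> log_r"
  shows "reward_tail (k, n, h, s, a, b, c) \<in> sets M" "prob (reward_tail (k, n, h, s, a, b, c)) \<le> exp (- 2 * log_r)"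
proof -
  let ?X = "\<lambda>\<tau> \<omega>. c * (visit \<tau> h s a b \<omega> * (rw \<tau> h s a b \<omega> - r h s a b))"
  have kK: "\<tau> \<in> {1..K}" if "\<tau> \<in> {1..k}" for \<tau> using that k by auto
  note G_past' = G_past[OF _ _ _ x(1)]
  have past: "?X j \<in> borel_measurable (G \<tau> h)" "visit j h s a b \<in> borel_measurable (G \<tau> h)"
    if "\<tau> \<in> {1..k}" "j \<in> {1..<\<tau>}" for \<tau> j
  proof -
    have j: "j \<in> {1..K}" using that k by auto
    have sub: "subalgebra (G \<tau> h) (F j (Suc H))" using that k by (intro G_past') auto
    show "?X j \<in> borel_measurable (G \<tau> h)" by (rule reward_diff_meas[OF j x(1) sub])
    show "visit j h s a b \<in> borel_measurable (G \<tau> h)"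
      by (rule step_meas(3)[OF j x(1) subalgebra_trans[OF sub F_end_G[OF j x(1)]]])
  qed
  have meas: "?X \<tau> \<in> borel_measurable M" "visit \<tau> h s a b \<in> borel_measurable M" if "\<tau> \<in> {1..k}" for \<tau>
    using reward_diff_meas[OF kK[OF that] x(1) F_end_sub[OF kK[OF that]]]
      step_meas(3)[OF kK[OF that] x(1) G_sub[OF kK[OF that] x(1)]] by blast+
  have bound: "\<bar>?X \<tau> \<omega>\<bar> \<le> visit \<tau> h s a b \<omega> \<and> visit \<tau> h s a b \<omega> \<in> {0, 1}"
    if "\<tau> \<in> {1..k}" "\<omega> \<in> space M" for \<tau> \<omega>
  proof -
    have "rw \<tau> h s a b \<omega> \<in> {0..1}" "r h s a b \<in> {0..1}" using rw_range[OF kK[OF that(1)] x that(2)] reward_range[OF x] by auto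
    then have "\<bar>rw \<tau> h s a b \<omega> - r h s a b\<bar> \<le> 1" by auto
    then show ?thesis using c by (auto simp: of_bool_def)
  qed
  have orth: "expectation (\<lambda>\<omega>. Z \<omega> * ?X \<tau> \<omega>) = 0"
    if "\<tau> \<in> {1..k}" "Z \<in> borel_measurable (G \<tau> h)" "\<And>\<omega>. \<omega> \<in> space M \<Longrightarrow> \<bar>Z \<omega>\<bar> \<le> d" for \<tau> Z d
  proof -
    have "expectation (\<lambda>\<omega>. Z \<omega> * ?X \<tau> \<omega>) = expectation (\<lambda>\<omega>. c * (Z \<omega> * (visit \<tau> h s a b \<omega> * (rw \<tau> h s a b \<omega> - r h s a b))))"
      by (simp add: mult_ac)
    also have "\<dots> = c * expectation (\<lambda>\<omega>. Z \<omega> * (visit \<tau> h s a b \<omega> * (rw \<tau> h s a b \<omega> - r h s a b)))"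
      by simp
    also have "\<dots> = 0" using reward_orth[OF kK[OF that(1)] x that(2,3)] by simp
    finally show ?thesis .
  qed
  have t: "0 \<le> sqrt (4 * log_r * real n)" "0 < real n" using L n by auto
  have ex: "- (sqrt (4 * log_r * real n))\<^sup>2 / (2 * real n) = - 2 * log_r" using L n by simp
  note mt = martingale_tail[where \<F> = "\<lambda>k. G k h" and X = ?X and v = "\<lambda>\<tau>. visit \<tau> h s a b" and n = k
      and t = "sqrt (4 * log_r * real n)" and m = "real n", OF past meas bound orth t]
  show "reward_tail (k, n, h, s, a, b, c) \<in> sets M"
    unfolding reward_tail_def prod.case by (rule mt(1))
  have "prob (reward_tail (k, n, h, s, a, b, c)) \<le> exp (- (sqrt (4 * log_r * real n))\<^sup>2 / (2 * real n))"
    unfolding reward_tail_def prod.case by (rule mt(2))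
  then show "prob (reward_tail (k, n, h, s, a, b, c)) \<le> exp (- 2 * log_r)"
    by (simp only: ex)
qed

lemma prob_UN_le:
  assumes "finite I" "\<And>i. i \<in> I \<Longrightarrow> E i \<in> sets M" "\<And>i. i \<in> I \<Longrightarrow> prob (E i) \<le> q"
  shows "(\<Union>i\<in>I. E i) \<in> sets M" "prob (\<Union>i\<in>I. E i) \<le> real (card I) * q"
proof -
  show "(\<Union>i\<in>I. E i) \<in> sets M" using assms by auto
  have "prob (\<Union>i\<in>I. E i) \<le> (\<Sum>i\<in>I. prob (E i))"
    using assms by (intro measure_UNION_le) auto
  also have "\<dots> \<le> real (card I) * q" using assms(3) by (rule sum_bounded_above)
  finally show "prob (\<Union>i\<in>I. E i) \<le> real (card I) * q" .
qed

definition reward_fail :: "'w set" where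
  "reward_fail = (\<Union>i\<in>{1..K} \<times> {1..K} \<times> {1..H} \<times> S \<times> A \<times> B \<times> {-1, 1}. reward_tail i)"

lemma reward_fail_prob:
  assumes "0 \<le> log_r"
  shows "reward_fail \<in> sets M" "prob reward_fail \<le> 2 * \<delta>"
proof -
  let ?I = "{1..K} \<times> {1..K} \<times> {1..H} \<times> S \<times> A \<times> B \<times> {-1, 1::real}"
  let ?x = "real (card S) * real (card A) * real (card B) * real H * real K"
  have fin: "finite ?I" using finite_spaces by auto
  have tail: "reward_tail i \<in> sets M" "prob (reward_tail i) \<le> exp (- 2 * log_r)" if "i \<in> ?I" for i
    using that reward_tail_prob[OF _ _ _ _ _ _ _ assms] by auto
  show "reward_fail \<in> sets M" unfolding reward_fail_def by (rule prob_UN_le(1)[OF fin tail])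
  have "prob reward_fail \<le> real (card ?I) * exp (- 2 * log_r)"
    unfolding reward_fail_def by (rule prob_UN_le(2)[OF fin tail])
  \<comment> \<open>The number of events contains K twice, for the episode and for the visit count,
    whereas \<open>exp (- log_r)\<close> is \<delta> / \<open>?x\<close> with a single K; the square
    pays for the second one.\<close>
  also have "real (card ?I) = 2 * real K * ?x" by (simp add: card_cartesian_product)
  also have "exp (- 2 * log_r) = (exp (- log_r))\<^sup>2" by (simp flip: exp_double)
  also have "2 * real K * ?x * (exp (- log_r))\<^sup>2 = 2 * \<delta> * (\<delta> * (real K / ?x))"
    unfolding exp_minus_log_r using card_pos by (simp add: power2_eq_square field_simps)
  also have "\<dots> \<le> 2 * \<delta> * (1 * 1)"
  proof -
    have "real K \<le> ?x" using size_bounds by linarith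
    then have "real K / ?x \<le> 1" using card_pos by (intro divide_le_eq_1_pos[THEN iffD2]) linarith+
    then show ?thesis using confidence by (intro mult_left_mono mult_mono) auto
  qed
  finally show "prob reward_fail \<le> 2 * \<delta>" by simp
qed

lemma reward_accurateI:
  assumes L: "1 / 4 \<le> log_r" and w: "\<omega> \<in> space M" "\<omega> \<notin> reward_fail"
  shows "reward_accurate \<omega>"
  unfolding reward_accurate_def
proof (intro ballI)
  fix k h s a b assume k: "k \<in> {1..K}" and x: "h \<in> {1..H}" "s \<in> S" "a \<in> A" "b \<in> B"
  define n where "n = count_sab \<omega> k h s a b"
  define T where "T = (\<Sum>\<tau>\<in>{1..k}. visit \<tau> h s a b \<omega> * rw \<tau> h s a b \<omega>)"
  have n: "(\<Sum>\<tau>\<in>{1..k}. visit \<tau> h s a b \<omega>) = real n" by (simp add: n_def real_count_sab)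
  have k1: "1 \<le> k" using k by auto
  have rh: "r_hat \<omega> k h s a b = T / real (max n 1)" using k1 by (simp add: r_hat_def T_def n_def)
  show "\<bar>r_hat \<omega> k h s a b - r h s a b\<bar> \<le> bonus_r \<omega> k h s a b"
  proof (cases "n = 0")
    case True
    then have "\<forall>\<tau>\<in>{1..k}. visit \<tau> h s a b \<omega> = 0"
      using n sum_nonneg_eq_0_iff[of "{1..k}" "\<lambda>\<tau>. visit \<tau> h s a b \<omega>"] by simp
    then have "T = 0" unfolding T_def by (intro sum.neutral) auto
    \<comment> \<open>Without visits the estimate is 0 and the error at most 1, which is where 1/4
      <= \<open>log_r\<close> enters.\<close>
    then have "\<bar>r_hat \<omega> k h s a b - r h s a b\<bar> \<le> 1" using reward_range[OF x] by (simp add: rh)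
    also have "1 \<le> sqrt (4 * log_r)" using L by simp
    finally show ?thesis using True by (simp add: bonus_r_eq[OF k1] n_def)
  next
    case False
    then have n1: "n \<in> {1..K}" using count_le(1)[of \<omega> k h s a b] k by (auto simp: n_def)
    have notin: "\<omega> \<notin> reward_tail (k, n, h, s, a, b, c)" if "c \<in> {-1, 1}" for c
    proof
      assume "\<omega> \<in> reward_tail (k, n, h, s, a, b, c)"
      then have "\<omega> \<in> reward_fail" unfolding reward_fail_def
        by (rule UN_I[rotated]) (use k n1 x that in simp)
      with w(2) show False ..
    qed
    have dev: "(\<Sum>\<tau>\<in>{1..k}. c * (visit \<tau> h s a b \<omega> * (rw \<tau> h s a b \<omega> - r h s a b))) = c * (T - real n * r h s a b)" for c
      unfolding T_def n[symmetric] sum_distrib_right sum_subtractf[symmetric] sum_distrib_left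
      by (simp only: right_diff_distrib)
    have "c * (T - real n * r h s a b) \<le> sqrt (4 * log_r * real n)" if "c \<in> {-1, 1}" for c
      using notin[OF that] w(1) unfolding reward_tail_def prod.case mem_Collect_eq dev n by simp
    from this[of 1] this[of "-1"] have "\<bar>T - real n * r h s a b\<bar> \<le> sqrt (4 * log_r * real n)" by (simp add: abs_le_iff)
    then have "\<bar>T - real n * r h s a b\<bar> / real n \<le> sqrt (4 * log_r * real n) / real n"
      by (rule divide_right_mono) simp
    moreover have "\<bar>T - real n * r h s a b\<bar> / real n = \<bar>T / real n - r h s a b\<bar>"
    proof -
      have "T / real n - r h s a b = (T - real n * r h s a b) / real n"
        using n1 by (simp add: diff_divide_distrib)
      then show ?thesis by (simp add: abs_divide)
    qed
    ultimately show ?thesis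
      using n1 unfolding rh bonus_r_eq[OF k1] n_def[symmetric] by (simp add: sqrt_mult_divide_self max_absorb1)
  qed
qed

section \<open>Accuracy of the transition estimates\<close>

definition transition_noise :: "nat \<Rightarrow> nat \<Rightarrow> 's \<Rightarrow> 'a \<Rightarrow> 's \<Rightarrow> 'w \<Rightarrow> real" where
  "transition_noise k h s a s' \<omega> = visit_sa k h s a \<omega> * (of_bool (st k (Suc h) \<omega> = s') - P h s a s')"

text \<open>Deviation of the mass of a set U of next states; all subsets together control every
  bounded test function. The threshold is n times \<open>bonus_P\<close> at n visits, divided by
  H.\<close>

definition transition_tail :: "nat \<times> nat \<times> nat \<times> 's \<times> 'a \<times> 's set \<Rightarrow> 'w set" where
  "transition_tail = (\<lambda>(k, n, h, s, a, U). {\<omega> \<in> space M.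
     sqrt (2 * real (card S) * log_P * real n) < (\<Sum>\<tau>\<in>{1..k}. \<Sum>s'\<in>U. transition_noise \<tau> h s a s' \<omega>) \<and>
     (\<Sum>\<tau>\<in>{1..k}. visit_sa \<tau> h s a \<omega>) = real n})"

lemma transition_noise_meas:
  assumes "k \<in> {1..K}" "h \<in> {1..H}" "subalgebra N (F k (Suc h))"
  shows "transition_noise k h s a s' \<in> borel_measurable N"
  unfolding transition_noise_def[abs_def]
  by (intro borel_measurable_times borel_measurable_diff borel_measurable_const next_meas[OF assms]
      step_meas(2)[OF assms(1,2) subalgebra_trans[OF assms(3) G_F[OF assms(1,2)]]])

lemma sum_transition_noise_bound:
  assumes k: "k \<in> {1..K}" and x: "h \<in> {1..H}" "s \<in> S" "a \<in> A" and U: "U \<subseteq> S"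
  shows "\<bar>\<Sum>s'\<in>U. transition_noise k h s a s' \<omega>\<bar> \<le> visit_sa k h s a \<omega>"
proof -
  have fin: "finite U" using U finite_spaces finite_subset by blast
  have P: "0 \<le> (\<Sum>s'\<in>U. P h s a s')" "(\<Sum>s'\<in>U. P h s a s') \<le> 1"
    using prob_simplexD[OF transition[OF x]] U finite_spaces sum_mono2[of S U "P h s a"]
    by (auto intro!: sum_nonneg)
  have "(\<Sum>s'\<in>U. of_bool (st k (Suc h) \<omega> = s')) = (of_bool (st k (Suc h) \<omega> \<in> U) :: real)"
    using fin by (simp add: of_bool_def)
  then have "(\<Sum>s'\<in>U. transition_noise k h s a s' \<omega>) = visit_sa k h s a \<omega> * (of_bool (st k (Suc h) \<omega> \<in> U) - (\<Sum>s'\<in>U. P h s a s'))"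
    unfolding transition_noise_def by (simp only: sum_subtractf sum_distrib_left[symmetric])
  moreover have "\<bar>of_bool (st k (Suc h) \<omega> \<in> U) - (\<Sum>s'\<in>U. P h s a s')\<bar> \<le> 1" using P by (auto simp: of_bool_def)
  ultimately show ?thesis by (simp add: of_bool_def)
qed

lemma transition_noise_orth:
  assumes k: "k \<in> {1..K}" and x: "h \<in> {1..H}" "s \<in> S" "a \<in> A" and U: "U \<subseteq> S"
    and Z: "Z \<in> borel_measurable (G k h)" "\<And>\<omega>. \<omega> \<in> space M \<Longrightarrow> \<bar>Z \<omega>\<bar> \<le> c"
  shows "expectation (\<lambda>\<omega>. Z \<omega> * (\<Sum>s'\<in>U. transition_noise k h s a s' \<omega>)) = 0"
proof -
  let ?v = "visit_sa k h s a" and ?n = "\<lambda>s' \<omega>. of_bool (st k (Suc h) \<omega> = s') :: real"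
  have ZM: "Z \<in> borel_measurable M" by (rule measurable_from_subalg[OF G_sub[OF k x(1)] Z(1)])
  have vM: "?v \<in> borel_measurable M" by (rule step_meas(2)[OF k x(1) G_sub[OF k x(1)]])
  have sub: "subalgebra M (F k (Suc h))" using k x by (intro F_sub) auto
  have nM: "?n s' \<in> borel_measurable M" for s' by (rule next_meas[OF k x(1) sub])
  note f = borel_measurable_times[OF ZM vM] abs_mult_le_left[OF Z(2)]
  have int1: "integrable M (\<lambda>\<omega>. Z \<omega> * ?v \<omega> * ?n s' \<omega>)" for s'
    by (rule integrable_mult_bounded[OF f nM]) auto
  have "integrable M (\<lambda>\<omega>. Z \<omega> * ?v \<omega>)"
    by (rule integrable_bounded[OF f]) auto
  then have int2: "integrable M (\<lambda>\<omega>. Z \<omega> * ?v \<omega> * P h s a s')" for s' by (rule integrable_mult_left)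
  have "expectation (\<lambda>\<omega>. Z \<omega> * (\<Sum>s'\<in>U. transition_noise k h s a s' \<omega>)) =
      expectation (\<lambda>\<omega>. \<Sum>s'\<in>U. Z \<omega> * ?v \<omega> * ?n s' \<omega> - Z \<omega> * ?v \<omega> * P h s a s')"
    unfolding transition_noise_def sum_distrib_left by (simp only: right_diff_distrib mult.assoc)
  also have "\<dots> = (\<Sum>s'\<in>U. expectation (\<lambda>\<omega>. Z \<omega> * ?v \<omega> * ?n s' \<omega> - Z \<omega> * ?v \<omega> * P h s a s'))"
    using int1 int2 by (intro Bochner_Integration.integral_sum Bochner_Integration.integrable_diff)
  also have "\<dots> = (\<Sum>s'\<in>U. expectation (\<lambda>\<omega>. Z \<omega> * ?v \<omega> * ?n s' \<omega>) - expectation (\<lambda>\<omega>. Z \<omega> * ?v \<omega> * P h s a s'))"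
    by (intro sum.cong refl Bochner_Integration.integral_diff int1 int2)
  also have "\<dots> = 0"
  proof (rule sum.neutral, rule ballI)
    fix s' assume "s' \<in> U"
    then have "s' \<in> S" using U by auto
    from transition_orth[OF k x this Z]
    show "expectation (\<lambda>\<omega>. Z \<omega> * ?v \<omega> * ?n s' \<omega>) - expectation (\<lambda>\<omega>. Z \<omega> * ?v \<omega> * P h s a s') = 0" by simp
  qed
  finally show ?thesis .
qed

text \<open>The factor |S| in the bonus makes the exponent |S| times \<open>log_P\<close>, which has
  to pay for the 2^|S| subsets.\<close>

lemma transition_tail_prob:
  assumes k: "k \<in> {1..K}" and n: "1 \<le> n" and x: "h \<in> {1..H}" "s \<in> S" "a \<in> A" and U: "U \<subseteq> S" and L: "0 \<le> log_P"
  shows "transition_tail (k, n, h, s, a, U) \<in> sets M"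
    "prob (transition_tail (k, n, h, s, a, U)) \<le> exp (- log_P) ^ card S"
proof -
  let ?X = "\<lambda>\<tau> \<omega>. \<Sum>s'\<in>U. transition_noise \<tau> h s a s' \<omega>"
  have kK: "\<tau> \<in> {1..K}" if "\<tau> \<in> {1..k}" for \<tau> using that k by auto
  have h: "1 \<le> Suc h" "Suc h \<le> Suc H" using x by auto
  have past: "?X j \<in> borel_measurable (G \<tau> h)" "visit_sa j h s a \<in> borel_measurable (G \<tau> h)"
    if "\<tau> \<in> {1..k}" "j \<in> {1..<\<tau>}" for \<tau> j
  proof -
    have j: "j \<in> {1..K}" using that k by auto
    have sub: "subalgebra (G \<tau> h) (F j (Suc H))" using that k by (intro G_past[OF _ _ _ x(1)]) auto
    show "?X j \<in> borel_measurable (G \<tau> h)"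
      by (intro borel_measurable_sum transition_noise_meas[OF j x(1) subalgebra_trans[OF sub F_mono[OF j h(1) h(2) order_refl]]])
    show "visit_sa j h s a \<in> borel_measurable (G \<tau> h)"
      by (rule step_meas(2)[OF j x(1) subalgebra_trans[OF sub F_end_G[OF j x(1)]]])
  qed
  have meas: "?X \<tau> \<in> borel_measurable M" "visit_sa \<tau> h s a \<in> borel_measurable M" if "\<tau> \<in> {1..k}" for \<tau>
  proof -
    have "subalgebra M (F \<tau> (Suc h))" using kK[OF that] h by (intro F_sub) auto
    then show "?X \<tau> \<in> borel_measurable M"
      by (intro borel_measurable_sum transition_noise_meas[OF kK[OF that] x(1)])
    show "visit_sa \<tau> h s a \<in> borel_measurable M"
      by (rule step_meas(2)[OF kK[OF that] x(1) G_sub[OF kK[OF that] x(1)]])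
  qed
  have bound: "\<bar>?X \<tau> \<omega>\<bar> \<le> visit_sa \<tau> h s a \<omega> \<and> visit_sa \<tau> h s a \<omega> \<in> {0, 1}"
    if "\<tau> \<in> {1..k}" "\<omega> \<in> space M" for \<tau> \<omega>
    using sum_transition_noise_bound[OF kK[OF that(1)] x U, of \<omega>] by (simp add: of_bool_def)
  have orth: "expectation (\<lambda>\<omega>. Z \<omega> * ?X \<tau> \<omega>) = 0"
    if "\<tau> \<in> {1..k}" "Z \<in> borel_measurable (G \<tau> h)" "\<And>\<omega>. \<omega> \<in> space M \<Longrightarrow> \<bar>Z \<omega>\<bar> \<le> d" for \<tau> Z d
    by (rule transition_noise_orth[OF kK[OF that(1)] x U that(2,3)])
  let ?t = "sqrt (2 * real (card S) * log_P * real n)"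
  have t: "0 \<le> ?t" "0 < real n" using L n by auto
  have ex: "- ?t\<^sup>2 / (2 * real n) = real (card S) * (- log_P)" using L n by simp
  note mt = martingale_tail[where \<F> = "\<lambda>k. G k h" and X = ?X and v = "\<lambda>\<tau>. visit_sa \<tau> h s a" and n = k
      and t = ?t and m = "real n", OF past meas bound orth t]
  show "transition_tail (k, n, h, s, a, U) \<in> sets M"
    unfolding transition_tail_def prod.case by (rule mt(1))
  have "prob (transition_tail (k, n, h, s, a, U)) \<le> exp (- ?t\<^sup>2 / (2 * real n))"
    unfolding transition_tail_def prod.case by (rule mt(2))
  then show "prob (transition_tail (k, n, h, s, a, U)) \<le> exp (- log_P) ^ card S"
    by (simp only: ex exp_of_nat_mult)
qed

lemma sum_transition_noise_all:
  assumes "k \<in> {1..K}" "h \<in> {1..H}" "s \<in> S" "a \<in> A" "\<omega> \<in> space M"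
  shows "(\<Sum>s'\<in>S. transition_noise k h s a s' \<omega>) = 0"
proof -
  have "(\<Sum>s'\<in>S. of_bool (st k (Suc h) \<omega> = s')) = (1::real)"
    using st_in_S[OF assms(1) _ assms(5), of "Suc h"] assms(2) finite_spaces by (simp add: of_bool_def)
  then show ?thesis
    using prob_simplexD(2)[OF transition[OF assms(2-4)]]
    unfolding transition_noise_def sum_distrib_left[symmetric] sum_subtractf by simp
qed

definition transition_fail :: "'w set" where
  "transition_fail = (\<Union>i\<in>{1..K} \<times> {1..K} \<times> {1..H} \<times> S \<times> A \<times> Pow S. transition_tail i)"

text \<open>The bonus \<open>\<beta>\<^sup>P\<close> leaves no room for a union bound when \<open>|S| = 1\<close>, but then the transition noise
  vanishes.\<close>

lemma transition_fail_prob: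
  assumes K: "2 \<le> K"
  shows "transition_fail \<in> sets M" "prob transition_fail \<le> 2 * \<delta>"
proof -
  let ?I = "{1..K} \<times> {1..K} \<times> {1..H} \<times> S \<times> A \<times> Pow S"
  let ?y = "real (card S) * real (card A) * real H * real K"
  have L: "0 \<le> log_P" using log_P_ge[OF K] by simp
  have fin: "finite ?I" using finite_spaces by auto
  have tail: "transition_tail i \<in> sets M" "prob (transition_tail i) \<le> exp (- log_P) ^ card S" if "i \<in> ?I" for i
    using that transition_tail_prob[OF _ _ _ _ _ _ L] by auto
  show "transition_fail \<in> sets M" unfolding transition_fail_def by (rule prob_UN_le(1)[OF fin tail])
  have cS: "1 \<le> card S" using card_pos by simp
  show "prob transition_fail \<le> 2 * \<delta>"
  proof (cases "card S = 1")
    case True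
    then obtain s0 where S: "S = {s0}" by (rule card_1_singletonE)
    have "transition_tail i = {}" if "i \<in> ?I" for i
    proof -
      obtain k n h s a U where i: "i = (k, n, h, s, a, U)" by (metis prod_cases6)
      have U: "U = {} \<or> U = S" using that S unfolding i by auto
      have noise: "(\<Sum>\<tau>\<in>{1..k}. \<Sum>s'\<in>U. transition_noise \<tau> h s a s' \<omega>) = 0" if w: "\<omega> \<in> space M" for \<omega>
      proof (rule sum.neutral, rule ballI)
        fix \<tau> assume "\<tau> \<in> {1..k}"
        then show "(\<Sum>s'\<in>U. transition_noise \<tau> h s a s' \<omega>) = 0"
          using U sum_transition_noise_all[of \<tau> h s a \<omega>] w \<open>i \<in> ?I\<close> unfolding i by auto
      qed
      have t: "0 \<le> sqrt (2 * real (card S) * log_P * real n)" using L by simp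
      show ?thesis unfolding i
      proof (rule equals0I)
        fix \<omega> assume "\<omega> \<in> transition_tail (k, n, h, s, a, U)"
        then have "\<omega> \<in> space M"
          "sqrt (2 * real (card S) * log_P * real n) < (\<Sum>\<tau>\<in>{1..k}. \<Sum>s'\<in>U. transition_noise \<tau> h s a s' \<omega>)"
          unfolding transition_tail_def prod.case mem_Collect_eq by blast+
        then show False using noise t by simp
      qed
    qed
    then have "transition_fail = {}" unfolding transition_fail_def by blast
    then show ?thesis using confidence by simp
  next
    case False
    \<comment> \<open>Of the |S| >= 2 factors 2 \<delta> / \<open>?y\<close>, one cancels
      \<open>?y\<close> and one cancels K, by 2 K <= \<open>?y\<close>; the others are at most 1.
      The 2 in each factor stems from the number of subsets.\<close>
    then obtain m where m: "card S = Suc (Suc m)" using cS by (metis One_nat_def not0_implies_Suc not_one_le_zero)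
    have y: "2 * real K \<le> ?y" "2 \<le> ?y"
    proof -
      have "2 * real K \<le> real (card S) * real K" using m by (intro mult_right_mono) auto
      then show "2 * real K \<le> ?y" using size_bounds(2) by linarith
      then show "2 \<le> ?y" using card_pos by linarith
    qed
    have "prob transition_fail \<le> real (card ?I) * exp (- log_P) ^ card S"
      unfolding transition_fail_def by (rule prob_UN_le(2)[OF fin tail])
    also have "real (card ?I) = real K * ?y * 2 ^ card S"
      using finite_spaces by (simp add: card_cartesian_product card_Pow)
    also have "real K * ?y * 2 ^ card S * exp (- log_P) ^ card S = real K * ?y * (2 * \<delta> / ?y) ^ card S"
      unfolding exp_minus_log_P by (simp add: power_mult_distrib power_divide)
    also have "\<dots> = 2 * \<delta> * \<delta> * (2 * real K / ?y) * (2 * \<delta> / ?y) ^ m"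
    proof -
      have "real K * Y * ((2 * \<delta> / Y) * ((2 * \<delta> / Y) * p)) = 2 * \<delta> * \<delta> * (2 * real K / Y) * p"
        if "0 < Y" for Y p :: real
        using that by (simp add: field_simps)
      then show ?thesis unfolding m power_Suc using y(2) by simp
    qed
    also have "\<dots> \<le> 2 * \<delta> * 1 * 1 * 1"
    proof (intro mult_mono)
      have "2 * \<delta> \<le> ?y" using y(2) confidence by linarith
      then have "2 * \<delta> / ?y \<le> 1" using y(2) by (intro divide_le_eq_1_pos[THEN iffD2]) linarith+
      then show "(2 * \<delta> / ?y) ^ m \<le> 1" using confidence y(2) by (intro power_le_one) auto
      show "2 * real K / ?y \<le> 1" using y by (intro divide_le_eq_1_pos[THEN iffD2]) linarith+
    qed (use confidence in auto)
    finally show ?thesis by simp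
  qed
qed

lemma transition_accurateI:
  assumes K: "2 \<le> K" and w: "\<omega> \<in> space M" "\<omega> \<notin> transition_fail"
  shows "transition_accurate \<omega>"
  unfolding transition_accurate_def
proof (intro ballI allI impI)
  fix k h s a and W :: "'s \<Rightarrow> real"
  assume k: "k \<in> {1..K}" and x: "h \<in> {1..H}" "s \<in> S" "a \<in> A"
    and W: "\<forall>s'\<in>S. 0 \<le> W s' \<and> W s' \<le> real H"
  have L: "2 / 3 \<le> log_P" by (rule log_P_ge[OF K])
  define n where "n = count_sa \<omega> k h s a"
  define D where "D s' = (\<Sum>\<tau>\<in>{1..k}. transition_noise \<tau> h s a s' \<omega>)" for s'
  define T where "T s' = (\<Sum>\<tau>\<in>{1..k}. visit_sa \<tau> h s a \<omega> * of_bool (st \<tau> (Suc h) \<omega> = s'))" for s'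
  have n: "(\<Sum>\<tau>\<in>{1..k}. visit_sa \<tau> h s a \<omega>) = real n" by (simp add: n_def real_count_sa)
  have k1: "1 \<le> k" using k by auto
  have ph: "P_hat \<omega> k h s a s' = T s' / real (max n 1)" for s'
    using k1 by (simp add: P_hat_def T_def n_def of_bool_conj mult.assoc)
  have DT: "D s' = T s' - real n * P h s a s'" for s'
    unfolding D_def T_def n[symmetric] transition_noise_def sum_distrib_right sum_subtractf[symmetric]
    by (simp only: right_diff_distrib)
  show "\<bar>\<Sum>s'\<in>S. (P_hat \<omega> k h s a s' - P h s a s') * W s'\<bar> \<le> bonus_P \<omega> k h s a"
  proof (cases "n = 0")
    case True
    then have "\<forall>\<tau>\<in>{1..k}. visit_sa \<tau> h s a \<omega> = 0"
      using n sum_nonneg_eq_0_iff[of "{1..k}" "\<lambda>\<tau>. visit_sa \<tau> h s a \<omega>"] by simp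
    then have "T s' = 0" for s' unfolding T_def by (intro sum.neutral) auto
    then have "\<bar>\<Sum>s'\<in>S. (P_hat \<omega> k h s a s' - P h s a s') * W s'\<bar> = \<bar>\<Sum>s'\<in>S. P h s a s' * W s'\<bar>"
      by (simp add: ph sum_negf)
    \<comment> \<open>Without visits \<open>P_hat\<close> is 0 and the error is the full integral of
      \<open>W\<close>, at most H; the bonus covers it because 2 |S| \<open>log_P\<close> >=
      1.\<close>
    also have "\<dots> \<le> real H"
      using sum_ge_mult_simplex[OF transition[OF x], of 0 W] sum_le_mult_simplex[OF transition[OF x], of W "real H"] W by auto
    also have "\<dots> = sqrt ((real H)\<^sup>2 * 1)" by simp
    also have "\<dots> \<le> sqrt ((real H)\<^sup>2 * (2 * real (card S) * log_P))"
    proof (intro real_sqrt_le_mono mult_left_mono)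
      have "1 * (2 / 3) \<le> real (card S) * log_P" using card_pos(1) L by (intro mult_mono) auto
      then show "1 \<le> 2 * real (card S) * log_P" by simp
    qed simp
    finally show ?thesis using True by (simp add: bonus_P_eq[OF k1] n_def mult_ac)
  next
    case False
    then have n1: "n \<in> {1..K}" using count_le(2)[of \<omega> k h s a] k by (auto simp: n_def)
    have "sum D U \<le> sqrt (2 * real (card S) * log_P * real n)" if U: "U \<subseteq> S" for U
    proof -
      have "\<omega> \<notin> transition_tail (k, n, h, s, a, U)"
      proof
        assume "\<omega> \<in> transition_tail (k, n, h, s, a, U)"
        then have "\<omega> \<in> transition_fail" unfolding transition_fail_def
          by (rule UN_I[rotated]) (use k n1 x U in simp)
        with w(2) show False ..
      qed
      moreover have "sum D U = (\<Sum>\<tau>\<in>{1..k}. \<Sum>s'\<in>U. transition_noise \<tau> h s a s' \<omega>)"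
        unfolding D_def by (rule sum.swap)
      ultimately show ?thesis using w(1) unfolding transition_tail_def prod.case mem_Collect_eq n by simp
    qed
    moreover have "sum D S = 0"
    proof -
      have "sum D S = (\<Sum>\<tau>\<in>{1..k}. \<Sum>s'\<in>S. transition_noise \<tau> h s a s' \<omega>)"
        unfolding D_def by (rule sum.swap)
      also have "\<dots> = 0" using k by (intro sum.neutral ballI sum_transition_noise_all x w(1)) auto
      finally show ?thesis .
    qed
    ultimately have "\<bar>\<Sum>s'\<in>S. D s' * W s'\<bar> \<le> real H * sqrt (2 * real (card S) * log_P * real n)"
      using W finite_spaces by (intro abs_sum_weighted_le) auto
    also have "\<dots> = sqrt (2 * (real H)\<^sup>2 * real (card S) * log_P * real n)"
      by (simp add: real_sqrt_mult)
    finally have "\<bar>\<Sum>s'\<in>S. D s' * W s'\<bar> / real n \<le> sqrt (2 * (real H)\<^sup>2 * real (card S) * log_P * real n) / real n"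
      by (rule divide_right_mono) simp
    moreover have "\<bar>\<Sum>s'\<in>S. D s' * W s'\<bar> / real n = \<bar>\<Sum>s'\<in>S. (P_hat \<omega> k h s a s' - P h s a s') * W s'\<bar>"
    proof -
      have "(\<Sum>s'\<in>S. D s' * W s') / real n = (\<Sum>s'\<in>S. (P_hat \<omega> k h s a s' - P h s a s') * W s')"
        unfolding sum_divide_distrib using n1
        by (intro sum.cong refl) (simp add: DT ph max_absorb1 diff_divide_distrib left_diff_distrib)
      then show ?thesis by (metis abs_divide abs_of_nat)
    qed
    ultimately show ?thesis
      using n1 unfolding bonus_P_eq[OF k1] n_def[symmetric] by (simp add: sqrt_mult_divide_self max_absorb1)
  qed
qed

end

section \<open>Expected bonuses\<close>

context fictitious_play
begin

text \<open>Common scale of both bonuses: the joint count is at most the count of (s, a), so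
  \<open>bonus_P\<close> is dominated as well.\<close>

definition width :: "'w \<Rightarrow> nat \<Rightarrow> nat \<Rightarrow> 's \<Rightarrow> 'a \<Rightarrow> 'b \<Rightarrow> real" where
  "width \<omega> k h s a b = 1 / sqrt (real (max (count_sab \<omega> k h s a b) 1))"

lemma width_range: "0 \<le> width \<omega> k h s a b" "width \<omega> k h s a b \<le> 1"
  unfolding width_def by (auto intro!: divide_le_eq_1_pos[THEN iffD2])

lemma count_mono: "count_sab \<omega> (k - 1) h s a b \<le> count_sab \<omega> k h s a b" "count_sab \<omega> k h s a b \<le> count_sa \<omega> k h s a"
  unfolding count_sab_def count_sa_def by (auto intro!: card_mono)

text \<open>Two losses are accepted: the counts go back from k to k - 1, so that
  \<open>width\<close> is known before episode k, and sqrt z <= z for z >= 1 removes the roots of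
  the logarithms. The constant 6 is 4 from the reward bonus plus 2 from the transition
  bonus.\<close>

lemma bonus_le_width:
  assumes k: "k \<in> {1..K}" and L: "2 / 3 \<le> log_r"
  shows "bonus \<omega> k h s a b \<le> 6 * real H * real (card S) * log_r * width \<omega> (k - 1) h s a b"
proof -
  have k1: "1 \<le> k" using k by auto
  have le_sq: "sqrt z \<le> z" if "1 \<le> z" for z :: real
    using that by (intro real_le_lsqrt) (auto simp: power2_eq_square)
  let ?n = "real (max (count_sab \<omega> (k - 1) h s a b) 1)" and ?n' = "real (max (count_sab \<omega> k h s a b) 1)"
    and ?m = "real (max (count_sa \<omega> k h s a) 1)"
  have n: "1 \<le> ?n" "?n \<le> ?n'" "?n' \<le> ?m"
    using count_mono[of \<omega> k h s a b] by (auto simp: max_def)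
  have SL: "1 * (2 / 3) \<le> real (card S) * log_r" using card_pos(1) L by (intro mult_mono) auto
  have "bonus_r \<omega> k h s a b = sqrt (4 * log_r) * (1 / sqrt ?n')"
    by (simp add: bonus_r_eq[OF k1] real_sqrt_divide)
  also have "\<dots> \<le> (4 * log_r) * (1 / sqrt ?n)"
    using n L by (intro mult_mono le_sq divide_left_mono real_sqrt_le_mono) auto
  also have "4 * log_r \<le> 4 * real H * real (card S) * log_r"
  proof -
    have "1 * 1 \<le> real H * real (card S)" using card_pos by (intro mult_mono) auto
    then show ?thesis using L mult_right_mono[of 1 "real H * real (card S)" "4 * log_r"] by (simp add: mult_ac)
  qed
  finally have r: "bonus_r \<omega> k h s a b \<le> 4 * real H * real (card S) * log_r * width \<omega> (k - 1) h s a b"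
    unfolding width_def by (simp add: divide_right_mono)
  have "bonus_P \<omega> k h s a = real H * sqrt (2 * (real (card S) * log_P)) * (1 / sqrt ?m)"
    by (simp add: bonus_P_eq[OF k1] real_sqrt_divide real_sqrt_mult)
  also have "\<dots> \<le> real H * sqrt (2 * (real (card S) * log_r)) * (1 / sqrt ?n)"
    using n log_P_le_log_r L
    by (intro mult_mono mult_left_mono divide_left_mono real_sqrt_le_mono mult_nonneg_nonneg) auto
  also have "\<dots> \<le> real H * (2 * (real (card S) * log_r)) * (1 / sqrt ?n)"
    using SL by (intro mult_right_mono mult_left_mono le_sq) auto
  finally have "bonus_P \<omega> k h s a \<le> 2 * real H * real (card S) * log_r * width \<omega> (k - 1) h s a b"
    unfolding width_def by (simp add: mult_ac)
  with r show ?thesis unfolding bonus_def by (simp add: algebra_simps)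
qed

text \<open>A visit raises the count by one, and 1 / sqrt m is compared with the increment of 3 sqrt
  from m to m + 1. The 3 instead of the usual 2 is due to the lag: the width uses the count before
  the visit, and sqrt (m + 1) <= 2 sqrt m for m >= 1.\<close>

lemma sum_width_le:
  "(\<Sum>k\<in>{1..n}. visit k h s a b \<omega> * width \<omega> (k - 1) h s a b)
    \<le> 3 * sqrt (real (count_sab \<omega> n h s a b))"
proof (induction n)
  case (Suc n)
  let ?v = "visit (Suc n) h s a b \<omega>"
  let ?c = "real (count_sab \<omega> n h s a b)"
  have c: "real (count_sab \<omega> (Suc n) h s a b) = ?c + ?v" by (simp add: real_count_sab)
  have "1 / sqrt (real (max m 1)) \<le> 3 * sqrt (real m + 1) - 3 * sqrt (real m)" for m :: nat
  proof (cases "m = 0")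
    case False
    then have m: "0 < sqrt (real m)" by simp
    have "sqrt (real m + 1) \<le> sqrt (4 * real m)" using False by (intro real_sqrt_le_mono) simp
    then have le: "sqrt (real m + 1) + sqrt (real m) \<le> 3 * sqrt (real m)" by (simp add: real_sqrt_mult)
    have pos: "0 < sqrt (real m + 1) + sqrt (real m)" using m by (simp add: add_pos_pos)
    have "(sqrt (real m + 1) - sqrt (real m)) * (sqrt (real m + 1) + sqrt (real m)) = 1"
      by (simp add: algebra_simps)
    then have "3 * sqrt (real m + 1) - 3 * sqrt (real m) = 3 / (sqrt (real m + 1) + sqrt (real m))"
      using pos by (simp add: eq_divide_eq algebra_simps)
    also have "\<dots> \<ge> 3 / (3 * sqrt (real m))"
      using le pos m by (intro divide_left_mono mult_pos_pos) auto
    finally show ?thesis using False by (simp add: max_absorb1)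
  qed simp
  then have "?v * width \<omega> n h s a b \<le> 3 * sqrt (?c + ?v) - 3 * sqrt ?c"
    by (auto simp: of_bool_def width_def)
  then show ?case using Suc by (simp add: c)
qed simp

end

section \<open>From expected to realised widths\<close>

context fictitious_play_run
begin

text \<open>Expected minus realised width of one episode, a martingale difference over the episodes.
  Summing over all entries first leaves a single deviation event, with differences bounded by H
  irrespective of the number of triples.\<close>

definition excess :: "nat \<Rightarrow> 'w \<Rightarrow> real" where
  "excess k \<omega> = (\<Sum>h\<in>{1..H}. \<Sum>s\<in>S. \<Sum>a\<in>A. \<Sum>b\<in>B. width \<omega> (k - 1) h s a b *
     (rate k h s a b \<omega> - visit k h s a b \<omega>))"

lemma excess_eq:
  "excess k \<omega> = occ (pol1 \<omega> k) (pol2 \<omega> k) (width \<omega> (k - 1)) -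
    (\<Sum>h\<in>{1..H}. \<Sum>s\<in>S. \<Sum>a\<in>A. \<Sum>b\<in>B. visit k h s a b \<omega> * width \<omega> (k - 1) h s a b)"
  unfolding excess_def occ_def sum_distrib_left sum_subtractf[symmetric]
  by (intro sum.cong refl) (simp only: right_diff_distrib mult_ac)

lemma width_meas:
  assumes "observed N k" "h \<in> {1..H}" "s \<in> S" "a \<in> A" "b \<in> B"
  shows "(\<lambda>\<omega>. width \<omega> k h s a b) \<in> borel_measurable N"
  unfolding width_def of_nat_max
  by (intro borel_measurable_divide borel_measurable_const measurable_compose[OF _ borel_measurable_sqrt]
      borel_measurable_max count_meas(2)[OF assms(1-4)] assms(5))

lemma excess_meas:
  assumes k: "k \<in> {1..K}" and sub: "subalgebra N (F k (Suc H))"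
  shows "excess k \<in> borel_measurable N"
proof -
  have sub1: "subalgebra N (F k 1)"
    by (rule subalgebra_trans[OF sub F_mono[OF k]]) auto
  show ?thesis unfolding excess_def[abs_def]
  proof (intro borel_measurable_sum borel_measurable_times borel_measurable_diff)
    fix h s a b assume x: "h \<in> {1..H}" "s \<in> S" "a \<in> A" "b \<in> B"
    show "(\<lambda>\<omega>. width \<omega> (k - 1) h s a b) \<in> borel_measurable N"
      by (rule measurable_from_subalg[OF sub1 width_meas[OF observed_F[OF k] x]])
    note m = measurable_from_subalg[OF sub1]
    show "(\<lambda>\<omega>. reach (pol1 \<omega> k) P h s) \<in> borel_measurable N"
      using x by (intro m reach_P_meas_F k) auto
    show "(\<lambda>\<omega>. pol1 \<omega> k h s a) \<in> borel_measurable N" "(\<lambda>\<omega>. pol2 \<omega> k h s b) \<in> borel_measurable N"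
      by (intro m policy_measD[OF pol_meas_F(1)[OF k]] policy_measD[OF pol_meas_F(2)[OF k]] x)+
    show "visit k h s a b \<in> borel_measurable N"
      by (rule step_meas(3)[OF k x(1) subalgebra_trans[OF sub F_end_G[OF k x(1)]]])
  qed
qed

lemma sum_visit:
  assumes "k \<in> {1..K}" "h \<in> {1..H}" "\<omega> \<in> space M"
  shows "(\<Sum>s\<in>S. \<Sum>a\<in>A. \<Sum>b\<in>B. visit k h s a b \<omega>) = 1"
  using st_in_S[OF assms(1) _ assms(3), of h] act_in[OF assms] assms(2) finite_spaces
  unfolding of_bool_conj sum_distrib_left[symmetric] by (simp add: of_bool_def)

lemma excess_bound:
  assumes k: "k \<in> {1..K}" and w: "\<omega> \<in> space M"
  shows "\<bar>excess k \<omega>\<bar> \<le> real H"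
proof -
  have "occ (pol1 \<omega> k) (pol2 \<omega> k) (\<lambda>h s a b. 0) \<le> occ (pol1 \<omega> k) (pol2 \<omega> k) (width \<omega> (k - 1))"
    "occ (pol1 \<omega> k) (pol2 \<omega> k) (width \<omega> (k - 1)) \<le> occ (pol1 \<omega> k) (pol2 \<omega> k) (\<lambda>h s a b. 1)"
    using width_range by (auto intro!: occ_mono pol_policies)
  moreover have "occ (pol1 \<omega> k) (pol2 \<omega> k) (\<lambda>h s a b. 1) \<le> real H"
  proof -
    have "(\<Sum>s\<in>S. reach (pol1 \<omega> k) P h s * (\<Sum>a\<in>A. pol1 \<omega> k h s a * 1)) \<le> 1" if "h \<in> {1..H}" for h
      using sum_reach_le_1[OF pol_policies(1) substochastic_P, of h] that prob_simplexD(2)[OF conjunct2[OF pol_simplex(1)]]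
      by simp
    then have "(\<Sum>h\<in>{1..H}. \<Sum>s\<in>S. reach (pol1 \<omega> k) P h s * (\<Sum>a\<in>A. pol1 \<omega> k h s a * 1)) \<le> (\<Sum>h\<in>{1..H}. 1)"
      by (rule sum_mono)
    then show ?thesis unfolding occ_state_action[OF pol_policies(2)] by simp
  qed
  moreover have "occ (pol1 \<omega> k) (pol2 \<omega> k) (\<lambda>h s a b. 0) = 0" by (simp add: occ_def)
  moreover have "0 \<le> (\<Sum>h\<in>{1..H}. \<Sum>s\<in>S. \<Sum>a\<in>A. \<Sum>b\<in>B. visit k h s a b \<omega> * width \<omega> (k - 1) h s a b)"
    using width_range by (intro sum_nonneg mult_nonneg_nonneg) auto
  moreover have "(\<Sum>h\<in>{1..H}. \<Sum>s\<in>S. \<Sum>a\<in>A. \<Sum>b\<in>B. visit k h s a b \<omega> * width \<omega> (k - 1) h s a b) \<le>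
      (\<Sum>h\<in>{1..H}. \<Sum>s\<in>S. \<Sum>a\<in>A. \<Sum>b\<in>B. visit k h s a b \<omega>)"
    using width_range by (intro sum_mono mult_left_le) auto
  moreover have "(\<Sum>h\<in>{1..H}. \<Sum>s\<in>S. \<Sum>a\<in>A. \<Sum>b\<in>B. visit k h s a b \<omega>) = (\<Sum>h\<in>{1..H}. 1)"
    by (intro sum.cong refl sum_visit k w)
  ultimately show ?thesis unfolding excess_eq abs_le_iff by simp
qed

text \<open>The width after k - 1 episodes is known at the start of episode k, so it joins
  \<open>Z\<close> as a bounded factor in \<open>visit_prob\<close>.\<close>

lemma excess_orth:
  assumes k: "k \<in> {1..K}"
    and Z: "Z \<in> borel_measurable (F k 1)" "\<And>\<omega>. \<omega> \<in> space M \<Longrightarrow> \<bar>Z \<omega>\<bar> \<le> c"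
  shows "expectation (\<lambda>\<omega>. Z \<omega> * excess k \<omega>) = 0"
proof -
  let ?p = "\<lambda>h s a b \<omega>. rate k h s a b \<omega>"
  let ?Y = "\<lambda>h s a b \<omega>. Z \<omega> * width \<omega> (k - 1) h s a b"
  have sub: "subalgebra M (F k 1)" by (rule F_sub[OF k]) auto
  have *: "integrable M (\<lambda>\<omega>. ?Y h s a b \<omega> * ?p h s a b \<omega> - ?Y h s a b \<omega> * visit k h s a b \<omega>)"
    "expectation (\<lambda>\<omega>. ?Y h s a b \<omega> * ?p h s a b \<omega> - ?Y h s a b \<omega> * visit k h s a b \<omega>) = 0"
    if x: "h \<in> {1..H}" "s \<in> S" "a \<in> A" "b \<in> B" for h s a b
  proof -
    have YF: "?Y h s a b \<in> borel_measurable (F k 1)"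
      by (rule borel_measurable_times[OF Z(1) width_meas[OF observed_F[OF k] x]])
    have Yb: "\<bar>?Y h s a b \<omega>\<bar> \<le> c" if "\<omega> \<in> space M" for \<omega>
      using width_range[of \<omega> "k - 1" h s a b] by (intro abs_mult_le_left[OF Z(2)[OF that]]) auto
    have YM: "?Y h s a b \<in> borel_measurable M" by (rule measurable_from_subalg[OF sub YF])
    have pM: "?p h s a b \<in> borel_measurable M" by (rule measurable_from_subalg[OF sub rate_meas[OF k x]])
    have vM: "visit k h s a b \<in> borel_measurable M" by (rule step_meas(3)[OF k x(1) G_sub[OF k x(1)]])
    have i1: "integrable M (\<lambda>\<omega>. ?Y h s a b \<omega> * ?p h s a b \<omega>)"
      by (rule integrable_mult_bounded[OF YM Yb pM rate_range[OF x]])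
    have i2: "integrable M (\<lambda>\<omega>. ?Y h s a b \<omega> * visit k h s a b \<omega>)"
      by (rule integrable_mult_bounded[OF YM Yb vM]) auto
    show "integrable M (\<lambda>\<omega>. ?Y h s a b \<omega> * ?p h s a b \<omega> - ?Y h s a b \<omega> * visit k h s a b \<omega>)"
      by (rule Bochner_Integration.integrable_diff[OF i1 i2])
    show "expectation (\<lambda>\<omega>. ?Y h s a b \<omega> * ?p h s a b \<omega> - ?Y h s a b \<omega> * visit k h s a b \<omega>) = 0"
      unfolding Bochner_Integration.integral_diff[OF i1 i2] using visit_prob[OF k x YF Yb] by simp
  qed
  have "expectation (\<lambda>\<omega>. Z \<omega> * excess k \<omega>) = expectation (\<lambda>\<omega>. \<Sum>h\<in>{1..H}. \<Sum>s\<in>S. \<Sum>a\<in>A. \<Sum>b\<in>B.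
      ?Y h s a b \<omega> * ?p h s a b \<omega> - ?Y h s a b \<omega> * visit k h s a b \<omega>)"
    unfolding excess_def sum_distrib_left by (simp only: right_diff_distrib mult.assoc)
  also have "\<dots> = (\<Sum>h\<in>{1..H}. \<Sum>s\<in>S. \<Sum>a\<in>A. \<Sum>b\<in>B. 0)"
    using * by (simp add: integrable_sum)
  finally show ?thesis by simp
qed

text \<open>The event of \<open>martingale_tail\<close> for the differences divided by H, with
  \<open>v = 1\<close> and \<open>m = K\<close>. One side suffices, since the expected widths are
  only to be bounded above.\<close>

definition excess_fail :: "'w set" where
  "excess_fail = {\<omega> \<in> space M. sqrt (2 * real K * log_r) < (\<Sum>k\<in>{1..K}. excess k \<omega> / real H) \<and> (\<Sum>k\<in>{1..K}. 1) = real K}"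

lemma excess_fail_prob:
  assumes "0 \<le> log_r"
  shows "excess_fail \<in> sets M" "prob excess_fail \<le> \<delta>"
proof -
  let ?X = "\<lambda>k \<omega>. excess k \<omega> / real H"
  have past: "?X j \<in> borel_measurable (F k 1)" "(\<lambda>_. 1) \<in> borel_measurable (F k 1)"
    if "k \<in> {1..K}" "j \<in> {1..<k}" for k j
  proof -
    have j: "j \<in> {1..K}" "subalgebra (F k 1) (F j (Suc H))" using that F_past[of j k] by auto
    show "?X j \<in> borel_measurable (F k 1)" by (intro borel_measurable_divide borel_measurable_const excess_meas j)
  qed simp
  have meas: "?X k \<in> borel_measurable M" "(\<lambda>_. 1) \<in> borel_measurable M" if "k \<in> {1..K}" for k
    using that by (auto intro!: borel_measurable_divide excess_meas F_end_sub)
  have bound: "\<bar>?X k \<omega>\<bar> \<le> 1 \<and> 1 \<in> {0, 1}" if "k \<in> {1..K}" "\<omega> \<in> space M" for k \<omega>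
    using excess_bound[OF that] card_pos by (simp add: abs_divide divide_le_eq_1)
  have orth: "expectation (\<lambda>\<omega>. Z \<omega> * ?X k \<omega>) = 0"
    if "k \<in> {1..K}" "Z \<in> borel_measurable (F k 1)" "\<And>\<omega>. \<omega> \<in> space M \<Longrightarrow> \<bar>Z \<omega>\<bar> \<le> d" for k Z d
    using excess_orth[OF that] by simp
  let ?t = "sqrt (2 * real K * log_r)"
  have t: "0 \<le> ?t" "0 < real K" using assms card_pos by auto
  have ex: "- ?t\<^sup>2 / (2 * real K) = - log_r" using assms card_pos by simp
  note mt = martingale_tail[where \<F> = "\<lambda>k. F k 1" and X = ?X and v = "\<lambda>_ _. 1" and n = K and t = ?t and m = "real K",
      OF past meas bound orth t]
  show "excess_fail \<in> sets M" unfolding excess_fail_def by (rule mt(1))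
  have "prob excess_fail \<le> exp (- ?t\<^sup>2 / (2 * real K))" unfolding excess_fail_def by (rule mt(2))
  also have "\<dots> = exp (- log_r)" by (simp only: ex)
  also have "\<dots> \<le> \<delta> / 1"
  proof -
    have "1 \<le> real (card S) * real (card A) * real (card B) * real H * real K"
      using size_bounds card_pos(5) by linarith
    then show ?thesis unfolding exp_minus_log_r using confidence by (intro divide_left_mono) auto
  qed
  finally show "prob excess_fail \<le> \<delta>" by simp
qed

text \<open>Expected widths are realised widths plus \<open>excess\<close>; the realised ones sum to
  at most 3 sqrt K for each of the H |S| |A| |B| entries.\<close>

lemma bonus_sum_le:
  assumes L: "2 / 3 \<le> log_r" and w: "\<omega> \<in> space M" "\<omega> \<notin> excess_fail"
  shows "bonus_sum \<omega> \<le> 6 * real H * real (card S) * log_r *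
    (real H * sqrt (2 * real K * log_r) + 3 * (real H * real (card S) * real (card A) * real (card B)) * sqrt (real K))"
proof -
  let ?occ = "\<lambda>k. occ (pol1 \<omega> k) (pol2 \<omega> k) (width \<omega> (k - 1))"
  have "(\<Sum>k\<in>{1..K}. excess k \<omega>) / real H \<le> sqrt (2 * real K * log_r)"
    using w unfolding excess_fail_def by (simp add: sum_divide_distrib not_less)
  then have ex: "(\<Sum>k\<in>{1..K}. excess k \<omega>) \<le> real H * sqrt (2 * real K * log_r)"
    using card_pos by (simp add: divide_le_eq mult.commute)
  have "(\<Sum>k\<in>{1..K}. \<Sum>h\<in>{1..H}. \<Sum>s\<in>S. \<Sum>a\<in>A. \<Sum>b\<in>B. visit k h s a b \<omega> * width \<omega> (k - 1) h s a b) =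
      (\<Sum>h\<in>{1..H}. \<Sum>s\<in>S. \<Sum>a\<in>A. \<Sum>b\<in>B. \<Sum>k\<in>{1..K}. visit k h s a b \<omega> * width \<omega> (k - 1) h s a b)"
    by (subst sum.swap, rule sum.cong[OF refl], subst sum.swap, rule sum.cong[OF refl], subst sum.swap,
        rule sum.cong[OF refl], rule sum.swap)
  also have "\<dots> \<le> (\<Sum>h\<in>{1..H}. \<Sum>s\<in>S. \<Sum>a\<in>A. \<Sum>b\<in>B. 3 * sqrt (real K))"
  proof (intro sum_mono order_trans[OF sum_width_le])
    fix h s a b
    show "3 * sqrt (real (count_sab \<omega> K h s a b)) \<le> 3 * sqrt (real K)"
      using count_le(1)[of \<omega> K h s a b] by simp
  qed
  also have "\<dots> = 3 * (real H * real (card S) * real (card A) * real (card B)) * sqrt (real K)" by simp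
  finally have occ: "(\<Sum>k\<in>{1..K}. ?occ k) \<le>
      real H * sqrt (2 * real K * log_r) + 3 * (real H * real (card S) * real (card A) * real (card B)) * sqrt (real K)"
    using ex unfolding excess_eq sum_subtractf by linarith
  have "bonus_sum \<omega> \<le> (\<Sum>k\<in>{1..K}. 6 * real H * real (card S) * log_r * ?occ k)"
    unfolding bonus_sum_def occ_cmult[symmetric]
    by (intro sum_mono occ_mono pol_policies bonus_le_width L)
  also have "\<dots> = 6 * real H * real (card S) * log_r * (\<Sum>k\<in>{1..K}. ?occ k)"
    by (simp add: sum_distrib_left)
  also have "\<dots> \<le> 6 * real H * real (card S) * log_r *
      (real H * sqrt (2 * real K * log_r) + 3 * (real H * real (card S) * real (card A) * real (card B)) * sqrt (real K))"
    using occ L by (intro mult_left_mono) auto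
  finally show ?thesis .
qed

end

section \<open>The gap\<close>

context fictitious_play
begin

abbreviation size_factor :: real where
  "size_factor \<equiv> real (card S) * real (card A) * real (card B) * real H"

lemma size_factor_ge: "1 \<le> size_factor" "real H \<le> size_factor" "real (card S) \<le> size_factor"
proof -
  have "card S \<ge> 1" "card A \<ge> 1" "card B \<ge> 1" "H \<ge> 1" using card_pos by (simp_all add: Suc_le_eq)
  then have "1 \<le> card S * card A * card B * H" "H \<le> card S * card A * card B * H" "card S \<le> card S * card A * card B * H"
    by (simp_all add: Suc_le_eq)
  then have "real 1 \<le> real (card S * card A * card B * H)" "real H \<le> real (card S * card A * card B * H)"
    "real (card S) \<le> real (card S * card A * card B * H)"
    by (simp_all only: of_nat_le_iff)
  then show "1 \<le> size_factor" "real H \<le> size_factor" "real (card S) \<le> size_factor"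
    by (simp_all only: of_nat_mult of_nat_1)
qed

lemma log_card_le: "ln (real (card A)) \<le> log_r" "ln (real (card B)) \<le> log_r"
proof -
  have "card S \<ge> 1" "card A \<ge> 1" "card B \<ge> 1" "H \<ge> 1" "K \<ge> 1" using card_pos by (simp_all add: Suc_le_eq)
  then have "card A \<le> card S * card A * card B * H * K" "card B \<le> card S * card A * card B * H * K"
    by (simp_all add: Suc_le_eq)
  then have le: "real (card A) \<le> size_factor * real K" "real (card B) \<le> size_factor * real K"
    unfolding of_nat_mult[symmetric] by (simp_all only: of_nat_le_iff)
  have "size_factor * real K \<le> size_factor * real K / \<delta>"
    using confidence card_pos by (simp add: pos_le_divide_eq mult_le_cancel_left1 mult_left_le)
  with le have "real (card A) \<le> size_factor * real K / \<delta>" "real (card B) \<le> size_factor * real K / \<delta>" by linarith+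
  then show "ln (real (card A)) \<le> log_r" "ln (real (card B)) \<le> log_r"
    unfolding log_r_def using card_pos by (intro ln_mono; linarith)+
qed

text \<open>The three terms of the gap bound contribute 9, 9 and 252, in total 270 <= 300. The power
  4 collects H, H, |S| and one full size product from the bonuses; the square of the logarithm is
  \<open>log_r\<close> times the bound of sqrt (2 \<open>log_r\<close>) by 2
  \<open>log_r\<close>.\<close>

lemma Gap_le_rate:
  assumes L: "2 / 3 \<le> log_r" and good: "reward_accurate \<omega>" "transition_accurate \<omega>"
    and bonus: "bonus_sum \<omega> \<le> 6 * real H * real (card S) * log_r *
      (real H * sqrt (2 * real K * log_r) + 3 * (real H * real (card S) * real (card A) * real (card B)) * sqrt (real K))"
  shows "Gap \<omega> \<le> 300 * size_factor ^ 4 * log_r ^ 2 * sqrt (real (K * H))"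
proof -
  let ?D = size_factor and ?L = log_r and ?s = "sqrt (real K)" and ?H = "real H" and ?S = "real (card S)"
  have s: "1 \<le> ?s" using card_pos by simp
  have D: "1 \<le> ?D" "?H \<le> ?D" "?S \<le> ?D" by (rule size_factor_ge)+
  have LL: "?L * (2 / 3) \<le> ?L * ?L" "(2 / 3) * (2 / 3) \<le> ?L * ?L" using L by (intro mult_mono; simp)+
  then have L2: "1 + 4 * ?L \<le> 9 * ?L\<^sup>2" "2 * ?L\<^sup>2 + 3 * ?L \<le> 7 * ?L\<^sup>2"
    unfolding power2_eq_square by linarith+
  have hedge: "1 + 2 * sqrt (real K * y) \<le> 9 * ?L\<^sup>2 * ?s" if "y \<le> ?L" for y
  proof -
    have "y \<le> (2 * ?L)\<^sup>2" unfolding power2_eq_square using that LL L by linarith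
    then have "sqrt y \<le> 2 * ?L" using L by (intro real_le_lsqrt) auto
    then have "?s * sqrt y \<le> ?s * (2 * ?L)" by (intro mult_left_mono) auto
    then have "1 + 2 * sqrt (real K * y) \<le> 1 * ?s + 4 * ?L * ?s"
      using s unfolding real_sqrt_mult by (simp only: mult_ac)
    also have "\<dots> = (1 + 4 * ?L) * ?s" by (simp add: algebra_simps)
    also have "\<dots> \<le> 9 * ?L\<^sup>2 * ?s" using L2 s by (intro mult_right_mono) auto
    finally show ?thesis .
  qed
  have HS0: "0 \<le> ?H" "0 \<le> ?S" by auto
  have Ls0: "0 \<le> ?L\<^sup>2 * ?s" using s by simp
  have D4: "?H * ?H \<le> ?D ^ 4" "?H * ?S * ?S \<le> ?D ^ 4" "?H * ?H * ?S * ?D \<le> ?D ^ 4"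
  proof -
    have "?H * ?H * 1 * 1 \<le> ?D * ?D * ?D * ?D" "?H * ?S * ?S * 1 \<le> ?D * ?D * ?D * ?D"
      "?H * ?H * ?S * ?D \<le> ?D * ?D * ?D * ?D"
      using D HS0 by (intro mult_mono mult_nonneg_nonneg; linarith)+
    then show "?H * ?H \<le> ?D ^ 4" "?H * ?S * ?S \<le> ?D ^ 4" "?H * ?H * ?S * ?D \<le> ?D ^ 4"
      by (simp_all add: eval_nat_numeral mult.assoc)
  qed
  have "?H * (?H + 2 * ?H * sqrt (real K * ln (real (card A)))) = ?H * ?H * (1 + 2 * sqrt (real K * ln (real (card A))))"
    by (simp add: algebra_simps)
  also have "\<dots> \<le> ?D ^ 4 * (9 * ?L\<^sup>2 * ?s)"
    using D4(1) hedge[OF log_card_le(1)] D card_pos by (intro mult_mono) auto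
  finally have 1: "?H * (?H + 2 * ?H * sqrt (real K * ln (real (card A)))) \<le> 9 * (?D ^ 4 * (?L\<^sup>2 * ?s))" by (simp add: mult_ac)
  have "?H * ?S * (1 + 2 * ?S * sqrt (real K * ln (real (card B)))) \<le> ?H * ?S * (?S * (1 + 2 * sqrt (real K * ln (real (card B)))))"
    using card_pos by (intro mult_left_mono) (auto simp: algebra_simps)
  also have "\<dots> = ?H * ?S * ?S * (1 + 2 * sqrt (real K * ln (real (card B))))" by simp
  also have "\<dots> \<le> ?D ^ 4 * (9 * ?L\<^sup>2 * ?s)"
    using D4(2) hedge[OF log_card_le(2)] D card_pos by (intro mult_mono) auto
  finally have 2: "?H * ?S * (1 + 2 * ?S * sqrt (real K * ln (real (card B)))) \<le> 9 * (?D ^ 4 * (?L\<^sup>2 * ?s))" by (simp add: mult_ac)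
  have sq: "sqrt (2 * real K * ?L) \<le> 2 * ?L * ?s"
  proof -
    have "sqrt (2 * ?L) \<le> 2 * ?L" using L by (intro real_le_lsqrt) (auto simp: power2_eq_square)
    then have "?s * sqrt (2 * ?L) \<le> ?s * (2 * ?L)" by (intro mult_left_mono) auto
    moreover have "sqrt (2 * real K * ?L) = ?s * sqrt (2 * ?L)" by (simp add: real_sqrt_mult)
    ultimately show ?thesis by (simp add: mult_ac)
  qed
  have "(4 + 2 * ?H) * bonus_sum \<omega> \<le> (6 * ?H) * (6 * ?H * ?S * ?L * (?D * (2 * ?L * ?s) + 3 * ?D * ?s))"
  proof -
    have "bonus_sum \<omega> \<le> 6 * ?H * ?S * ?L * (?D * (2 * ?L * ?s) + 3 * ?D * ?s)"
    proof (rule order_trans[OF bonus], intro mult_left_mono add_mono)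
      show "?H * sqrt (2 * real K * ?L) \<le> ?D * (2 * ?L * ?s)" using D(2) sq L by (intro mult_mono) auto
      show "3 * (?H * ?S * real (card A) * real (card B)) * ?s \<le> 3 * ?D * ?s" by (simp add: mult_ac)
    qed (use L in auto)
    then have "(4 + 2 * ?H) * bonus_sum \<omega> \<le> (4 + 2 * ?H) * (6 * ?H * ?S * ?L * (?D * (2 * ?L * ?s) + 3 * ?D * ?s))"
      by (intro mult_left_mono) auto
    also have "\<dots> \<le> (6 * ?H) * (6 * ?H * ?S * ?L * (?D * (2 * ?L * ?s) + 3 * ?D * ?s))"
      using card_pos L D s by (intro mult_right_mono mult_nonneg_nonneg add_nonneg_nonneg) auto
    finally show ?thesis .
  qed
  also have "\<dots> = 36 * (?H * ?H * ?S * ?D * ((2 * ?L\<^sup>2 + 3 * ?L) * ?s))"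
    by (simp add: algebra_simps power2_eq_square)
  also have "\<dots> \<le> 36 * (?D ^ 4 * (7 * ?L\<^sup>2 * ?s))"
    using D4(3) L2(2) L s D by (intro mult_left_mono[of _ _ 36] mult_mono) auto
  finally have 3: "(4 + 2 * ?H) * bonus_sum \<omega> \<le> 252 * (?D ^ 4 * (?L\<^sup>2 * ?s))" by (simp add: mult_ac)
  have "Gap \<omega> \<le> 270 * (?D ^ 4 * (?L\<^sup>2 * ?s))"
    using Gap_le_bonus_sum[OF good] 1 2 3 by linarith
  also have "\<dots> \<le> 300 * (?D ^ 4 * (?L\<^sup>2 * sqrt (real (K * H))))"
    using D s card_pos(4) by (intro mult_mono mult_left_mono real_sqrt_le_mono) auto
  finally show ?thesis by (simp add: mult_ac)
qed

lemma Gap_le_horizon: "Gap \<omega> \<le> 2 * real K * real H"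
proof -
  have V: "0 \<le> V \<mu> \<nu> 1 s1" "V \<mu> \<nu> 1 s1 \<le> real H" if "\<mu> \<in> policies H S A" "\<nu> \<in> policies H S B" for \<mu> \<nu>
    using V_range[OF that, of 1 s1] initial_state by auto
  have "V (best1 \<omega>) (pol2 \<omega> k) 1 s1 - V (pol1 \<omega> k) (pol2 \<omega> k) 1 s1 \<le> real H"
    "V (pol1 \<omega> k) (pol2 \<omega> k) 1 s1 - V (pol1 \<omega> k) (best2 \<omega>) 1 s1 \<le> real H" for k
    using V(2)[OF best1_optimal(1) pol_policies(2), of \<omega> \<omega> k] V[OF pol_policies, of \<omega> k \<omega> k]
      V(1)[OF pol_policies(1) best2_optimal(1), of \<omega> k \<omega>] by linarith+
  then have "Regret1 \<omega> \<le> (\<Sum>k\<in>{1..K}. real H)" "Regret2 \<omega> \<le> (\<Sum>k\<in>{1..K}. real H)"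
    unfolding Regret1_def Regret2_def by (intro sum_mono; blast)+
  then show ?thesis unfolding Gap_def by simp
qed

lemma Gap_eq_0:
  assumes "card A = 1" "card B = 1"
  shows "Gap \<omega> = 0"
proof -
  have eq: "p x = p' x" if "card X = 1" "p \<in> prob_simplex X" "p' \<in> prob_simplex X" "x \<in> X" for p p' :: "'x \<Rightarrow> real" and X x
    using that by (auto simp: prob_simplex_def card_1_singleton_iff)
  have "V (best1 \<omega>) (pol2 \<omega> k) 1 s1 = V (pol1 \<omega> k) (pol2 \<omega> k) 1 s1" for k
    by (intro V_cong eq[OF assms(1)] policiesD[OF best1_optimal(1)] policiesD[OF pol_policies(1)] refl)
  moreover have "V (pol1 \<omega> k) (best2 \<omega>) 1 s1 = V (pol1 \<omega> k) (pol2 \<omega> k) 1 s1" for k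
    by (intro V_cong eq[OF assms(2)] policiesD[OF best2_optimal(1)] policiesD[OF pol_policies(2)] refl)
  ultimately show ?thesis by (simp add: Gap_def Regret1_def Regret2_def)
qed

text \<open>If all sizes are 1, \<open>log_r\<close> is ln (1 / \<delta>), which can be arbitrarily
  close to 0, so the bound 2 H does not suffice there and the gap has to vanish. As soon as a player
  has two actions, \<open>log_r\<close> is at least 2/3.\<close>

lemma Gap_le_rate_single_episode:
  assumes "K = 1"
  shows "Gap \<omega> \<le> 300 * size_factor ^ 4 * log_r ^ 2 * sqrt (real (K * H))"
proof (cases "card A = 1 \<and> card B = 1")
  case True
  then show ?thesis using size_factor_ge by (simp add: Gap_eq_0)
next
  case False
  then have "2 \<le> card A * card B"
    using card_pos by (cases "card A"; cases "card B") auto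
  moreover have "card A * card B \<le> card S * card A * card B * H * K"
    using card_pos by (simp add: Suc_le_eq)
  ultimately have "2 \<le> card S * card A * card B * H * K" by linarith
  then have "real 2 \<le> real (card S * card A * card B * H * K)" by (simp only: of_nat_le_iff)
  then have "2 \<le> size_factor * real K" by (simp only: of_nat_mult of_nat_numeral)
  then have L: "2 / 3 \<le> log_r" unfolding log_r_def by (rule log_ge)
  then have L2: "(2 / 3)\<^sup>2 \<le> log_r\<^sup>2" by (intro power_mono) auto
  have "size_factor ^ 1 \<le> size_factor ^ 4" using size_factor_ge(1) by (intro power_increasing) auto
  then have D: "real H \<le> size_factor ^ 4" using size_factor_ge(2) unfolding power_one_right by linarith
  have "Gap \<omega> \<le> 2 * real H" using Gap_le_horizon[of \<omega>] assms by simp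
  also have "\<dots> \<le> 300 * real H * (2 / 3)\<^sup>2 * 1" by (simp add: power2_eq_square)
  also have "\<dots> \<le> 300 * size_factor ^ 4 * log_r ^ 2 * sqrt (real (K * H))"
    using D size_factor_ge L2 card_pos assms by (intro mult_mono mult_left_mono[of _ _ 300]) auto
  finally show ?thesis .
qed

end

context fictitious_play_run
begin

lemma Gap_rate_prob:
  "1 - 5 * \<delta> \<le> prob {\<omega> \<in> space M. Gap \<omega> \<le> 300 * size_factor ^ 4 * log_r ^ 2 * sqrt (real (K * H))}"
proof (cases "K = 1")
  case True
  then have "{\<omega> \<in> space M. Gap \<omega> \<le> 300 * size_factor ^ 4 * log_r ^ 2 * sqrt (real (K * H))} = space M"
    using Gap_le_rate_single_episode by blast
  then show ?thesis using confidence by (simp add: prob_space)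
next
  case False
  then have K: "2 \<le> K" using episodes_pos by simp
  have L: "2 / 3 \<le> log_r" using log_P_ge[OF K] log_P_le_log_r by linarith
  let ?c = "300 * size_factor ^ 4 * log_r ^ 2 * sqrt (real (K * H))"
  let ?E = "{\<omega> \<in> space M. Gap \<omega> \<le> ?c}"
  have "Gap \<in> borel_measurable M" by (rule Gap_meas[OF observed_M])
  then have E: "?E \<in> sets M" by (rule borel_measurable_le) simp
  have L0: "0 \<le> log_r" using L by simp
  note fail = reward_fail_prob[OF L0] transition_fail_prob[OF K] excess_fail_prob[OF L0]
  \<comment> \<open>Outside the three failure events the bound holds, and their probabilities 2
    \<delta>, 2 \<delta> and \<delta> add up to 5 \<delta>. Measurability of the gap allows the
    passage to the complement.\<close>
  have "space M - ?E \<subseteq> reward_fail \<union> transition_fail \<union> excess_fail"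
  proof
    fix \<omega> assume w: "\<omega> \<in> space M - ?E"
    show "\<omega> \<in> reward_fail \<union> transition_fail \<union> excess_fail"
    proof (rule ccontr)
      assume "\<omega> \<notin> reward_fail \<union> transition_fail \<union> excess_fail"
      then have "Gap \<omega> \<le> ?c"
        using w L by (intro Gap_le_rate reward_accurateI transition_accurateI K bonus_sum_le) auto
      then show False using w by blast
    qed
  qed
  then have "prob (space M - ?E) \<le> prob (reward_fail \<union> transition_fail \<union> excess_fail)"
    using fail by (intro finite_measure_mono) auto
  also have "\<dots> \<le> prob (reward_fail \<union> transition_fail) + prob excess_fail"
    using fail by (intro measure_Un_le) auto
  also have "prob (reward_fail \<union> transition_fail) \<le> prob reward_fail + prob transition_fail"
    using fail by (intro measure_Un_le) auto
  finally have "prob (space M - ?E) \<le> 5 * \<delta>" using fail by linarith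
  then show ?thesis using prob_compl[OF E] by linarith
qed

end

theorem corollary5p3:
  "\<exists>(C::real) (p::nat) (q::nat).
     \<forall>(S::'s set) (A::'a set) (B::'b set) (H::nat) (s1::'s) P r (K::nat) (\<delta>::real)
      st ac bc rw (M::'w measure) F G.
       fictitious_play_run S A B H s1 P r K \<delta> st ac bc rw M F G \<longrightarrow>
       measure M {\<omega> \<in> space M.
          fictitious_play.Gap S A B H s1 P r K \<delta> st ac bc rw \<omega>
            \<le> C * (real (card S) * real (card A) * real (card B) * real H) ^ p
                * ln (real (card S) * real (card A) * real (card B) * real H * real K / \<delta>) ^ q
                * sqrt (real (K * H))}
         \<ge> 1 - 5 * \<delta>"
\<comment> \<open>The witnesses C = 300, p = 4 and q = 2 are chosen before the game and the run, as
  uniformity requires; the displayed goal instantiates them.\<close>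
proof (intro exI allI impI)
  fix S :: "'s set" and A :: "'a set" and B :: "'b set" and H :: nat and s1 :: 's
    and P r and K :: nat and \<delta> :: real and st ac bc rw and M :: "'w measure" and F G
  assume "fictitious_play_run S A B H s1 P r K \<delta> st ac bc rw M F G"
  then interpret fictitious_play_run S A B H s1 P r K \<delta> st ac bc rw M F G .
  show "measure M {\<omega> \<in> space M.
          fictitious_play.Gap S A B H s1 P r K \<delta> st ac bc rw \<omega>
            \<le> 300 * (real (card S) * real (card A) * real (card B) * real H) ^ 4
                * ln (real (card S) * real (card A) * real (card B) * real H * real K / \<delta>) ^ 2
                * sqrt (real (K * H))}
         \<ge> 1 - 5 * \<delta>"
    using Gap_rate_prob unfolding log_r_def .
qed

end
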